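(* Let $R>0$ and let $\mathbf{f}\in L_2(B_R;\mathcal{A};\mathbb{R})$ be monogenic in $B_R$ and orthogonal (with respect to the real inner product) to the non-trivial hyperholomorphic constants. Then for $0\le r<R$, $$\mathcal{M}(\mathbf{f}-\mathbf{f}(0),r)\le\sqrt{\tfrac23}\,\frac{2r\,A(r,R)}{(R-r)^4}\sup_{|\xi|<R}|\mathbf{Sc}\{\mathbf{f}(\xi)-\mathbf{f}(0)\}|,\qquad A(r,R)=(3R-r)(3R^2-Rr+r^2).$$
   Context: Quaternions $\mathbb{H}$ have basis $1,\mathbf{e}_1,\mathbf{e}_2,\mathbf{e}_3$ with Hamilton multiplication; $\mathbf{Sc}$ is the real part, conjugation flips the signs of the imaginary parts, $|\cdot|$ is the Euclidean norm. Reduced quaternions: $\mathcal{A}=\mathrm{span}_\mathbb{R}\{1,\mathbf{e}_1,\mathbf{e}_2\}$, with $x=(x_0,x_1,x_2)\in\mathbb{R}^3$ identified with $x_0+x_1\mathbf{e}_1+x_2\mathbf{e}_2$. $D=\partial_{x_0}+\mathbf{e}_1\partial_{x_1}+\mathbf{e}_2\partial_{x_2}$, $\overline{D}=\partial_{x_0}-\mathbf{e}_1\partial_{x_1}-\mathbf{e}_2\partial_{x_2}$; an $\mathcal{A}$-valued $C^1$ function is monogenic if $D\mathbf{f}=0$. $B_R$ is the open ball of radius $R$ centered at $0$; $L_2(B_R;\mathcal{A};\mathbb{R})$ carries the real inner product $\langle\mathbf{f},\mathbf{g}\rangle=\int_{B_R}\mathbf{Sc}(\overline{\mathbf{f}}\mathbf{g})\,dV$.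 $\mathcal{M}(\mathbf{f},r)=\max_{|x|=r}|\mathbf{f}(x)|$. Spherical coordinates $x_0=r\cos\theta_1$, $x_1=r\sin\theta_1\cos\theta_2$, $x_2=r\sin\theta_1\sin\theta_2$; $P^m_n(t)=(1-t^2)^{m/2}\frac{d^m}{dt^m}P_n(t)$, $T_k,U_k$ Chebyshev polynomials of first and second kind; $U^{n+1}_{n+1}=P^{n+1}_{n+1}(\cos\theta_1)T_{n+1}(\cos\theta_2)$, $V^{n+1}_{n+1}=P^{n+1}_{n+1}(\cos\theta_1)\sin\theta_2U_{n}(\cos\theta_2)$. The non-trivial hyperholomorphic constants are the polynomials $\mathbf{X}^{n+1,\dagger}_n:=\tfrac12\overline{D}(r^{n+1}U^{n+1}_{n+1})$ and $\mathbf{Y}^{n+1,\dagger}_n:=\tfrac12\overline{D}(r^{n+1}V^{n+1}_{n+1})$ for $n\ge1$; "orthogonal to the non-trivial hyperholomorphic constants" means $\langle\mathbf{f},\mathbf{X}^{n+1,\dagger}_n\rangle=\langle\mathbf{f},\mathbf{Y}^{n+1,\dagger}_n\rangle=0$ for all $n\ge1$. *)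

theory Defs
  imports "HOL-Analysis.Analysis" "HOL-Computational_Algebra.Polynomial"
begin

type_synonym quat = "real ^ 4"

definition Q :: "real \<Rightarrow> real \<Rightarrow> real \<Rightarrow> real \<Rightarrow> quat" where
  "Q a b c d = (\<chi> i. if i = 1 then a else if i = 2 then b else if i = 3 then c else d)"

definition qmult :: "quat \<Rightarrow> quat \<Rightarrow> quat" (infixl \<open>\<odot>\<close> 70) where
  "p \<odot> q = Q (p$1*q$1 - p$2*q$2 - p$3*q$3 - p$4*q$4)
              (p$1*q$2 + p$2*q$1 + p$3*q$4 - p$4*q$3)
              (p$1*q$3 - p$2*q$4 + p$3*q$1 + p$4*q$2)
              (p$1*q$4 + p$2*q$3 - p$3*q$2 + p$4*q$1)"

definition qconj :: "quat \<Rightarrow> quat" where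
  "qconj p = Q (p$1) (- p$2) (- p$3) (- p$4)"

definition Sc :: "quat \<Rightarrow> real" where
  "Sc p = p$1"

definition qreal :: "real \<Rightarrow> quat" where
  "qreal a = Q a 0 0 0"

definition qe1 :: quat where "qe1 = Q 0 1 0 0"
definition qe2 :: quat where "qe2 = Q 0 0 1 0"

text \<open>Points x = (x0,x1,x2) of R^3 are real^3 with x$1 = x0, x$2 = x1, x$3 = x2.
  The norm of real^4 is the Euclidean norm |.| of the quaternion.\<close>

definition partial :: "3 \<Rightarrow> (real^3 \<Rightarrow> quat) \<Rightarrow> real^3 \<Rightarrow> quat" where
  "partial i f x = frechet_derivative f (at x) (axis i 1)"

definition Dop :: "(real^3 \<Rightarrow> quat) \<Rightarrow> real^3 \<Rightarrow> quat" where
  "Dop f x = partial 1 f x + qe1 \<odot> partial 2 f x + qe2 \<odot> partial 3 f x"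

definition Dbar :: "(real^3 \<Rightarrow> quat) \<Rightarrow> real^3 \<Rightarrow> quat" where
  "Dbar f x = partial 1 f x - qe1 \<odot> partial 2 f x - qe2 \<odot> partial 3 f x"

text \<open>Reduced-quaternion (A-valued) functions on a set: e3-component vanishes.\<close>
definition A_valued_on :: "(real^3) set \<Rightarrow> (real^3 \<Rightarrow> quat) \<Rightarrow> bool" where
  "A_valued_on S f \<longleftrightarrow> (\<forall>x\<in>S. f x $ 4 = 0)"

definition C1_on :: "(real^3) set \<Rightarrow> (real^3 \<Rightarrow> quat) \<Rightarrow> bool" where
  "C1_on S f \<longleftrightarrow> (\<forall>x\<in>S. f differentiable (at x)) \<and> (\<forall>i. continuous_on S (partial i f))"

definition monogenic_on :: "(real^3) set \<Rightarrow> (real^3 \<Rightarrow> quat) \<Rightarrow> bool" where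
  "monogenic_on S f \<longleftrightarrow> A_valued_on S f \<and> C1_on S f \<and> (\<forall>x\<in>S. Dop f x = 0)"

definition L2_ball :: "real \<Rightarrow> (real^3 \<Rightarrow> quat) \<Rightarrow> bool" where
  "L2_ball R f \<longleftrightarrow> A_valued_on (ball 0 R) f \<and> set_borel_measurable lborel (ball 0 R) f
     \<and> set_integrable lborel (ball 0 R) (\<lambda>x. (norm (f x))\<^sup>2)"

definition L2_inner :: "real \<Rightarrow> (real^3 \<Rightarrow> quat) \<Rightarrow> (real^3 \<Rightarrow> quat) \<Rightarrow> real" where
  "L2_inner R f g = (LINT x:ball 0 R|lborel. Sc (qconj (f x) \<odot> g x))"

text \<open>Legendre polynomials via Rodrigues' formula.\<close>
definition legendre :: "nat \<Rightarrow> real poly" where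
  "legendre n = smult (1 / (2 ^ n * fact n)) ((pderiv ^^ n) ([:-1, 0, 1:] ^ n))"

definition assoc_legendre :: "nat \<Rightarrow> nat \<Rightarrow> real \<Rightarrow> real" where
  "assoc_legendre m n t = (1 - t\<^sup>2) powr (real m / 2) * poly ((pderiv ^^ m) (legendre n)) t"

fun chebT :: "nat \<Rightarrow> real \<Rightarrow> real" where
  "chebT 0 t = 1"
| "chebT (Suc 0) t = t"
| "chebT (Suc (Suc k)) t = 2 * t * chebT (Suc k) t - chebT k t"

fun chebU :: "nat \<Rightarrow> real \<Rightarrow> real" where
  "chebU 0 t = 1"
| "chebU (Suc 0) t = 2 * t"
| "chebU (Suc (Suc k)) t = 2 * t * chebU (Suc k) t - chebU k t"

text \<open>Spherical coordinates: x0 = r cos th1, x1 = r sin th1 cos th2, x2 = r sin th1 sin th2.\<close>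
definition theta1 :: "real^3 \<Rightarrow> real" where
  "theta1 x = arccos (x$1 / norm x)"

definition theta2 :: "real^3 \<Rightarrow> real" where
  "theta2 x = Arg (Complex (x$2) (x$3))"

definition UU :: "nat \<Rightarrow> real^3 \<Rightarrow> real" where
  "UU n x = assoc_legendre (n+1) (n+1) (cos (theta1 x)) * chebT (n+1) (cos (theta2 x))"

definition VV :: "nat \<Rightarrow> real^3 \<Rightarrow> real" where
  "VV n x = assoc_legendre (n+1) (n+1) (cos (theta1 x)) * sin (theta2 x) * chebU n (cos (theta2 x))"

text \<open>Non-trivial hyperholomorphic constants X^{n+1,dagger}_n and Y^{n+1,dagger}_n.\<close>
definition Xdag :: "nat \<Rightarrow> real^3 \<Rightarrow> quat" where
  "Xdag n x = (1/2) *\<^sub>R Dbar (\<lambda>y. qreal (norm y ^ (n+1) * UU n y)) x"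

definition Ydag :: "nat \<Rightarrow> real^3 \<Rightarrow> quat" where
  "Ydag n x = (1/2) *\<^sub>R Dbar (\<lambda>y. qreal (norm y ^ (n+1) * VV n y)) x"

definition maxmod :: "(real^3 \<Rightarrow> quat) \<Rightarrow> real \<Rightarrow> real" where
  "maxmod f r = (SUP x\<in>sphere 0 r. norm (f x))"

definition Acoef :: "real \<Rightarrow> real \<Rightarrow> real" where
  "Acoef r R = (3*R - r) * (3*R\<^sup>2 - R*r + r\<^sup>2)"

end

theory Submission
  imports Defs
begin

text \<open>
  Scale to \<open>R = 1\<close> and write \<open>f = f\<^sub>0 + f\<^sub>1 e\<^sub>1 + f\<^sub>2 e\<^sub>2\<close>. Then \<open>v = (f\<^sub>0, -f\<^sub>1, -f\<^sub>2)\<close> is a Riesz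
  system (its Jacobian is symmetric and trace-free), hence harmonic, and it is the sum of
  homogeneous Riesz systems \<open>v\<^sup>n\<close>. The Euler operator is symmetric on harmonic functions for the inner
  product of every ball, so different degrees are orthogonal; testing \<open>f\<^sub>0 - f\<^sub>0(0)\<close> against its own
  degree \<open>n\<close> part \<open>h\<close> bounds the \<open>L\<^sub>2\<close> norm of \<open>h\<close>, and by the mean value property \<open>sup |grad h|\<close> on the
  sphere, by a constant times \<open>sup |f\<^sub>0 - f\<^sub>0(0)|\<close>. Put \<open>z = x\<^sub>1 + i x\<^sub>2\<close> and let \<open>W\<close> be the complex
  combination of the last two components of \<open>v\<^sup>n\<close>. Along the rotations \<open>rot t\<close> about the real axis
  the derivative of \<open>e\<^sup>-\<^sup>i\<^sup>n\<^sup>t W\<close> only involves the tangential gradient of \<open>h\<close>, and the mean of this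
  function is a multiple of \<open>z\<^sup>n\<close>, which orthogonality to the hyperholomorphic constants forces to
  vanish. Hence \<open>|W| \<le> (\<pi>/2) sup |grad h|\<close>. The resulting bound for \<open>|v\<^sup>n|\<close> is
  \<open>\<surd>(2/3) (2n+1)(n+1)(n+2) r\<^sup>n sup |f\<^sub>0 - f\<^sub>0(0)|\<close>, and these constants are the power series coefficients
  of the function of \<open>r\<close> in the theorem.
\<close>

section \<open>Partial derivatives and functions of class C1\<close>

text \<open>The scalar part does not determine a homogeneous Riesz system. If the first component
  vanishes, symmetry makes the other two independent of \<open>x$1\<close>, and
  \<open>v 2 - i v 3\<close> is holomorphic in \<open>z\<close>, hence a multiple of
  \<open>z^n\<close>. Removing this kernel is what the orthogonality is for. As \<open>f\<close> is
  only C1, its components are not harmonic by definition: a mean value formula that uses first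
  derivatives alone has to come before any Laplacian. All integrals are over solid balls. A weight
  that vanishes on the boundary replaces the boundary terms in integrations by parts, and thin
  shells with a limit of radii replace integrals over spheres. Since nothing is known at the
  boundary of the ball, identities are proved at radii below \<open>1\<close> and the limit comes
  last. The estimates do not produce the constants of the theorem. They bound the square of the
  degree \<open>n\<close> constant by
  \<open>15 (1/n^2 + pi^2/4) (1 + 2/n)^(2n+3) / ((2/n)^5 (2n+3))\<close>, of order
  \<open>n^4\<close>, while the square of the target \<open>sqrt(2/3) (2n+1)(n+1)(n+2)\<close> has
  order \<open>n^6\<close>. This gap pays for the crude gradient estimate.\<close>

definition pd :: "3 \<Rightarrow> (real^3 \<Rightarrow> real) \<Rightarrow> real^3 \<Rightarrow> real" where
  "pd i h x = frechet_derivative h (at x) (axis i 1)"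

definition C1 :: "(real^3) set \<Rightarrow> (real^3 \<Rightarrow> real) \<Rightarrow> bool" where
  "C1 U h \<longleftrightarrow> (\<forall>x\<in>U. h differentiable at x) \<and> (\<forall>i. continuous_on U (pd i h))"

lemma C1_continuous_pd: "C1 U h \<Longrightarrow> continuous_on U (pd i h)"
  by (simp add: C1_def)

lemma C1_continuous: "C1 U h \<Longrightarrow> continuous_on U h"
  by (meson C1_def continuous_at_imp_continuous_on differentiable_imp_continuous_within)

lemma C1_subset: "C1 U h \<Longrightarrow> V \<subseteq> U \<Longrightarrow> C1 V h"
  unfolding C1_def by (meson continuous_on_subset subsetD)

lemma has_derivative_pd:
  assumes "h differentiable at x"
  shows "(h has_derivative (\<lambda>v. \<Sum>i\<in>UNIV. v$i * pd i h x)) (at x)"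
proof -
  let ?D = "frechet_derivative h (at x)"
  have D: "(h has_derivative ?D) (at x)"
    using assms frechet_derivative_works by blast
  then have lin: "linear ?D"
    by (simp add: has_derivative_linear)
  have "?D v = (\<Sum>i\<in>UNIV. v$i * pd i h x)" for v
  proof -
    have "?D v = ?D (\<Sum>i\<in>UNIV. v$i *\<^sub>R axis i 1)"
      using basis_expansion[of v] by (simp add: scalar_mult_eq_scaleR)
    also have "\<dots> = (\<Sum>i\<in>UNIV. v$i * pd i h x)"
      by (simp add: linear_sum[OF lin] linear_cmul[OF lin] pd_def)
    finally show ?thesis .
  qed
  then have "?D = (\<lambda>v. \<Sum>i\<in>UNIV. v$i * pd i h x)" by (rule ext)
  with D show ?thesis by (simp only:)
qed

lemma C1_has_derivative:
  "C1 U h \<Longrightarrow> x \<in> U \<Longrightarrow> (h has_derivative (\<lambda>v. \<Sum>i\<in>UNIV. v$i * pd i h x)) (at x)"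
  by (simp add: C1_def has_derivative_pd)

lemma pd_eqI:
  assumes "(h has_derivative D) (at x)"
  shows "pd i h x = D (axis i 1)"
  using assms frechet_derivative_at by (fastforce simp: pd_def)

lemma sum_axis [simp]: "(\<Sum>j\<in>UNIV. (axis i (1::real) :: real^3) $ j * g j) = g i"
proof -
  have "(axis i (1::real) :: real^3) $ j * g j = (if j = i then g j else 0)" for j
    by (simp add: axis_def)
  then show ?thesis by simp
qed

lemma C1I:
  assumes "\<And>x. x \<in> U \<Longrightarrow> (h has_derivative (\<lambda>v. \<Sum>i\<in>UNIV. v$i * g i x)) (at x)"
    and "\<And>i. continuous_on U (g i)"
  shows "C1 U h" "\<And>x i. x \<in> U \<Longrightarrow> pd i h x = g i x"
proof -
  show *: "pd i h x = g i x" if "x \<in> U" for x i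
    using pd_eqI[OF assms(1)[OF that]] by simp
  show "C1 U h"
    unfolding C1_def using assms * by (auto simp: differentiable_def cong: continuous_on_cong)
qed

lemma has_derivative_cong_open:
  assumes "open U" "x \<in> U" "\<And>y. y \<in> U \<Longrightarrow> f y = g y" "(f has_derivative D) (at x)"
  shows "(g has_derivative D) (at x)"
  by (rule has_derivative_transform_within_open[OF assms(4,1,2)]) (use assms(3) in auto)

text \<open>\<open>frechet_derivative\<close> is a choice from the derivatives at a point, so it
  suffices that both functions have the same derivatives, and this also covers points without
  any.\<close>

lemma pd_cong:
  assumes "open U" "x \<in> U" "\<And>y. y \<in> U \<Longrightarrow> f y = g y"
  shows "pd i f x = pd i g x"
proof -
  have "(f has_derivative D) (at x) \<longleftrightarrow> (g has_derivative D) (at x)" for D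
  proof
    assume "(f has_derivative D) (at x)"
    then show "(g has_derivative D) (at x)" using has_derivative_cong_open[OF assms(1,2), of f g D] assms(3) by blast
  next
    assume "(g has_derivative D) (at x)"
    then show "(f has_derivative D) (at x)"
      using has_derivative_cong_open[OF assms(1,2), of g f D] assms(3) by simp
  qed
  then show ?thesis by (simp add: pd_def frechet_derivative_def)
qed

lemma C1_cong:
  assumes "open U" "\<And>y. y \<in> U \<Longrightarrow> f y = g y" "C1 U f"
  shows "C1 U g"
proof (rule C1I)
  fix x assume "x \<in> U"
  with assms show "(g has_derivative (\<lambda>v. \<Sum>i\<in>UNIV. v$i * pd i f x)) (at x)"
    by (intro has_derivative_cong_open[OF assms(1) _ assms(2)] C1_has_derivative) auto
qed (use assms C1_continuous_pd in auto)

lemma pd_const [simp]: "pd i (\<lambda>x. c) = (\<lambda>x. 0)"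
  by (rule ext) (use pd_eqI[OF has_derivative_const] in auto)

lemma C1_const [simp]: "C1 U (\<lambda>x. c)"
  by (simp add: C1_def)

lemma pd_coord: "pd i (\<lambda>x. x$j) = (\<lambda>x. if i = j then 1 else 0)"
proof
  fix x
  have "((\<lambda>x::real^3. x$j) has_derivative (\<lambda>v. v$j)) (at x)"
    by (intro bounded_linear_imp_has_derivative bounded_linear_vec_nth)
  from pd_eqI[OF this] show "pd i (\<lambda>x. x$j) x = (if i = j then 1 else 0)"
    by (simp add: axis_def)
qed

lemma differentiable_coord [simp]: "(\<lambda>x::real^3. x$j) differentiable at x"
  using differentiable_def bounded_linear_imp_has_derivative bounded_linear_vec_nth by blast

lemma C1_coord [simp]: "C1 U (\<lambda>x. x$j)"
  by (simp add: C1_def pd_coord)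

lemma pd_add:
  assumes "f differentiable at x" "g differentiable at x"
  shows "pd i (\<lambda>x. f x + g x) x = pd i f x + pd i g x"
  using pd_eqI[OF has_derivative_add[OF has_derivative_pd[OF assms(1)] has_derivative_pd[OF assms(2)]]]
  by simp

lemma pd_mult:
  assumes "f differentiable at x" "g differentiable at x"
  shows "pd i (\<lambda>x. f x * g x) x = f x * pd i g x + pd i f x * g x"
  using pd_eqI[OF has_derivative_mult[OF has_derivative_pd[OF assms(1)] has_derivative_pd[OF assms(2)]]]
  by simp

lemma pd_cmult:
  assumes "f differentiable at x"
  shows "pd i (\<lambda>x. c * f x) x = c * pd i f x"
  using pd_mult[OF _ assms, of "\<lambda>x. c"] by simp

lemma pd_minus:
  assumes "f differentiable at x"
  shows "pd i (\<lambda>x. - f x) x = - pd i f x"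
  using pd_cmult[OF assms, of i "-1"] by simp

lemma pd_diff:
  assumes "f differentiable at x" "g differentiable at x"
  shows "pd i (\<lambda>x. f x - g x) x = pd i f x - pd i g x"
  using pd_add[of f x "\<lambda>x. - g x" i] assms by (simp add: pd_minus)

lemma pd_sum:
  assumes "finite A" "\<And>a. a \<in> A \<Longrightarrow> f a differentiable at x"
  shows "pd i (\<lambda>x. \<Sum>a\<in>A. f a x) x = (\<Sum>a\<in>A. pd i (f a) x)"
  using assms
proof (induction A rule: finite_induct)
  case (insert a A)
  have "(\<lambda>x. \<Sum>a\<in>A. f a x) differentiable at x"
    using insert by (intro differentiable_sum) auto
  then show ?case using insert by (simp add: pd_add)
qed simp

lemma pd_affine:
  assumes "f differentiable at (a + t *\<^sub>R x)"
  shows "pd i (\<lambda>x. f (a + t *\<^sub>R x)) x = t * pd i f (a + t *\<^sub>R x)"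
    and "(\<lambda>x. f (a + t *\<^sub>R x)) differentiable at x"
proof -
  have "((\<lambda>x. a + t *\<^sub>R x) has_derivative (\<lambda>v. t *\<^sub>R v)) (at x)"
    by (auto intro!: derivative_eq_intros)
  from has_derivative_compose[OF this has_derivative_pd[OF assms]]
  have D: "((\<lambda>x. f (a + t *\<^sub>R x)) has_derivative
      (\<lambda>v. \<Sum>i\<in>UNIV. (t *\<^sub>R v)$i * pd i f (a + t *\<^sub>R x))) (at x)" .
  then show "(\<lambda>x. f (a + t *\<^sub>R x)) differentiable at x"
    by (auto simp: differentiable_def)
  have "(\<Sum>j\<in>UNIV. (t *\<^sub>R axis i (1::real) :: real^3)$j * pd j f (a + t *\<^sub>R x))
     = t * (\<Sum>j\<in>UNIV. (axis i (1::real) :: real^3)$j * pd j f (a + t *\<^sub>R x))"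
    by (simp only: sum_distrib_left vector_scaleR_component real_scaleR_def mult.assoc)
  then show "pd i (\<lambda>x. f (a + t *\<^sub>R x)) x = t * pd i f (a + t *\<^sub>R x)"
    using pd_eqI[OF D, of i] by simp
qed

lemma C1_differentiable: "C1 U h \<Longrightarrow> x \<in> U \<Longrightarrow> h differentiable at x"
  by (simp add: C1_def)

lemma C1_add [intro]:
  assumes "C1 U f" "C1 U g"
  shows "C1 U (\<lambda>x. f x + g x)"
proof -
  have "continuous_on U (pd i (\<lambda>x. f x + g x)) \<longleftrightarrow> continuous_on U (\<lambda>x. pd i f x + pd i g x)" for i
    by (rule continuous_on_cong) (use assms in \<open>auto simp: pd_add C1_def\<close>)
  then show ?thesis using assms by (auto simp: C1_def intro!: continuous_intros)
qed

lemma C1_mult [intro]: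
  assumes "C1 U f" "C1 U g"
  shows "C1 U (\<lambda>x. f x * g x)"
proof -
  have "continuous_on U (pd i (\<lambda>x. f x * g x)) \<longleftrightarrow> continuous_on U (\<lambda>x. f x * pd i g x + pd i f x * g x)" for i
    by (rule continuous_on_cong) (use assms in \<open>auto simp: pd_mult C1_def\<close>)
  then show ?thesis using assms C1_continuous[OF assms(1)] C1_continuous[OF assms(2)]
    by (auto simp: C1_def intro!: continuous_intros)
qed

lemma C1_cmult [intro]: "C1 U f \<Longrightarrow> C1 U (\<lambda>x. c * f x)"
  by (rule C1_mult) auto

lemma C1_minus [intro]: "C1 U f \<Longrightarrow> C1 U (\<lambda>x. - f x)"
  using C1_cmult[of U f "-1"] by simp

lemma C1_diff [intro]: "C1 U f \<Longrightarrow> C1 U g \<Longrightarrow> C1 U (\<lambda>x. f x - g x)"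
  using C1_add[of U f "\<lambda>x. - g x"] by (simp add: C1_minus)

lemma C1_sum [intro]: "finite A \<Longrightarrow> (\<And>a. a \<in> A \<Longrightarrow> C1 U (f a)) \<Longrightarrow> C1 U (\<lambda>x. \<Sum>a\<in>A. f a x)"
  by (induction A rule: finite_induct) auto

lemma C1_affine:
  assumes "C1 U f" "\<And>x. x \<in> V \<Longrightarrow> a + t *\<^sub>R x \<in> U"
  shows "C1 V (\<lambda>x. f (a + t *\<^sub>R x))"
proof -
  have "continuous_on V (pd i (\<lambda>x. f (a + t *\<^sub>R x))) \<longleftrightarrow> continuous_on V (\<lambda>x. t * pd i f (a + t *\<^sub>R x))" for i
    by (rule continuous_on_cong) (use assms in \<open>auto simp: pd_affine C1_def\<close>)
  moreover have "continuous_on V (\<lambda>x. t * pd i f (a + t *\<^sub>R x))" for i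
    by (intro continuous_intros continuous_on_compose2[OF C1_continuous_pd[OF assms(1)]])
      (use assms(2) in auto)
  ultimately show ?thesis using assms by (auto simp: C1_def pd_affine)
qed

lemma C1_curve:
  assumes "C1 U h" "\<gamma> t \<in> U" "(\<gamma> has_vector_derivative \<gamma>') (at t within T)"
  shows "((\<lambda>t. h (\<gamma> t)) has_real_derivative (\<Sum>i\<in>UNIV. \<gamma>'$i * pd i h (\<gamma> t))) (at t within T)"
proof -
  have "((\<lambda>t. h (\<gamma> t)) has_derivative (\<lambda>s. \<Sum>i\<in>UNIV. (s *\<^sub>R \<gamma>')$i * pd i h (\<gamma> t))) (at t within T)"
    by (rule has_derivative_compose[OF assms(3)[unfolded has_vector_derivative_def]
          C1_has_derivative[OF assms(1,2)]])
  moreover have "(\<lambda>s. \<Sum>i\<in>UNIV. (s *\<^sub>R \<gamma>')$i * pd i h (\<gamma> t))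
     = (*) (\<Sum>i\<in>UNIV. \<gamma>'$i * pd i h (\<gamma> t))"
    by (simp add: fun_eq_iff sum_distrib_left mult_ac)
  ultimately show ?thesis
    by (simp add: has_field_derivative_def)
qed

section \<open>Integrals over balls\<close>

lemma set_integrable_compact:
  fixes f :: "'a::euclidean_space \<Rightarrow> real"
  assumes "compact K" "continuous_on K f"
  shows "set_integrable lborel K f"
  unfolding set_integrable_def using borel_integrable_compact[OF assms]
  by (simp add: indicator_scaleR_eq_if)

text \<open>Compactness of \<open>K\<close> makes \<open>g x y\<close> close to
  \<open>g x0 y\<close> for all \<open>y\<close> at once when \<open>x\<close> is near
  \<open>x0\<close>, so the integrand is linearised at \<open>x0\<close> uniformly in
  \<open>y\<close>.\<close>

lemma leibniz_compact:
  fixes f :: "'a::euclidean_space \<Rightarrow> 'b::euclidean_space \<Rightarrow> real" and g :: "'a \<Rightarrow> 'b \<Rightarrow> 'a"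
  assumes K: "compact K" and T: "open T" "x0 \<in> T"
    and der: "\<And>x y. x \<in> T \<Longrightarrow> y \<in> K \<Longrightarrow> ((\<lambda>x. f x y) has_derivative (\<lambda>v. v \<bullet> g x y)) (at x)"
    and cf: "\<And>x. x \<in> T \<Longrightarrow> continuous_on K (f x)"
    and cg: "continuous_on (T \<times> K) (\<lambda>(x,y). g x y)"
  shows "((\<lambda>x. LINT y:K|lborel. f x y) has_derivative (\<lambda>v. LINT y:K|lborel. v \<bullet> g x0 y)) (at x0)"
proof -
  have cg': "continuous_on K (g x)" if "x \<in> T" for x
  proof -
    have "continuous_on K (\<lambda>y. (x, y))" by (intro continuous_intros)
    from continuous_on_compose2[OF cg this] that show ?thesis by (auto simp: image_subset_iff)
  qed
  have ig: "set_integrable lborel K (\<lambda>y. v \<bullet> g x0 y)" for v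
    by (intro set_integrable_compact K continuous_intros cg' T)
  have bl: "bounded_linear (\<lambda>v. LINT y:K|lborel. v \<bullet> g x0 y)"
    unfolding linear_conv_bounded_linear[symmetric]
  proof (rule linearI)
    fix a b :: 'a and k :: real
    show "(LINT y:K|lborel. (a + b) \<bullet> g x0 y) = (LINT y:K|lborel. a \<bullet> g x0 y) + (LINT y:K|lborel. b \<bullet> g x0 y)"
      using set_integral_add(2)[OF ig[of a] ig[of b]] by (simp add: inner_add_left)
    show "(LINT y:K|lborel. (k *\<^sub>R a) \<bullet> g x0 y) = k *\<^sub>R (LINT y:K|lborel. a \<bullet> g x0 y)"
      by simp
  qed
  have "\<exists>d>0. \<forall>y. norm (y - x0) < d \<longrightarrow>
         norm ((LINT z:K|lborel. f y z) - (LINT z:K|lborel. f x0 z) - (LINT z:K|lborel. (y - x0) \<bullet> g x0 z))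
           \<le> e * norm (y - x0)" if e: "e > 0" for e
  proof -
    \<comment> \<open>Adding one keeps \<open>M\<close> positive when \<open>K\<close> is a null
      set.\<close>
    define M where "M = measure lborel K + 1"
    have M: "M > 0" by (simp add: M_def add_nonneg_pos)
    have eM: "e / M > 0" using e M by simp
    obtain X where X: "x0 \<in> X" "open X"
      and "\<forall>x\<in>X \<inter> T. \<forall>z\<in>K. dist ((\<lambda>(x,y). g x y) (x, z)) ((\<lambda>(x,y). g x y) (x0, z)) \<le> e / M"
      by (rule continuous_on_prod_compactE[OF cg K T(2) eM])
    then have dd: "dist (g x z) (g x0 z) \<le> e / M" if "x \<in> X \<inter> T" "z \<in> K" for x z
      using that by auto
    obtain d where d: "d > 0" "ball x0 d \<subseteq> X \<inter> T"
      using X T open_contains_ball[of "X \<inter> T"] by blast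
    have key: "\<bar>f y z - f x0 z - (y - x0) \<bullet> g x0 z\<bar> \<le> e / M * norm (y - x0)"
      if y: "norm (y - x0) < d" and z: "z \<in> K" for y z
    proof -
      let ?B = "ball x0 d"
      \<comment> \<open>Subtracting the linear part at \<open>x0\<close> leaves a function with
        derivative at most \<open>e / M\<close> on the ball, to which the mean value inequality
        applies.\<close>
      let ?h = "\<lambda>x. f x z - x \<bullet> g x0 z"
      have sub: "x \<in> T" "x \<in> X \<inter> T" if "x \<in> ?B" for x
        using that d by auto
      have "norm (?h y - ?h x0) \<le> e / M * norm (y - x0)"
      proof (rule differentiable_bound)
        show "convex ?B" by simp
        show "(?h has_derivative (\<lambda>v. v \<bullet> g x z - v \<bullet> g x0 z)) (at x within ?B)" if "x \<in> ?B" for x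
          by (intro has_derivative_diff has_derivative_at_withinI[OF der[OF sub(1)[OF that] z]]
              has_derivative_inner_left has_derivative_ident)
        show "onorm (\<lambda>v. v \<bullet> g x z - v \<bullet> g x0 z) \<le> e / M" if "x \<in> ?B" for x
        proof (rule onorm_le)
          fix v
          have "norm (g x z - g x0 z) \<le> e / M"
            using dd[OF sub(2)[OF that] z] by (simp add: dist_norm)
          then have "\<bar>v \<bullet> (g x z - g x0 z)\<bar> \<le> norm v * (e / M)"
            by (metis Cauchy_Schwarz_ineq2 dual_order.trans mult_left_mono norm_ge_zero)
          then show "norm (v \<bullet> g x z - v \<bullet> g x0 z) \<le> e / M * norm v"
            by (simp add: inner_diff_right mult.commute)
        qed
        show "y \<in> ?B" "x0 \<in> ?B" using y d by (auto simp: dist_norm norm_minus_commute)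
      qed
      moreover have "?h y - ?h x0 = f y z - f x0 z - (y - x0) \<bullet> g x0 z"
        by (simp add: inner_diff_left)
      ultimately show ?thesis by simp
    qed
    show ?thesis
    proof (intro exI[of _ d] conjI allI impI)
      show "0 < d" by (rule d(1))
      fix y assume y: "norm (y - x0) < d"
      then have yT: "y \<in> T" using d by (auto simp: dist_norm norm_minus_commute subset_iff)
      have i1: "set_integrable lborel K (f y)" "set_integrable lborel K (f x0)"
        using set_integrable_compact[OF K] cf yT T by auto
      have i2: "set_integrable lborel K (\<lambda>z. f y z - f x0 z - (y - x0) \<bullet> g x0 z)"
        by (intro set_integral_diff(1) i1 ig)
      have "(LINT z:K|lborel. f y z) - (LINT z:K|lborel. f x0 z) - (LINT z:K|lborel. (y - x0) \<bullet> g x0 z)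
          = (LINT z:K|lborel. f y z - f x0 z - (y - x0) \<bullet> g x0 z)"
        by (simp add: set_integral_diff i1 ig)
      also have "norm \<dots> \<le> (LINT z:K|lborel. norm (f y z - f x0 z - (y - x0) \<bullet> g x0 z))"
        using set_integral_norm_bound[OF i2] .
      also have "\<dots> \<le> (LINT z:K|lborel. e / M * norm (y - x0))"
      proof (rule set_integral_mono)
        show "set_integrable lborel K (\<lambda>z. norm (f y z - f x0 z - (y - x0) \<bullet> g x0 z))"
          using set_integrable_norm[OF i2] .
        show "set_integrable lborel K (\<lambda>z. e / M * norm (y - x0))"
          by (intro set_integrable_compact K continuous_intros)
      qed (use key[OF y] in auto)
      also have "\<dots> = measure lborel K * (e / M * norm (y - x0))"
        using borel_compact[OF K] emeasure_bounded_finite[OF compact_imp_bounded[OF K]]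
        by (subst set_integral_const) auto
      also have "\<dots> \<le> M * (e / M * norm (y - x0))"
        using e M by (intro mult_right_mono) (auto simp: M_def)
      also have "\<dots> = e * norm (y - x0)" using M by simp
      finally show "norm ((LINT z:K|lborel. f y z) - (LINT z:K|lborel. f x0 z) - (LINT z:K|lborel. (y - x0) \<bullet> g x0 z))
           \<le> e * norm (y - x0)" .
    qed
  qed
  with bl show ?thesis unfolding has_derivative_at_alt by blast
qed

lemma leibniz_compact_real:
  fixes f :: "real \<Rightarrow> 'b::euclidean_space \<Rightarrow> real"
  assumes K: "compact K" and T: "open T" "x0 \<in> T"
    and der: "\<And>x y. x \<in> T \<Longrightarrow> y \<in> K \<Longrightarrow> ((\<lambda>x. f x y) has_real_derivative g x y) (at x)"
    and cf: "\<And>x. x \<in> T \<Longrightarrow> continuous_on K (f x)"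
    and cg: "continuous_on (T \<times> K) (\<lambda>(x,y). g x y)"
  shows "((\<lambda>x. LINT y:K|lborel. f x y) has_real_derivative (LINT y:K|lborel. g x0 y)) (at x0)"
proof -
  have "((\<lambda>x. LINT y:K|lborel. f x y) has_derivative (\<lambda>v. LINT y:K|lborel. v \<bullet> g x0 y)) (at x0)"
  proof (rule leibniz_compact[OF K T _ cf cg])
    fix x y assume "x \<in> T" "y \<in> K"
    moreover have "(\<lambda>v. v \<bullet> g x y) = (*) (g x y)" by (auto simp: mult.commute)
    ultimately show "((\<lambda>x. f x y) has_derivative (\<lambda>v. v \<bullet> g x y)) (at x)"
      using der[of x y] by (simp only: has_field_derivative_def)
  qed
  moreover have "(\<lambda>v. LINT y:K|lborel. v \<bullet> g x0 y) = (*) (LINT y:K|lborel. g x0 y)"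
    by (auto simp: mult.commute)
  ultimately show ?thesis by (simp add: has_field_derivative_def)
qed

lemma lborel_integral_affine:
  fixes F :: "real^3 \<Rightarrow> real"
  assumes t: "t > 0" and F: "F \<in> borel_measurable borel"
  shows "integral\<^sup>L lborel F = t^3 * integral\<^sup>L lborel (\<lambda>y. F (x + t *\<^sub>R y))"
proof -
  have "integral\<^sup>L lborel F
      = integral\<^sup>L (density (distr lborel borel (\<lambda>y. x + t *\<^sub>R y)) (\<lambda>_. ennreal (t^3))) F"
    using lborel_affine[of t x] t by (simp add: ennreal_power)
  also have "\<dots> = integral\<^sup>L (distr lborel borel (\<lambda>y. x + t *\<^sub>R y)) (\<lambda>z. t^3 *\<^sub>R F z)"
    by (rule integral_density) (use t F in auto)
  also have "\<dots> = integral\<^sup>L lborel (\<lambda>y. t^3 *\<^sub>R F (x + t *\<^sub>R y))"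
    by (rule integral_distr) (use F in auto)
  finally show ?thesis by simp
qed

lemma borel_measurable_cont_indicator:
  fixes f :: "'a::euclidean_space \<Rightarrow> real"
  assumes "compact K" "continuous_on K f"
  shows "(\<lambda>x. indicat_real K x * f x) \<in> borel_measurable borel"
  using borel_measurable_continuous_on_indicator[OF _ assms(2)] assms(1)
  by (simp add: borel_compact)

lemma lint_cball_affine:
  fixes f :: "real^3 \<Rightarrow> real"
  assumes t: "t > 0" and f: "continuous_on (cball x (t * c)) f"
  shows "(LINT z:cball x (t * c)|lborel. f z) = t^3 * (LINT y:cball 0 c|lborel. f (x + t *\<^sub>R y))"
proof -
  have "indicat_real (cball x (t * c)) (x + t *\<^sub>R y) = indicat_real (cball 0 c) y" for y :: "real^3"
    using t by (auto simp: indicator_def dist_norm)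
  then show ?thesis
    unfolding set_lebesgue_integral_def
    using lborel_integral_affine[OF t borel_measurable_cont_indicator[OF _ f], of x] by simp
qed

lemma lborel_integral_translation:
  fixes F :: "real^3 \<Rightarrow> real"
  assumes "F \<in> borel_measurable borel"
  shows "integral\<^sup>L lborel (\<lambda>y. F (y + a)) = integral\<^sup>L lborel F"
  using lborel_integral_affine[of 1 F a] assms by (simp add: add.commute)

text \<open>Volumes of boxes determine Lebesgue measure, and the preimage of a box under
  \<open>g\<close> is its image under the orthogonal map \<open>inv g\<close>, which preserves
  volume.\<close>

lemma lborel_orthogonal:
  fixes g :: "real^3 \<Rightarrow> real^3"
  assumes g: "orthogonal_transformation g"
  shows "lborel = distr lborel borel g"
proof (rule lborel_eqI)
  have lin: "linear g" using g by (simp add: orthogonal_transformation_linear)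
  have meas: "g \<in> borel_measurable borel"
    by (intro borel_measurable_continuous_onI linear_continuous_on linear_conv_bounded_linear[THEN iffD1] lin)
  have ig: "orthogonal_transformation (inv g)"
    using g by (rule orthogonal_transformation_inv)
  fix l u :: "real^3"
  assume lu: "\<And>b. b \<in> Basis \<Longrightarrow> l \<bullet> b \<le> u \<bullet> b"
  have vim: "g -` box l u = inv g ` box l u"
    using orthogonal_transformation_bij[OF g] by (simp add: bij_vimage_eq_inv_image)
  have lm: "box l u \<in> lmeasurable" by simp
  have bo: "g -` box l u \<in> sets borel"
    using measurable_sets[OF meas, of "box l u"] by simp
  have fin: "g -` box l u \<in> lmeasurable"
    unfolding vim by (rule measurable_orthogonal_image[OF ig lm])
  have "emeasure (distr lborel borel g) (box l u) = emeasure lborel (g -` box l u)"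
    by (subst emeasure_distr) (use meas in auto)
  also have "\<dots> = emeasure lebesgue (g -` box l u)"
    using bo by simp
  also have "\<dots> = ennreal (measure lebesgue (g -` box l u))"
    by (rule emeasure_eq_ennreal_measure[OF fmeasurableD2[OF fin]])
  also have "measure lebesgue (g -` box l u) = measure lebesgue (box l u)"
    unfolding vim by (rule measure_orthogonal_image[OF ig lm])
  also have "ennreal \<dots> = emeasure lborel (box l u)"
    using lm by (simp add: emeasure_eq_ennreal_measure fmeasurable_def)
  also have "\<dots> = ennreal (\<Prod>b\<in>Basis. (u - l) \<bullet> b)"
    using lu by (rule emeasure_lborel_box)
  finally show "emeasure (distr lborel borel g) (box l u) = ennreal (\<Prod>b\<in>Basis. (u - l) \<bullet> b)" .
qed simp

text \<open>Closed balls are compact, so continuity alone gives integrability; functions given on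
  the open unit ball are integrated over radii below \<open>1\<close>.\<close>

definition bint :: "real \<Rightarrow> (real^3 \<Rightarrow> real) \<Rightarrow> real" where
  "bint c f = (LINT y:cball 0 c|lborel. f y)"

lemma bint_integrable: "continuous_on (cball 0 c) f \<Longrightarrow> set_integrable lborel (cball 0 c) (f :: real^3 \<Rightarrow> real)"
  by (simp add: set_integrable_compact)

lemma bint_cong: "(\<And>y. y \<in> cball 0 c \<Longrightarrow> f y = g y) \<Longrightarrow> bint c f = bint c g"
  unfolding bint_def by (rule set_lebesgue_integral_cong) auto

lemma bint_add:
  assumes "continuous_on (cball 0 c) f" "continuous_on (cball 0 c) g"
  shows "bint c (\<lambda>y. f y + g y) = bint c f + bint c g"
  unfolding bint_def using assms by (simp add: set_integral_add bint_integrable)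

lemma bint_diff:
  assumes "continuous_on (cball 0 c) f" "continuous_on (cball 0 c) g"
  shows "bint c (\<lambda>y. f y - g y) = bint c f - bint c g"
  unfolding bint_def using assms by (simp add: set_integral_diff bint_integrable)

lemma bint_cmult: "bint c (\<lambda>y. k * f y) = k * bint c f"
  unfolding bint_def by simp

lemma bint_sum:
  assumes "finite A" "\<And>a. a \<in> A \<Longrightarrow> continuous_on (cball 0 c) (f a)"
  shows "bint c (\<lambda>y. \<Sum>a\<in>A. f a y) = (\<Sum>a\<in>A. bint c (f a))"
  using assms
proof (induction A rule: finite_induct)
  case empty
  then show ?case by (simp add: bint_def)
next
  case (insert a A)
  have "continuous_on (cball 0 c) (\<lambda>y. \<Sum>a\<in>A. f a y)"
    using insert by (intro continuous_on_sum) auto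
  with insert show ?case by (simp add: bint_add)
qed

lemma bint_mono:
  assumes "continuous_on (cball 0 c) f" "continuous_on (cball 0 c) g"
    and "\<And>y. y \<in> cball 0 c \<Longrightarrow> f y \<le> g y"
  shows "bint c f \<le> bint c g"
  unfolding bint_def using assms by (intro set_integral_mono bint_integrable) auto

lemma bint_nonneg:
  assumes "continuous_on (cball 0 c) f" "\<And>y. y \<in> cball 0 c \<Longrightarrow> 0 \<le> f y"
  shows "0 \<le> bint c f"
  using bint_mono[OF _ assms(1), of "\<lambda>_. 0"] assms(2) by (simp add: bint_def)

lemma bint_const: "bint c (\<lambda>y. k) = k * bint c (\<lambda>y. 1)"
  using bint_cmult[of c k "\<lambda>_. 1"] by simp

lemma bint_abs_le:
  assumes "continuous_on (cball 0 c) f" "\<And>y. y \<in> cball 0 c \<Longrightarrow> \<bar>f y\<bar> \<le> B"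
  shows "\<bar>bint c f\<bar> \<le> B * bint c (\<lambda>y. 1)"
proof -
  have "bint c f \<le> bint c (\<lambda>y. B)" "bint c (\<lambda>y. - B) \<le> bint c f"
    using assms by (intro bint_mono; force)+
  then show ?thesis using bint_const[of c B] bint_const[of c "- B"] by linarith
qed

lemma bint_scale:
  assumes "t > 0" "continuous_on (cball 0 (t * c)) f"
  shows "bint (t * c) f = t^3 * bint c (\<lambda>y. f (t *\<^sub>R y))"
  using lint_cball_affine[of t 0 c f] assms by (simp add: bint_def)

lemma bint_one: "c \<ge> 0 \<Longrightarrow> bint c (\<lambda>y. 1) = c^3 * bint 1 (\<lambda>y. 1)"
proof (cases "c = 0")
  case True
  have "emeasure lborel {0::real^3} = 0" by simp
  with True show ?thesis by (simp add: bint_def set_integral_const measure_def)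
next
  case False
  then show "c \<ge> 0 \<Longrightarrow> ?thesis" using bint_scale[of c 1 "\<lambda>_. 1"] by simp
qed

lemma bint_one_pos: "c > 0 \<Longrightarrow> bint c (\<lambda>y. 1) > 0"
  using content_cball_pos[of c "0::real^3"] unfolding bint_def
  using emeasure_bounded_finite[of "cball (0::real^3) c"]
  by (subst set_integral_const) auto

lemma bint_rotate:
  assumes g: "orthogonal_transformation g" and f: "continuous_on (cball 0 c) f"
  shows "bint c (\<lambda>y. f (g y)) = bint c f"
proof -
  have lin: "linear g" using g by (simp add: orthogonal_transformation_linear)
  have meas: "g \<in> borel_measurable borel"
    by (intro borel_measurable_continuous_onI linear_continuous_on linear_conv_bounded_linear[THEN iffD1] lin)
  have "indicat_real (cball 0 c) (g y) = indicat_real (cball 0 c) y" for y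
    using orthogonal_transformation_norm[OF g, of y] by (simp add: indicator_def)
  then have "bint c (\<lambda>y. f (g y)) = integral\<^sup>L lborel (\<lambda>y. indicat_real (cball 0 c) (g y) * f (g y))"
    by (simp add: bint_def set_lebesgue_integral_def)
  also have "\<dots> = integral\<^sup>L (distr lborel borel g) (\<lambda>y. indicat_real (cball 0 c) y * f y)"
    by (rule integral_distr[symmetric]) (use meas borel_measurable_cont_indicator[OF _ f] in auto)
  also have "\<dots> = bint c f"
    by (simp add: lborel_orthogonal[OF g, symmetric] bint_def set_lebesgue_integral_def)
  finally show ?thesis .
qed

section \<open>Integration by parts\<close>

lemma lint_continuous:
  fixes f :: "'a::euclidean_space \<Rightarrow> 'b::euclidean_space \<Rightarrow> real"
  assumes K: "compact K" and T: "open T" and cf: "continuous_on (T \<times> K) (\<lambda>(x,y). f x y)"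
  shows "continuous_on T (\<lambda>x. LINT y:K|lborel. f x y)"
proof (rule continuous_at_imp_continuous_on, rule ballI)
  fix x0 assume x0: "x0 \<in> T"
  have cf': "continuous_on K (f x)" if "x \<in> T" for x
  proof -
    have "continuous_on K (\<lambda>y. (x, y))" by (intro continuous_intros)
    from continuous_on_compose2[OF cf this] that show ?thesis by (auto simp: image_subset_iff)
  qed
  show "isCont (\<lambda>x. LINT y:K|lborel. f x y) x0"
    unfolding continuous_at_eps_delta
  proof (intro allI impI)
    fix e :: real assume e: "e > 0"
    define M where "M = measure lborel K + 1"
    have M: "M > 0" by (simp add: M_def add_nonneg_pos)
    have eM: "e / M > 0" using e M by simp
    obtain X where X: "x0 \<in> X" "open X"
      and "\<forall>x\<in>X \<inter> T. \<forall>z\<in>K. dist ((\<lambda>(x,y). f x y) (x, z)) ((\<lambda>(x,y). f x y) (x0, z)) \<le> e / M"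
      by (rule continuous_on_prod_compactE[OF cf K x0 eM])
    then have dd: "dist (f x z) (f x0 z) \<le> e / M" if "x \<in> X \<inter> T" "z \<in> K" for x z
      using that by auto
    obtain d where d: "d > 0" "ball x0 d \<subseteq> X \<inter> T"
      using X T x0 open_contains_ball[of "X \<inter> T"] by blast
    have "dist (LINT y:K|lborel. f x y) (LINT y:K|lborel. f x0 y) < e" if x: "dist x x0 < d" for x
    proof -
      have xX: "x \<in> X \<inter> T" using x d by (auto simp: dist_commute subset_iff)
      then have xT: "x \<in> T" by simp
      have i: "set_integrable lborel K (f x)" "set_integrable lborel K (f x0)"
        using set_integrable_compact[OF K] cf' xT x0 by auto
      have i2: "set_integrable lborel K (\<lambda>z. f x z - f x0 z)"
        by (intro set_integral_diff(1) i)
      have "dist (LINT y:K|lborel. f x y) (LINT y:K|lborel. f x0 y) = norm (LINT y:K|lborel. f x y - f x0 y)"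
        by (simp add: set_integral_diff i dist_norm)
      also have "\<dots> \<le> (LINT z:K|lborel. norm (f x z - f x0 z))"
        using set_integral_norm_bound[OF i2] .
      also have "\<dots> \<le> (LINT z:K|lborel. e / M)"
      proof (rule set_integral_mono)
        show "set_integrable lborel K (\<lambda>z. norm (f x z - f x0 z))"
          using set_integrable_norm[OF i2] .
        show "set_integrable lborel K (\<lambda>z. e / M)"
          by (intro set_integrable_compact K continuous_intros)
        show "norm (f x z - f x0 z) \<le> e / M" if "z \<in> K" for z
          using dd[OF xX that] by (simp add: dist_norm)
      qed
      also have "\<dots> = measure lborel K * (e / M)"
        using borel_compact[OF K] emeasure_bounded_finite[OF compact_imp_bounded[OF K]]
        by (subst set_integral_const) auto
      also have "\<dots> < M * (e / M)"
        using e M by (intro mult_strict_right_mono) (auto simp: M_def)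
      finally show ?thesis using M by simp
    qed
    then show "\<exists>d>0. \<forall>x'. dist x' x0 < d \<longrightarrow> dist (LINT y:K|lborel. f x' y) (LINT y:K|lborel. f x0 y) < e"
      using d by blast
  qed
qed

lemma leibniz_pd:
  fixes f :: "real^3 \<Rightarrow> 'b::euclidean_space \<Rightarrow> real"
  assumes K: "compact K" and T: "open T"
    and der: "\<And>x y. x \<in> T \<Longrightarrow> y \<in> K \<Longrightarrow> ((\<lambda>x. f x y) has_derivative (\<lambda>v. \<Sum>i\<in>UNIV. v$i * g i x y)) (at x)"
    and cf: "\<And>x. x \<in> T \<Longrightarrow> continuous_on K (f x)"
    and cg: "\<And>i. continuous_on (T \<times> K) (\<lambda>(x,y). g i x y)"
  shows "C1 T (\<lambda>x. LINT y:K|lborel. f x y)"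
    and "\<And>x i. x \<in> T \<Longrightarrow> pd i (\<lambda>x. LINT y:K|lborel. f x y) x = (LINT y:K|lborel. g i x y)"
proof -
  have cg': "continuous_on K (g i x)" if "x \<in> T" for i x
  proof -
    have "continuous_on K (\<lambda>y. (x, y))" by (intro continuous_intros)
    from continuous_on_compose2[OF cg this] that show ?thesis by (auto simp: image_subset_iff)
  qed
  have D: "((\<lambda>x. LINT y:K|lborel. f x y) has_derivative (\<lambda>v. \<Sum>i\<in>UNIV. v$i * (LINT y:K|lborel. g i x y))) (at x)"
    if x: "x \<in> T" for x
  proof -
    have "((\<lambda>x. LINT y:K|lborel. f x y) has_derivative (\<lambda>v. LINT y:K|lborel. v \<bullet> (\<chi> i. g i x y))) (at x)"
    proof (rule leibniz_compact[OF K T x _ cf])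
      show "((\<lambda>x. f x y) has_derivative (\<lambda>v. v \<bullet> (\<chi> i. g i x y))) (at x)" if "x \<in> T" "y \<in> K" for x y
        using der[OF that] by (simp add: inner_vec_def)
      have "(\<lambda>(x,y). \<chi> i. g i x y) = (\<lambda>p. \<chi> i. (\<lambda>(x,y). g i x y) p)" by auto
      then show "continuous_on (T \<times> K) (\<lambda>(x,y). \<chi> i. g i x y)"
        using cg by (simp only: continuous_on_vec_lambda)
    qed
    moreover have "(LINT y:K|lborel. v \<bullet> (\<chi> i. g i x y)) = (\<Sum>i\<in>UNIV. v$i * (LINT y:K|lborel. g i x y))" for v :: "real^3"
    proof -
      have "(LINT y:K|lborel. v \<bullet> (\<chi> i. g i x y)) = (LINT y:K|lborel. (\<Sum>i\<in>UNIV. v$i * g i x y))"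
        by (simp add: inner_vec_def)
      also have "\<dots> = (\<Sum>i\<in>UNIV. (LINT y:K|lborel. v$i * g i x y))"
        unfolding set_lebesgue_integral_def scaleR_sum_right
        by (intro Bochner_Integration.integral_sum set_integrable_compact[unfolded set_integrable_def]
            K continuous_intros cg' x)
      finally show ?thesis by simp
    qed
    ultimately show ?thesis by simp
  qed
  show "C1 T (\<lambda>x. LINT y:K|lborel. f x y)"
    and "\<And>x i. x \<in> T \<Longrightarrow> pd i (\<lambda>x. LINT y:K|lborel. f x y) x = (LINT y:K|lborel. g i x y)"
    using C1I[OF D lint_continuous[OF K T cg]] by auto
qed

section \<open>A C1 cutoff function for the ball\<close>

lemma max0_square_has_derivative: "((\<lambda>t::real. (max 0 t)\<^sup>2) has_real_derivative 2 * max 0 t) (at t)"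
proof -
  consider "t > 0" | "t < 0" | "t = 0" by linarith
  then show ?thesis
  proof cases
    case 1
    have "((\<lambda>t. t\<^sup>2) has_real_derivative 2 * max 0 t) (at t)"
      using 1 by (auto intro!: derivative_eq_intros)
    then show ?thesis
      by (rule has_field_derivative_transform_within_open[where S="{0<..}"]) (use 1 in auto)
  next
    case 2
    have "((\<lambda>t. 0) has_real_derivative 2 * max 0 t) (at t)"
      using 2 by simp
    then show ?thesis
      by (rule has_field_derivative_transform_within_open[where S="{..<0}"]) (use 2 in auto)
  next
    case 3
    \<comment> \<open>At the kink the difference quotient is at most \<open>|h|\<close> in absolute
      value.\<close>
    have "((\<lambda>h. (max 0 h)\<^sup>2 / h) \<longlongrightarrow> 0) (at (0::real))"
    proof (rule Lim_null_comparison)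
      show "\<forall>\<^sub>F h in at 0. norm ((max 0 h)\<^sup>2 / h) \<le> \<bar>h\<bar>"
        by (rule always_eventually) (auto simp: max_def power2_eq_square)
      show "((\<lambda>h. \<bar>h\<bar>) \<longlongrightarrow> 0) (at (0::real))"
        using tendsto_rabs_zero[OF tendsto_ident_at] by simp
    qed
    then show ?thesis using 3 by (simp add: DERIV_def)
  qed
qed

text \<open>Squaring the positive part makes the cutoff C1. On \<open>cball 0 c\<close> it is
  \<open>(c^2 - |y|^2)^2\<close>.\<close>

definition bump :: "real \<Rightarrow> real^3 \<Rightarrow> real" where
  "bump c y = (max 0 (c\<^sup>2 - (norm y)\<^sup>2))\<^sup>2"

lemma bump_C1: "C1 UNIV (bump c)"
  and pd_bump: "pd i (bump c) y = - 4 * y$i * max 0 (c\<^sup>2 - (norm y)\<^sup>2)"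
proof -
  have D: "(bump c has_derivative (\<lambda>v. \<Sum>i\<in>UNIV. v$i * (- 4 * y$i * max 0 (c\<^sup>2 - (norm y)\<^sup>2)))) (at y)" for y
  proof -
    have "((\<lambda>y. c\<^sup>2 - y \<bullet> y) has_derivative (\<lambda>v. - 2 * (y \<bullet> v))) (at y)"
      by (auto intro!: derivative_eq_intros simp: inner_commute)
    from has_derivative_compose[OF this max0_square_has_derivative[unfolded has_field_derivative_def]]
    have "((\<lambda>y. (max 0 (c\<^sup>2 - y \<bullet> y))\<^sup>2) has_derivative
        (\<lambda>v. 2 * max 0 (c\<^sup>2 - y \<bullet> y) * (- 2 * (y \<bullet> v)))) (at y)" .
    moreover have "2 * m * (- 2 * (y \<bullet> v)) = (\<Sum>i\<in>UNIV. v$i * (- 4 * y$i * m))" for v m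
    proof -
      have "2 * m * (- 2 * (y \<bullet> v)) = (- 4 * m) * (\<Sum>i\<in>UNIV. y$i * v$i)"
        by (simp add: inner_vec_def)
      also have "\<dots> = (\<Sum>i\<in>UNIV. v$i * (- 4 * y$i * m))"
        unfolding sum_distrib_left by (simp add: mult_ac)
      finally show ?thesis .
    qed
    moreover have "bump c = (\<lambda>y. (max 0 (c\<^sup>2 - y \<bullet> y))\<^sup>2)"
      by (rule ext) (simp add: bump_def power2_norm_eq_inner)
    ultimately show ?thesis by (simp only: power2_norm_eq_inner)
  qed
  have C: "continuous_on UNIV (\<lambda>y::real^3. - 4 * y$i * max 0 (c\<^sup>2 - (norm y)\<^sup>2))" for i
    by (intro continuous_intros)
  show "C1 UNIV (bump c)" "pd i (bump c) y = - 4 * y$i * max 0 (c\<^sup>2 - (norm y)\<^sup>2)"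
    using C1I[of UNIV "bump c" "\<lambda>i y. - 4 * y$i * max 0 (c\<^sup>2 - (norm y)\<^sup>2)", OF D C] by auto
qed

lemma cutoff_C1:
  assumes W: "open W" "cball 0 c \<subseteq> W" and G: "C1 W G" and c: "c \<ge> 0"
  shows "C1 UNIV (\<lambda>y. bump c y * G y)"
    and "pd i (\<lambda>y. bump c y * G y) y = bump c y * pd i G y - 4 * y$i * max 0 (c\<^sup>2 - (norm y)\<^sup>2) * G y"
proof -
  let ?F = "\<lambda>y. bump c y * G y"
  have F1: "C1 W ?F"
    by (intro C1_mult G C1_subset[OF bump_C1]) auto
  have p1: "pd i ?F y = bump c y * pd i G y - 4 * y$i * max 0 (c\<^sup>2 - (norm y)\<^sup>2) * G y" if "y \<in> W" for i y
    using pd_mult[OF C1_differentiable[OF bump_C1] C1_differentiable[OF G that]] by (simp add: pd_bump)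
  \<comment> \<open>\<open>W\<close> and the complement of the closed ball are open and cover the
    space; the product is C1 on the first and zero on the second.\<close>
  define V where "V = - cball (0::real^3) c"
  have V: "open V" by (simp add: V_def open_Compl)
  have z: "max 0 (c\<^sup>2 - (norm y)\<^sup>2) = 0" if "y \<in> V" for y
    using that c by (auto simp: V_def max_def power_mono)
  have zF: "0 = ?F y" if "y \<in> V" for y
    using z[OF that] by (simp add: bump_def)
  have F2: "C1 V ?F"
    by (rule C1_cong[OF V zF]) auto
  have p2: "pd i ?F y = bump c y * pd i G y - 4 * y$i * max 0 (c\<^sup>2 - (norm y)\<^sup>2) * G y" if "y \<in> V" for i y
  proof -
    have "pd i ?F y = 0" using pd_cong[where i=i, OF V that zF] by simp
    moreover have "bump c y = 0" using z[OF that] by (simp add: bump_def)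
    ultimately show ?thesis using z[OF that] by simp
  qed
  have U: "W \<union> V = UNIV" using W by (auto simp: V_def)
  then show "pd i ?F y = bump c y * pd i G y - 4 * y$i * max 0 (c\<^sup>2 - (norm y)\<^sup>2) * G y"
    using p1 p2 by blast
  have "continuous_on (W \<union> V) (pd i ?F)" for i
    by (rule continuous_on_open_Un[OF W(1) V C1_continuous_pd[OF F1] C1_continuous_pd[OF F2]])
  then show "C1 UNIV ?F"
    using F1 F2 U unfolding C1_def by (metis UNIV_I Un_iff)
qed

text \<open>The cutoff removes every boundary term: a partial derivative of a compactly supported C1
  function integrates to zero, because the integral is invariant under translation. The second
  summand comes from differentiating the weight.\<close>

lemma bint_ibp:
  assumes W: "open W" "cball 0 c \<subseteq> W" and G: "C1 W G" and c: "c \<ge> 0"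
  shows "bint c (\<lambda>y. (c\<^sup>2 - (norm y)\<^sup>2)\<^sup>2 * pd i G y - 4 * y$i * (c\<^sup>2 - (norm y)\<^sup>2) * G y) = 0"
proof -
  define F where "F = (\<lambda>y. bump c y * G y)"
  have F: "C1 UNIV F" unfolding F_def by (rule cutoff_C1[OF assms])
  have cF: "continuous_on UNIV F" by (rule C1_continuous[OF F])
  have pF: "pd i F y = bump c y * pd i G y - 4 * y$i * max 0 (c\<^sup>2 - (norm y)\<^sup>2) * G y" for y
    unfolding F_def by (rule cutoff_C1(2)[OF assms])
  have zm: "max 0 (c\<^sup>2 - (norm y)\<^sup>2) = 0" if "norm y > c" for y :: "real^3"
    using that c by (auto simp: max_def power_mono)
  have zF: "F y = 0" if "norm y > c" for y
    using zm[OF that] by (simp add: F_def bump_def)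
  have zpF: "pd i F y = 0" if "norm y > c" for y
    using zm[OF that] by (simp add: pF bump_def)
  \<comment> \<open>Radius \<open>c + 1\<close> contains the support of every translate by
    \<open>s\<close> with \<open>|s| < 1\<close>, so the domain of integration stays fixed.\<close>
  let ?K = "cball (0::real^3) (c + 1)"
  let ?\<phi> = "\<lambda>s. LINT y:?K|lborel. F (y + s *\<^sub>R axis i 1)"
  have const: "?\<phi> s = integral\<^sup>L lborel F" if "s \<in> {-1<..<1}" for s
  proof -
    have "indicat_real ?K y *\<^sub>R F (y + s *\<^sub>R axis i 1) = F (y + s *\<^sub>R axis i 1)" for y
    proof (cases "y \<in> ?K")
      case False
      have "norm y \<le> norm (y + s *\<^sub>R axis i 1) + norm (s *\<^sub>R (axis i 1 :: real^3))"
        using norm_triangle_ineq4[of "y + s *\<^sub>R axis i 1" "s *\<^sub>R axis i 1"] by simp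
      moreover have "\<bar>s\<bar> < 1" using that by (simp add: abs_less_iff)
      ultimately have "norm (y + s *\<^sub>R axis i 1) > c" using False by simp
      then show ?thesis using zF by simp
    qed simp
    then have "?\<phi> s = integral\<^sup>L lborel (\<lambda>y. F (y + s *\<^sub>R axis i 1))"
      by (simp only: set_lebesgue_integral_def)
    also have "\<dots> = integral\<^sup>L lborel F"
      by (rule lborel_integral_translation) (use cF in \<open>auto intro: borel_measurable_continuous_onI\<close>)
    finally show ?thesis .
  qed
  have "(?\<phi> has_real_derivative (LINT y:?K|lborel. pd i F (y + 0 *\<^sub>R axis i 1))) (at 0)"
  proof (rule leibniz_compact_real[where T="{-1<..<1}"])
    fix s and y :: "real^3"
    have "((\<lambda>s. y + s *\<^sub>R axis i 1) has_vector_derivative axis i 1) (at s)"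
      by (auto intro!: derivative_eq_intros)
    from C1_curve[OF F _ this]
    show "((\<lambda>s. F (y + s *\<^sub>R axis i 1)) has_real_derivative pd i F (y + s *\<^sub>R axis i 1)) (at s)"
      by simp
  next
    show "continuous_on ?K (\<lambda>y. F (y + s *\<^sub>R axis i 1))" for s
      by (intro continuous_on_compose2[OF cF] continuous_intros) auto
    show "continuous_on ({-1<..<1} \<times> ?K) (\<lambda>(s, y). pd i F (y + s *\<^sub>R axis i 1))"
      unfolding case_prod_unfold
      by (intro continuous_on_compose2[OF C1_continuous_pd[OF F]] continuous_intros) auto
  qed auto
  moreover have "(?\<phi> has_real_derivative 0) (at 0)"
  proof (rule has_field_derivative_transform_within_open[where S="{-1<..<1}"])
    show "((\<lambda>s. integral\<^sup>L lborel F) has_real_derivative 0) (at 0)" by simp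
  qed (use const in auto)
  ultimately have "(LINT y:?K|lborel. pd i F y) = 0"
    using DERIV_unique by fastforce
  moreover have "(LINT y:?K|lborel. pd i F y) = (LINT y:cball 0 c|lborel. pd i F y)"
  proof -
    have "indicat_real ?K y *\<^sub>R pd i F y = indicat_real (cball 0 c) y *\<^sub>R pd i F y" for y
      using zpF[of y] by (auto simp: indicator_def)
    then show ?thesis by (simp only: set_lebesgue_integral_def)
  qed
  moreover have "(LINT y:cball 0 c|lborel. pd i F y)
     = bint c (\<lambda>y. (c\<^sup>2 - (norm y)\<^sup>2)\<^sup>2 * pd i G y - 4 * y$i * (c\<^sup>2 - (norm y)\<^sup>2) * G y)"
    unfolding bint_def[symmetric]
  proof (rule bint_cong)
    fix y :: "real^3" assume "y \<in> cball 0 c"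
    then have "(norm y)\<^sup>2 \<le> c\<^sup>2" by (simp add: power_mono)
    then show "pd i F y = (c\<^sup>2 - (norm y)\<^sup>2)\<^sup>2 * pd i G y - 4 * y$i * (c\<^sup>2 - (norm y)\<^sup>2) * G y"
      by (simp add: pF bump_def)
  qed
  ultimately show ?thesis by simp
qed

section \<open>Regularity of Riesz systems\<close>

lemma cball_subset_open_margin:
  fixes x :: "'a::euclidean_space"
  assumes "open U" "cball x t \<subseteq> U" "t \<ge> 0"
  obtains e where "e > 0" "cball x (t + e) \<subseteq> U"
proof -
  obtain e where e: "e > 0" "{y. infdist y (cball x t) \<le> e} \<subseteq> U"
    using compact_in_open_separated[of "cball x t" U] assms by auto
  have "y \<in> U" if y: "y \<in> cball x (t + e)" for y
  proof (cases "y \<in> cball x t")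
    case False
    define z where "z = x + (t / norm (y - x)) *\<^sub>R (y - x)"
    have n: "norm (y - x) > t" using False by (simp add: dist_norm norm_minus_commute)
    then have ne: "y \<noteq> x" using assms by auto
    then have "z \<in> cball x t" using assms by (simp add: z_def dist_norm)
    moreover have "dist y z \<le> e"
    proof -
      have "y - z = (1 - t / norm (y - x)) *\<^sub>R (y - x)"
        by (simp add: z_def algebra_simps)
      then have "norm (y - z) = \<bar>1 - t / norm (y - x)\<bar> * norm (y - x)" by simp
      also have "\<dots> = norm (y - x) - t"
        using n ne assms by (simp add: abs_if field_simps)
      finally show ?thesis using y by (simp add: dist_norm norm_minus_commute)
    qed
    ultimately have "infdist y (cball x t) \<le> e" by (rule infdist_le2)
    then show ?thesis using e by auto
  qed (use assms in auto)
  then show ?thesis using that e by blast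
qed

lemma bint_mono_radius:
  assumes "c \<le> d" "continuous_on (cball 0 d) f" "\<And>y. y \<in> cball 0 d \<Longrightarrow> 0 \<le> f y"
  shows "bint c f \<le> bint d f"
proof -
  have "continuous_on (cball 0 c) f"
    using assms by (intro continuous_on_subset[OF assms(2)]) auto
  then show ?thesis
    unfolding bint_def set_lebesgue_integral_def using assms
    by (intro integral_mono bint_integrable[unfolded set_integrable_def]) (auto simp: indicator_def)
qed

text \<open>The kernel \<open>(1 - |y|\<^sup>2)\<^sup>2\<close> extends by zero to a \<open>C1\<close> function, so a continuous function that it
  reproduces is \<open>C1\<close>, and its partial derivatives are reproduced again.\<close>

definition mvp_const :: real where
  "mvp_const = bint 1 (\<lambda>y. (1 - (norm y)\<^sup>2)\<^sup>2)"

definition mvp :: "(real^3) set \<Rightarrow> (real^3 \<Rightarrow> real) \<Rightarrow> bool" where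
  "mvp U q \<longleftrightarrow> continuous_on U q \<and>
     (\<forall>x t. t > 0 \<longrightarrow> cball x t \<subseteq> U \<longrightarrow>
        mvp_const * q x = bint 1 (\<lambda>y. q (x + t *\<^sub>R y) * (1 - (norm y)\<^sup>2)\<^sup>2))"

lemma mvp_const_pos: "mvp_const > 0"
proof -
  have "0 < (9/16) * bint (1/2) (\<lambda>y. 1)" using bint_one_pos[of "1/2"] by simp
  also have "\<dots> = bint (1/2) (\<lambda>y. 9/16)" using bint_const[of "1/2" "9/16"] by simp
  also have "\<dots> \<le> bint (1/2) (\<lambda>y. (1 - (norm y)\<^sup>2)\<^sup>2)"
  proof (rule bint_mono)
    fix y :: "real^3" assume "y \<in> cball 0 (1/2)"
    then have "(norm y)\<^sup>2 \<le> (1/2)\<^sup>2" by (intro power_mono) auto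
    then have "(3/4)\<^sup>2 \<le> (1 - (norm y)\<^sup>2)\<^sup>2" by (intro power_mono) (auto simp: power2_eq_square)
    then show "9/16 \<le> (1 - (norm y)\<^sup>2)\<^sup>2" by (simp add: power2_eq_square)
  qed (intro continuous_intros)+
  also have "\<dots> \<le> mvp_const"
    unfolding mvp_const_def by (rule bint_mono_radius) (auto intro!: continuous_intros)
  finally show ?thesis .
qed

lemma mvp_C1:
  assumes U: "open U" and q: "mvp U q"
  shows "C1 U q"
proof -
  have cq: "continuous_on U q" using q by (simp add: mvp_def)
  have loc: "\<exists>T. open T \<and> x0 \<in> T \<and> T \<subseteq> U \<and> C1 T q" if x0: "x0 \<in> U" for x0
  proof -
    obtain s where s: "s > 0" "cball x0 s \<subseteq> U"
      using U x0 open_contains_cball by blast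
    \<comment> \<open>With half the radius, the balls of radius \<open>t\<close> about points of
      \<open>ball x0 t\<close> all lie in the fixed compact set \<open>cball x0 s\<close>.\<close>
    define t where "t = s / 2"
    have t: "t > 0" using s by (simp add: t_def)
    let ?T = "ball x0 t" and ?K = "cball x0 s"
    let ?c = "1 / (mvp_const * t^3)"
    let ?b = "\<lambda>x z. bump 1 ((1/t) *\<^sub>R z + (- 1/t) *\<^sub>R x)"
    \<comment> \<open>Substituting \<open>z = x + t y\<close> moves the dependence on
      \<open>x\<close> from \<open>q\<close>, which is only known to be continuous, to the C1
      kernel.\<close>
    have rep: "q x = ?c * (LINT z:?K|lborel. q z * ?b x z)" if x: "x \<in> ?T" for x
    proof -
      have sub: "cball x t \<subseteq> ?K"
      proof
        fix z assume "z \<in> cball x t"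
        then show "z \<in> ?K" using x dist_triangle[of x0 z x] by (simp add: t_def)
      qed
      have cb: "continuous_on ?K (\<lambda>z. q z * ?b x z)"
        by (intro continuous_intros continuous_on_compose2[OF C1_continuous[OF bump_C1[of 1]]]
            continuous_on_subset[OF cq s(2)]) auto
      have arg: "(1/t) *\<^sub>R (x + t *\<^sub>R y) + (- 1/t) *\<^sub>R x = y" for y
        using t by (simp add: scaleR_add_right)
      have "mvp_const * q x = bint 1 (\<lambda>y. q (x + t *\<^sub>R y) * (1 - (norm y)\<^sup>2)\<^sup>2)"
        using q t sub s by (auto simp: mvp_def)
      also have "\<dots> = bint 1 (\<lambda>y. q (x + t *\<^sub>R y) * ?b x (x + t *\<^sub>R y))"
      proof (rule bint_cong)
        fix y :: "real^3" assume "y \<in> cball 0 1"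
        then have "(norm y)\<^sup>2 \<le> 1" by (simp add: power_le_one)
        then show "q (x + t *\<^sub>R y) * (1 - (norm y)\<^sup>2)\<^sup>2 = q (x + t *\<^sub>R y) * ?b x (x + t *\<^sub>R y)"
          unfolding arg by (simp add: bump_def)
      qed
      finally have "t^3 * (mvp_const * q x) = (LINT z:cball x t|lborel. q z * ?b x z)"
        using lint_cball_affine[OF t, of x 1 "\<lambda>z. q z * ?b x z"] continuous_on_subset[OF cb sub]
        by (simp add: bint_def)
      also have "\<dots> = (LINT z:?K|lborel. q z * ?b x z)"
      proof -
        have "indicat_real (cball x t) z *\<^sub>R (q z * ?b x z) = indicat_real ?K z *\<^sub>R (q z * ?b x z)" for z
        proof (cases "z \<in> cball x t")
          case False
          then have "norm (z - x) > t" by (simp add: dist_norm norm_minus_commute)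
          moreover have "(1/t) *\<^sub>R z + (- 1/t) *\<^sub>R x = (1/t) *\<^sub>R (z - x)"
            by (simp add: scaleR_diff_right)
          moreover have "norm ((1/t) *\<^sub>R (z - x)) = norm (z - x) / t"
            using t by (simp add: divide_inverse)
          ultimately have "norm ((1/t) *\<^sub>R z + (- 1/t) *\<^sub>R x) \<ge> 1"
            using t by (simp only:) (simp add: field_simps)
          then have "?b x z = 0" by (simp add: bump_def)
          then show ?thesis by simp
        qed (use sub in \<open>auto simp: indicator_def\<close>)
        then show ?thesis by (simp only: set_lebesgue_integral_def)
      qed
      finally show ?thesis using t mvp_const_pos by (simp add: field_simps)
    qed
    have "C1 ?T (\<lambda>x. LINT z:?K|lborel. q z * ?b x z)"
    proof (rule leibniz_pd(1)[where g="\<lambda>i x z. q z * ((- 1/t) * pd i (bump 1) ((1/t) *\<^sub>R z + (- 1/t) *\<^sub>R x))"])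
      fix x z
      have dif: "bump 1 differentiable at w" for w
        using C1_differentiable[OF bump_C1] by simp
      note a = pd_affine(2)[where a="(1/t) *\<^sub>R z" and t="- 1/t" and x=x, OF dif]
      have "((\<lambda>x. q z * ?b x z) has_derivative (\<lambda>v. q z * (\<Sum>i\<in>UNIV. v$i * pd i (\<lambda>x. ?b x z) x))) (at x)"
        by (intro has_derivative_mult_right has_derivative_pd a)
      then show "((\<lambda>x. q z * ?b x z) has_derivative
         (\<lambda>v. \<Sum>i\<in>UNIV. v$i * (q z * ((- 1/t) * pd i (bump 1) ((1/t) *\<^sub>R z + (- 1/t) *\<^sub>R x))))) (at x)"
        unfolding pd_affine(1)[OF dif] sum_distrib_left by (simp only: mult.left_commute)
    next
      show "continuous_on ?K (\<lambda>z. q z * ?b x z)" for x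
        by (intro continuous_intros continuous_on_compose2[OF C1_continuous[OF bump_C1[of 1]]]
            continuous_on_subset[OF cq s(2)]) auto
      have 1: "continuous_on (?T \<times> ?K) (\<lambda>p. q (snd p))"
        by (intro continuous_on_compose2[OF cq] continuous_intros) (use s in auto)
      show "continuous_on (?T \<times> ?K) (\<lambda>(x, z). q z * ((- 1/t) * pd i (bump 1) ((1/t) *\<^sub>R z + (- 1/t) *\<^sub>R x)))" for i
        unfolding case_prod_unfold
        by (intro continuous_on_mult 1 continuous_intros continuous_on_compose2[OF C1_continuous_pd[OF bump_C1[of 1]]]) auto
    qed auto
    then have "C1 ?T (\<lambda>x. ?c * (LINT z:?K|lborel. q z * ?b x z))" by (rule C1_cmult)
    then have "C1 ?T q" by (rule C1_cong[rotated 2]) (use rep in auto)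
    moreover have "?T \<subseteq> U"
    proof -
      have "?T \<subseteq> cball x0 s" using s by (auto simp: t_def)
      then show ?thesis using s by blast
    qed
    ultimately show ?thesis using t by (intro exI[of _ ?T]) auto
  qed
  show ?thesis
    unfolding C1_def
  proof (intro conjI ballI allI)
    show "q differentiable at x" if "x \<in> U" for x
      using loc[OF that] by (auto simp: C1_def)
    show "continuous_on U (pd i q)" for i
    proof (rule continuous_at_imp_continuous_on, rule ballI)
      fix x assume "x \<in> U"
      from loc[OF this] obtain T where T: "open T" "x \<in> T" "C1 T q" by blast
      then show "isCont (pd i q) x"
        using C1_continuous_pd[OF T(3)] continuous_on_eq_continuous_at by blast
    qed
  qed
qed

lemma mvp_pd:
  assumes U: "open U" and q: "mvp U q"
  shows "mvp U (pd i q)"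
  unfolding mvp_def
proof (intro conjI allI impI)
  have c1: "C1 U q" by (rule mvp_C1[OF assms])
  show "continuous_on U (pd i q)" by (rule C1_continuous_pd[OF c1])
  fix x t assume t: "(0::real) < t" "cball x t \<subseteq> U"
  \<comment> \<open>The margin lets the formula hold with the same \<open>t\<close> at all centres
    near \<open>x\<close>, so that it can be differentiated in the centre.\<close>
  obtain e where e: "e > 0" "cball x (t + e) \<subseteq> U"
    using cball_subset_open_margin[OF U t(2)] t(1) by auto
  let ?T = "ball x e" and ?K = "cball (0::real^3) 1"
  have inU: "x' + t *\<^sub>R y \<in> U" if "x' \<in> ?T" "y \<in> ?K" for x' y
  proof -
    have "norm (x - (x' + t *\<^sub>R y)) \<le> norm (x - x') + norm (t *\<^sub>R y)"
      by (metis diff_diff_eq norm_triangle_ineq4)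
    also have "\<dots> \<le> e + t"
      using that t by (intro add_mono) (auto simp: dist_norm mult_left_le)
    finally show ?thesis using e by (auto simp: dist_norm subset_iff)
  qed
  let ?w = "\<lambda>y::real^3. (1 - (norm y)\<^sup>2)\<^sup>2"
  let ?I = "\<lambda>x. LINT y:?K|lborel. q (x + t *\<^sub>R y) * ?w y"
  have "pd i ?I x = (LINT y:?K|lborel. pd i q (x + t *\<^sub>R y) * ?w y)"
  proof (rule leibniz_pd(2)[where T="?T" and g="\<lambda>i x y. pd i q (x + t *\<^sub>R y) * ?w y"])
    fix x' y assume xy: "x' \<in> ?T" "y \<in> ?K"
    have "((\<lambda>x'. x' + t *\<^sub>R y) has_derivative (\<lambda>v. v)) (at x')"
      by (auto intro!: derivative_eq_intros)
    from has_derivative_compose[OF this C1_has_derivative[OF c1 inU[OF xy]]]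
    have "((\<lambda>x'. q (x' + t *\<^sub>R y) * ?w y) has_derivative
        (\<lambda>v. (\<Sum>i\<in>UNIV. v$i * pd i q (x' + t *\<^sub>R y)) * ?w y)) (at x')"
      by (rule has_derivative_mult_left)
    then show "((\<lambda>x'. q (x' + t *\<^sub>R y) * ?w y) has_derivative
        (\<lambda>v. \<Sum>i\<in>UNIV. v$i * (pd i q (x' + t *\<^sub>R y) * ?w y))) (at x')"
      by (simp only: sum_distrib_right mult.assoc)
  next
    show "continuous_on ?K (\<lambda>y. q (x' + t *\<^sub>R y) * ?w y)" if "x' \<in> ?T" for x'
      by (intro continuous_on_mult continuous_intros continuous_on_compose2[OF C1_continuous[OF c1]])
        (use inU[OF that] in auto)
    show "continuous_on (?T \<times> ?K) (\<lambda>(x, y). pd i q (x + t *\<^sub>R y) * ?w y)" for i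
      unfolding case_prod_unfold
      by (intro continuous_on_mult continuous_intros continuous_on_compose2[OF C1_continuous_pd[OF c1]])
        (use inU in auto)
  qed (use e in auto)
  moreover have "pd i ?I x = pd i (\<lambda>x. mvp_const * q x) x"
  proof (rule pd_cong[of ?T])
    fix x' assume x': "x' \<in> ?T"
    have "cball x' t \<subseteq> U"
    proof
      fix z assume "z \<in> cball x' t"
      then have "z \<in> cball x (t + e)" using x' dist_triangle[of x z x'] by simp
      then show "z \<in> U" using e by blast
    qed
    then show "?I x' = mvp_const * q x'"
      using q t by (simp add: mvp_def bint_def)
  qed (use e in auto)
  moreover have "pd i (\<lambda>x. mvp_const * q x) x = mvp_const * pd i q x"
    using t by (intro pd_cmult C1_differentiable[OF c1]) auto
  ultimately show "mvp_const * pd i q x = bint 1 (\<lambda>y. pd i q (x + t *\<^sub>R y) * ?w y)"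
    by (simp add: bint_def)
qed

section \<open>Mean value property and smoothness of Riesz systems\<close>

definition riesz :: "(real^3) set \<Rightarrow> (3 \<Rightarrow> real^3 \<Rightarrow> real) \<Rightarrow> bool" where
  "riesz U v \<longleftrightarrow> (\<forall>j. C1 U (v j)) \<and> (\<forall>x\<in>U. \<forall>i j. pd i (v j) x = pd j (v i) x)
     \<and> (\<forall>x\<in>U. (\<Sum>i\<in>UNIV. pd i (v i) x) = 0)"

text \<open>The derivative of the weighted mean in the radius integrates
  \<open>y . grad (v j)\<close>. By symmetry and zero trace this is the sum over \<open>i\<close> of
  \<open>y$i pd j (v i) - y$j pd i (v i)\<close>. Each summand is a rotation field applied to
  \<open>v i\<close> and integrates to zero against a radial weight. Only first derivatives
  occur.\<close>

lemma riesz_mvp: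
  assumes U: "open U" and v: "riesz U v"
  shows "mvp U (v j)"
  unfolding mvp_def
proof (intro conjI allI impI)
  have c1: "C1 U (v j)" for j using v by (simp add: riesz_def)
  have sym: "pd i (v j) x = pd j (v i) x" and div: "(\<Sum>i\<in>UNIV. pd i (v i) x) = 0" if "x \<in> U" for x i j
    using v that by (auto simp: riesz_def)
  show "continuous_on U (v j)" by (rule C1_continuous[OF c1])
  fix x and t :: real assume t: "t > 0" "cball x t \<subseteq> U"
  let ?w = "\<lambda>y::real^3. 1 - (norm y)\<^sup>2"
  let ?I = "\<lambda>\<tau>. LINT y:cball 0 1|lborel. v j (x + \<tau> *\<^sub>R y) * (?w y)\<^sup>2"
  obtain e where e: "e > 0" "cball x (t + e) \<subseteq> U"
    using cball_subset_open_margin[OF U t(2)] t(1) by auto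
  have inU: "x + \<tau> *\<^sub>R y \<in> U" if "\<tau> \<in> {-(t+e)<..<t+e}" "y \<in> cball 0 1" for \<tau> y
  proof -
    have "\<bar>\<tau>\<bar> * norm y \<le> (t + e) * 1"
      using that t e by (intro mult_mono) auto
    then show ?thesis using e by (auto simp: dist_norm subset_iff)
  qed
  have D: "(?I has_real_derivative (LINT y:cball 0 1|lborel. (\<Sum>i\<in>UNIV. y$i * pd i (v j) (x + \<tau> *\<^sub>R y)) * (?w y)\<^sup>2)) (at \<tau>)"
    if "\<tau> \<in> {-(t+e)<..<t+e}" for \<tau>
  proof (rule leibniz_compact_real[where T="{-(t+e)<..<t+e}"])
    fix \<tau> and y :: "real^3" assume ty: "\<tau> \<in> {-(t+e)<..<t+e}" "y \<in> cball 0 1"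
    have "((\<lambda>\<tau>. x + \<tau> *\<^sub>R y) has_vector_derivative y) (at \<tau>)"
      by (auto intro!: derivative_eq_intros)
    from C1_curve[OF c1 inU[OF ty] this]
    show "((\<lambda>\<tau>. v j (x + \<tau> *\<^sub>R y) * (?w y)\<^sup>2) has_real_derivative
       (\<Sum>i\<in>UNIV. y$i * pd i (v j) (x + \<tau> *\<^sub>R y)) * (?w y)\<^sup>2) (at \<tau>)"
      by (rule DERIV_cmult_right)
  next
    show "continuous_on (cball 0 1) (\<lambda>y. v j (x + \<tau> *\<^sub>R y) * (?w y)\<^sup>2)" if "\<tau> \<in> {-(t+e)<..<t+e}" for \<tau>
      by (intro continuous_on_mult continuous_intros continuous_on_compose2[OF C1_continuous[OF c1]])
        (use inU[OF that] in auto)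
    show "continuous_on ({-(t+e)<..<t+e} \<times> cball 0 1)
        (\<lambda>(\<tau>, y). (\<Sum>i\<in>UNIV. y$i * pd i (v j) (x + \<tau> *\<^sub>R y)) * (?w y)\<^sup>2)"
      unfolding case_prod_unfold
      by (intro continuous_on_mult continuous_intros continuous_on_compose2[OF C1_continuous_pd[OF c1]])
        (use inU in auto)
  qed (use that in auto)
  have Z: "(LINT y:cball 0 1|lborel. (\<Sum>i\<in>UNIV. y$i * pd i (v j) (x + \<tau> *\<^sub>R y)) * (?w y)\<^sup>2) = 0"
    if \<tau>: "0 < \<tau>" "\<tau> < t" for \<tau>
  proof -
    define W where "W = (\<lambda>y. x + \<tau> *\<^sub>R y) -` U"
    have W: "open W" unfolding W_def
      by (rule open_vimage[OF U]) (intro continuous_intros)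
    have cW: "cball 0 1 \<subseteq> W" using inU[of \<tau>] \<tau> t e by (auto simp: W_def)
    let ?v = "\<lambda>i y. v i (x + \<tau> *\<^sub>R y)"
    have vW: "C1 W (?v i)" for i
      by (rule C1_affine[OF c1]) (auto simp: W_def)
    have pv: "pd k (?v i) y = \<tau> * pd k (v i) (x + \<tau> *\<^sub>R y)" if "y \<in> W" for i k y
      using that by (intro pd_affine C1_differentiable[OF c1]) (auto simp: W_def)
    have cont: "continuous_on (cball 0 1) (pd k (?v i))" "continuous_on (cball 0 1) (?v i)" for i k
      using continuous_on_subset[OF C1_continuous_pd[OF vW] cW]
        continuous_on_subset[OF C1_continuous[OF vW] cW] by auto
    \<comment> \<open>Two integrations by parts, in direction \<open>j\<close> for
      \<open>y$i v i\<close> and in direction \<open>i\<close> for \<open>y$j v i\<close>. The terms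
      from the weight and those from differentiating the coordinates cancel.\<close>
    have part: "bint 1 (\<lambda>y. (?w y)\<^sup>2 * (y$i * pd j (?v i) y - y$j * pd i (?v i) y)) = 0" for i
    proof -
      have gi: "pd k (\<lambda>y. y$l * ?v i y) y = y$l * pd k (?v i) y + (if k = l then 1 else 0) * ?v i y"
        if "y \<in> cball 0 1" for k l y
        using pd_mult[OF differentiable_coord[of l y] C1_differentiable[OF vW[of i]]] that cW
        by (auto simp: pd_coord)
      have cc: "C1 W (\<lambda>y. y$l * ?v i y)" for l by (intro C1_mult C1_coord vW)
      have c2: "continuous_on (cball 0 1) (\<lambda>y. (?w y)\<^sup>2 * pd k (\<lambda>y. y$l * ?v i y) y - 4 * y$k * ?w y * (y$l * ?v i y))" for k l
        by (intro continuous_intros continuous_on_subset[OF C1_continuous_pd[OF cc] cW] cont)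
      have "0 = bint 1 (\<lambda>y. (?w y)\<^sup>2 * pd j (\<lambda>y. y$i * ?v i y) y - 4 * y$j * ?w y * (y$i * ?v i y))
             - bint 1 (\<lambda>y. (?w y)\<^sup>2 * pd i (\<lambda>y. y$j * ?v i y) y - 4 * y$i * ?w y * (y$j * ?v i y))"
        using bint_ibp[OF W cW cc, of j i] bint_ibp[OF W cW cc, of i j] by simp
      also have "\<dots> = bint 1 (\<lambda>y. ((?w y)\<^sup>2 * pd j (\<lambda>y. y$i * ?v i y) y - 4 * y$j * ?w y * (y$i * ?v i y))
             - ((?w y)\<^sup>2 * pd i (\<lambda>y. y$j * ?v i y) y - 4 * y$i * ?w y * (y$j * ?v i y)))"
        by (rule bint_diff[symmetric]) (rule c2)+
      also have "\<dots> = bint 1 (\<lambda>y. (?w y)\<^sup>2 * (y$i * pd j (?v i) y - y$j * pd i (?v i) y))"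
        by (rule bint_cong) (simp add: gi algebra_simps)
      finally show ?thesis by simp
    qed
    have "0 = (\<Sum>i\<in>UNIV. bint 1 (\<lambda>y. (?w y)\<^sup>2 * (y$i * pd j (?v i) y - y$j * pd i (?v i) y)))"
      by (simp add: part)
    also have "\<dots> = bint 1 (\<lambda>y. \<Sum>i\<in>UNIV. (?w y)\<^sup>2 * (y$i * pd j (?v i) y - y$j * pd i (?v i) y))"
      by (rule bint_sum[symmetric]) (auto intro!: continuous_intros cont)
    also have "\<dots> = bint 1 (\<lambda>y. \<tau> * ((\<Sum>i\<in>UNIV. y$i * pd i (v j) (x + \<tau> *\<^sub>R y)) * (?w y)\<^sup>2))"
    proof (rule bint_cong)
      fix y :: "real^3" assume y: "y \<in> cball 0 1"
      then have yW: "y \<in> W" and yU: "x + \<tau> *\<^sub>R y \<in> U" using cW by (auto simp: W_def)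
      have "(\<Sum>i\<in>UNIV. (?w y)\<^sup>2 * (y$i * pd j (?v i) y - y$j * pd i (?v i) y))
        = (?w y)\<^sup>2 * \<tau> * ((\<Sum>i\<in>UNIV. y$i * pd i (v j) (x + \<tau> *\<^sub>R y)) - y$j * (\<Sum>i\<in>UNIV. pd i (v i) (x + \<tau> *\<^sub>R y)))"
        unfolding pv[OF yW] sym[OF yU, of _ j]
        by (simp add: sum_subtractf sum_distrib_left algebra_simps)
      then show "(\<Sum>i\<in>UNIV. (?w y)\<^sup>2 * (y$i * pd j (?v i) y - y$j * pd i (?v i) y))
        = \<tau> * ((\<Sum>i\<in>UNIV. y$i * pd i (v j) (x + \<tau> *\<^sub>R y)) * (?w y)\<^sup>2)"
        unfolding div[OF yU] by (simp add: mult_ac)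
    qed
    finally show ?thesis using \<tau> by (simp add: bint_cmult) (simp add: bint_def)
  qed
  have "?I t = ?I 0"
  proof (rule DERIV_isconst_end[of 0 t ?I])
    show "continuous_on {0..t} ?I"
    proof (rule continuous_at_imp_continuous_on, rule ballI)
      fix \<tau> assume "\<tau> \<in> {0..t}"
      then show "isCont ?I \<tau>" using e t by (intro DERIV_isCont[OF D]) auto
    qed
    show "(?I has_real_derivative 0) (at \<tau>)" if "0 < \<tau>" "\<tau> < t" for \<tau>
      using D[of \<tau>] Z[OF that] that e by simp
  qed (use t in auto)
  then show "mvp_const * v j x = bint 1 (\<lambda>y. v j (x + t *\<^sub>R y) * (?w y)\<^sup>2)"
    by (simp add: bint_def mvp_const_def mult.commute)
qed

definition smooth :: "(real^3) set \<Rightarrow> (real^3 \<Rightarrow> real) \<Rightarrow> bool" where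
  "smooth U h \<longleftrightarrow> (\<forall>l. C1 U (foldr pd l h))"

lemma smooth_C1: "smooth U h \<Longrightarrow> C1 U h"
  unfolding smooth_def by (metis foldr.simps(1) id_apply)

lemma smooth_pd: "smooth U h \<Longrightarrow> smooth U (pd i h)"
  unfolding smooth_def
proof
  fix l assume "\<forall>l. C1 U (foldr pd l h)"
  then have "C1 U (foldr pd (l @ [i]) h)" by blast
  then show "C1 U (foldr pd l (pd i h))" by simp
qed

lemma riesz_smooth:
  assumes "open U" "riesz U v"
  shows "smooth U (v j)"
proof -
  have "mvp U (foldr pd l (v j))" for l
    by (induction l) (use assms in \<open>auto intro: mvp_pd riesz_mvp\<close>)
  then show ?thesis using mvp_C1[OF assms(1)] by (auto simp: smooth_def)
qed

section \<open>Harmonic functions and the Euler operator\<close>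

text \<open>The mean value theorem is applied in direction \<open>i\<close> and then in direction
  \<open>j\<close>. The parallelogram lies within distance \<open>2 s\<close> of \<open>x\<close>;
  the radius \<open>3 s\<close> leaves room for an open ball.\<close>

lemma pd_double_difference:
  assumes U: "open U" and h: "C1 U h" "C1 U (pd i h)"
    and s: "s > 0" "ball x (3 * s) \<subseteq> U"
  obtains \<xi> where "\<xi> \<in> ball x (3 * s)"
    "h (x + s *\<^sub>R axis i 1 + s *\<^sub>R axis j 1) - h (x + s *\<^sub>R axis i 1) - h (x + s *\<^sub>R axis j 1) + h x
       = s\<^sup>2 * pd j (pd i h) \<xi>"
proof -
  let ?p = "\<lambda>a b. x + a *\<^sub>R axis i 1 + b *\<^sub>R (axis j 1 :: real^3)"
  have inB: "?p a b \<in> ball x (3 * s)" if "0 \<le> a" "a \<le> s" "0 \<le> b" "b \<le> s" for a b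
  proof -
    have "norm (?p a b - x) \<le> norm (a *\<^sub>R (axis i 1 :: real^3)) + norm (b *\<^sub>R (axis j 1 :: real^3))"
      by (metis add.assoc add_diff_cancel_left' norm_triangle_ineq)
    also have "\<dots> < 3 * s" using that s by simp
    finally have "dist (?p a b) x < 3 * s" by (simp only: dist_norm)
    then show ?thesis by (simp only: mem_ball dist_commute)
  qed
  have da: "((\<lambda>a. f (?p a b)) has_real_derivative pd i f (?p a b)) (at a)"
    if "0 \<le> a" "a \<le> s" "0 \<le> b" "b \<le> s" "C1 U f" for a b f
  proof -
    have "((\<lambda>a. ?p a b) has_vector_derivative axis i 1) (at a)"
      by (auto intro!: derivative_eq_intros)
    from C1_curve[OF that(5) _ this] show ?thesis using inB[OF that(1-4)] s by auto
  qed
  have db: "((\<lambda>b. f (?p a b)) has_real_derivative pd j f (?p a b)) (at b)"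
    if "0 \<le> a" "a \<le> s" "0 \<le> b" "b \<le> s" "C1 U f" for a b f
  proof -
    have "((\<lambda>b. ?p a b) has_vector_derivative axis j 1) (at b)"
      by (auto intro!: derivative_eq_intros)
    from C1_curve[OF that(5) _ this] show ?thesis using inB[OF that(1-4)] s by auto
  qed
  have "\<exists>a>0. a < s \<and> (h (?p s s) - h (?p s 0)) - (h (?p 0 s) - h (?p 0 0))
      = (s - 0) * (pd i h (?p a s) - pd i h (?p a 0))"
  proof (rule MVT2[OF s(1)])
    fix a assume a: "0 \<le> a" "a \<le> s"
    show "((\<lambda>a. h (?p a s) - h (?p a 0)) has_real_derivative pd i h (?p a s) - pd i h (?p a 0)) (at a)"
      by (rule DERIV_diff[OF da da]) (use a s h in auto)
  qed
  then obtain a where a: "0 < a" "a < s"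
    and ea: "(h (?p s s) - h (?p s 0)) - (h (?p 0 s) - h (?p 0 0)) = s * (pd i h (?p a s) - pd i h (?p a 0))"
    by auto
  have "\<exists>b>0. b < s \<and> pd i h (?p a s) - pd i h (?p a 0) = (s - 0) * pd j (pd i h) (?p a b)"
  proof (rule MVT2[OF s(1)])
    fix b assume b: "0 \<le> b" "b \<le> s"
    show "((\<lambda>b. pd i h (?p a b)) has_real_derivative pd j (pd i h) (?p a b)) (at b)"
      by (rule db) (use a b h in auto)
  qed
  then obtain b where b: "0 < b" "b < s"
    and eb: "pd i h (?p a s) - pd i h (?p a 0) = s * pd j (pd i h) (?p a b)" by auto
  show ?thesis
    by (rule that[OF inB[of a b]]) (use a b ea eb in \<open>auto simp: power2_eq_square\<close>)
qed

text \<open>The second difference is symmetric in \<open>i\<close> and \<open>j\<close>, so the two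
  mixed derivatives agree at two points close to \<open>x\<close>, and continuity does the
  rest.\<close>

lemma pd_commute:
  assumes U: "open U" and h: "C1 U h" "\<And>i. C1 U (pd i h)" and x: "x \<in> U"
  shows "pd i (pd j h) x = pd j (pd i h) x"
proof (rule ccontr)
  assume ne: "\<not> ?thesis"
  define e where "e = \<bar>pd i (pd j h) x - pd j (pd i h) x\<bar> / 2"
  have e: "e > 0" using ne by (simp add: e_def)
  have cont: "continuous (at x) (pd k (pd l h))" for k l
    using C1_continuous_pd[OF h(2)] U x continuous_on_eq_continuous_at by blast
  obtain d1 where d1: "d1 > 0" "\<And>y. dist y x < d1 \<Longrightarrow> dist (pd i (pd j h) y) (pd i (pd j h) x) < e"
    using cont e unfolding continuous_at_eps_delta by metis
  obtain d2 where d2: "d2 > 0" "\<And>y. dist y x < d2 \<Longrightarrow> dist (pd j (pd i h) y) (pd j (pd i h) x) < e"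
    using cont e unfolding continuous_at_eps_delta by metis
  obtain r where r: "r > 0" "ball x r \<subseteq> U" using U x open_contains_ball by blast
  define s where "s = min r (min d1 d2) / 3"
  have s: "s > 0" "ball x (3 * s) \<subseteq> U" "3 * s \<le> d1" "3 * s \<le> d2"
    using r d1 d2 by (auto simp: s_def)
  obtain \<xi> where \<xi>: "\<xi> \<in> ball x (3 * s)"
    "h (x + s *\<^sub>R axis i 1 + s *\<^sub>R axis j 1) - h (x + s *\<^sub>R axis i 1) - h (x + s *\<^sub>R axis j 1) + h x
       = s\<^sup>2 * pd j (pd i h) \<xi>"
    using pd_double_difference[OF U h s(1,2)] .
  obtain \<eta> where \<eta>: "\<eta> \<in> ball x (3 * s)"
    "h (x + s *\<^sub>R axis j 1 + s *\<^sub>R axis i 1) - h (x + s *\<^sub>R axis j 1) - h (x + s *\<^sub>R axis i 1) + h x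
       = s\<^sup>2 * pd i (pd j h) \<eta>"
    using pd_double_difference[OF U h s(1,2)] .
  have sw: "x + s *\<^sub>R axis j 1 + s *\<^sub>R axis i 1 = x + s *\<^sub>R axis i 1 + s *\<^sub>R (axis j 1 :: real^3)"
    by (simp add: add.commute add.left_commute)
  have "s\<^sup>2 * pd j (pd i h) \<xi> = s\<^sup>2 * pd i (pd j h) \<eta>"
    using \<xi>(2) \<eta>(2) unfolding sw by linarith
  then have "pd j (pd i h) \<xi> = pd i (pd j h) \<eta>" using s by simp
  moreover have "dist (pd j (pd i h) \<xi>) (pd j (pd i h) x) < e"
    using \<xi>(1) s by (intro d2) (simp add: dist_commute)
  moreover have "dist (pd i (pd j h) \<eta>) (pd i (pd j h) x) < e"
    using \<eta>(1) s by (intro d1) (simp add: dist_commute)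
  ultimately have "\<bar>pd i (pd j h) x - pd j (pd i h) x\<bar> < 2 * e"
    unfolding dist_real_def by linarith
  then show False by (simp add: e_def)
qed

section \<open>Symmetry of the Euler operator on harmonic functions\<close>

definition euler :: "(real^3 \<Rightarrow> real) \<Rightarrow> real^3 \<Rightarrow> real" where
  "euler h y = (\<Sum>i\<in>UNIV. y$i * pd i h y)"

definition harmonic :: "(real^3) set \<Rightarrow> (real^3 \<Rightarrow> real) \<Rightarrow> bool" where
  "harmonic U h \<longleftrightarrow> C1 U h \<and> (\<forall>i. C1 U (pd i h)) \<and> (\<forall>x\<in>U. (\<Sum>i\<in>UNIV. pd i (pd i h) x) = 0)"

lemma harmonic_C1: "harmonic U h \<Longrightarrow> C1 U h"
  and harmonic_C1_pd: "harmonic U h \<Longrightarrow> C1 U (pd i h)"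
  and harmonic_lap: "harmonic U h \<Longrightarrow> x \<in> U \<Longrightarrow> (\<Sum>i\<in>UNIV. pd i (pd i h) x) = 0"
  by (auto simp: harmonic_def)

lemma harmonic_subset: "harmonic U h \<Longrightarrow> V \<subseteq> U \<Longrightarrow> harmonic V h"
  unfolding harmonic_def by (meson C1_subset subsetD)

lemma harmonic_affine:
  assumes h: "harmonic U h" and V: "open V" and VU: "\<And>y. y \<in> V \<Longrightarrow> a + t *\<^sub>R y \<in> U"
  shows "harmonic V (\<lambda>y. h (a + t *\<^sub>R y))"
proof -
  have p1: "pd i (\<lambda>y. h (a + t *\<^sub>R y)) y = t * pd i h (a + t *\<^sub>R y)" if "y \<in> V" for i y
    by (rule pd_affine(1)[OF C1_differentiable[OF harmonic_C1[OF h] VU[OF that]]])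
  have c2: "C1 V (pd i (\<lambda>y. h (a + t *\<^sub>R y)))" for i
    by (rule C1_cong[OF V p1[symmetric] C1_cmult[OF C1_affine[OF harmonic_C1_pd[OF h] VU]]])
  have p2: "pd i (pd i (\<lambda>y. h (a + t *\<^sub>R y))) y = t\<^sup>2 * pd i (pd i h) (a + t *\<^sub>R y)" if y: "y \<in> V" for i y
  proof -
    have d: "pd i h differentiable at (a + t *\<^sub>R y)"
      by (rule C1_differentiable[OF harmonic_C1_pd[OF h] VU[OF y]])
    have "pd i (pd i (\<lambda>y. h (a + t *\<^sub>R y))) y = pd i (\<lambda>y. t * pd i h (a + t *\<^sub>R y)) y"
      by (rule pd_cong[OF V y p1])
    also have "\<dots> = t * (t * pd i (pd i h) (a + t *\<^sub>R y))"
      by (simp add: pd_cmult pd_affine[OF d])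
    finally show ?thesis by (simp add: power2_eq_square)
  qed
  show ?thesis
    unfolding harmonic_def
  proof (intro conjI allI ballI)
    show "C1 V (\<lambda>y. h (a + t *\<^sub>R y))" by (rule C1_affine[OF harmonic_C1[OF h] VU])
    show "(\<Sum>i\<in>UNIV. pd i (pd i (\<lambda>y. h (a + t *\<^sub>R y))) y) = 0" if "y \<in> V" for y
      using harmonic_lap[OF h VU[OF that]] by (simp add: p2[OF that] sum_distrib_left[symmetric])
  qed (rule c2)
qed

lemma harmonic_add:
  assumes "open U" "harmonic U f" "harmonic U g"
  shows "harmonic U (\<lambda>x. f x + k * g x)"
proof -
  have p1: "pd i (\<lambda>x. f x + k * g x) x = pd i f x + k * pd i g x" if "x \<in> U" for i x
    using C1_differentiable[OF harmonic_C1[OF assms(2)] that] C1_differentiable[OF harmonic_C1[OF assms(3)] that]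
      C1_differentiable[OF C1_cmult[OF harmonic_C1[OF assms(3)]] that]
    by (simp add: pd_add pd_cmult)
  have c2: "C1 U (pd i (\<lambda>x. f x + k * g x))" for i
    by (rule C1_cong[OF assms(1) p1[symmetric] C1_add[OF harmonic_C1_pd[OF assms(2)] C1_cmult[OF harmonic_C1_pd[OF assms(3)]]]])
  have p2: "pd i (pd i (\<lambda>x. f x + k * g x)) x = pd i (pd i f) x + k * pd i (pd i g) x" if x: "x \<in> U" for i x
  proof -
    have "pd i (pd i (\<lambda>x. f x + k * g x)) x = pd i (\<lambda>x. pd i f x + k * pd i g x) x"
      by (rule pd_cong[OF assms(1) x p1])
    also have "\<dots> = pd i (pd i f) x + k * pd i (pd i g) x"
      using C1_differentiable[OF harmonic_C1_pd[OF assms(2)] x] C1_differentiable[OF harmonic_C1_pd[OF assms(3)] x]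
      C1_differentiable[OF C1_cmult[OF harmonic_C1_pd[OF assms(3)]] x]
      by (simp add: pd_add pd_cmult)
    finally show ?thesis .
  qed
  show ?thesis
    unfolding harmonic_def
    using C1_add[OF harmonic_C1[OF assms(2)] C1_cmult[OF harmonic_C1[OF assms(3)]]] c2
      harmonic_lap[OF assms(2)] harmonic_lap[OF assms(3)]
    by (auto simp: p2 sum.distrib sum_distrib_left[symmetric])
qed

lemma harmonic_const [simp]: "harmonic U (\<lambda>x. k)"
  by (simp add: harmonic_def)

lemma harmonic_sum:
  assumes "open U" "finite A" "\<And>a. a \<in> A \<Longrightarrow> harmonic U (f a)"
  shows "harmonic U (\<lambda>x. \<Sum>a\<in>A. f a x)"
  using assms(2,3)
proof (induction A rule: finite_induct)
  case (insert a A)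
  then show ?case using harmonic_add[OF assms(1), of "\<lambda>x. \<Sum>a\<in>A. f a x" "f a" 1]
    by (simp add: add.commute)
qed simp

lemma harmonic_continuous_cball: "harmonic U h \<Longrightarrow> cball 0 c \<subseteq> U \<Longrightarrow> continuous_on (cball 0 c) h"
  using C1_continuous[OF harmonic_C1] continuous_on_subset by blast

lemma euler_continuous: "C1 U h \<Longrightarrow> continuous_on U (euler h)"
  unfolding euler_def by (intro continuous_intros C1_continuous_pd)

text \<open>Green's second identity: the field with components
  \<open>pd i u * p - u * pd i p\<close> is divergence free, so in \<open>bint_ibp\<close> only the
  derivative of the weight survives. It is radial and produces the Euler operator.\<close>

lemma bint_euler_weighted:
  assumes W: "open W" "cball 0 c \<subseteq> W" and u: "harmonic W u" and p: "harmonic W p" and c: "c \<ge> 0"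
  shows "bint c (\<lambda>y. (c\<^sup>2 - (norm y)\<^sup>2) * (euler u y * p y - u y * euler p y)) = 0"
proof -
  let ?G = "\<lambda>i y. pd i u y * p y - u y * pd i p y"
  have dif: "u differentiable at y" "p differentiable at y" "pd i u differentiable at y" "pd i p differentiable at y"
    if "y \<in> cball 0 c" for y i
    using that W C1_differentiable[OF harmonic_C1[OF u]] C1_differentiable[OF harmonic_C1[OF p]]
      C1_differentiable[OF harmonic_C1_pd[OF u]] C1_differentiable[OF harmonic_C1_pd[OF p]] by auto
  have G: "C1 W (?G i)" for i
    by (intro C1_diff C1_mult harmonic_C1 harmonic_C1_pd u p)
  have pG: "pd i (?G i) y = pd i (pd i u) y * p y - u y * pd i (pd i p) y" if "y \<in> cball 0 c" for i y
    using dif[OF that] by (simp add: pd_diff pd_mult)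
  have cG: "continuous_on (cball 0 c) (?G i)" "continuous_on (cball 0 c) (pd i (?G i))" for i
    using continuous_on_subset[OF C1_continuous[OF G] W(2)] continuous_on_subset[OF C1_continuous_pd[OF G] W(2)] .
  have "0 = (\<Sum>i\<in>UNIV. bint c (\<lambda>y. (c\<^sup>2 - (norm y)\<^sup>2)\<^sup>2 * pd i (?G i) y - 4 * y$i * (c\<^sup>2 - (norm y)\<^sup>2) * ?G i y))"
    by (simp add: bint_ibp[OF W G c])
  also have "\<dots> = bint c (\<lambda>y. \<Sum>i\<in>UNIV. (c\<^sup>2 - (norm y)\<^sup>2)\<^sup>2 * pd i (?G i) y - 4 * y$i * (c\<^sup>2 - (norm y)\<^sup>2) * ?G i y)"
    by (rule bint_sum[symmetric]) (auto intro!: continuous_intros cG)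
  also have "\<dots> = bint c (\<lambda>y. - 4 * ((c\<^sup>2 - (norm y)\<^sup>2) * (euler u y * p y - u y * euler p y)))"
  proof (rule bint_cong)
    fix y :: "real^3" assume y: "y \<in> cball 0 c"
    then have yW: "y \<in> W" using W by auto
    have "(\<Sum>i\<in>UNIV. (c\<^sup>2 - (norm y)\<^sup>2)\<^sup>2 * pd i (?G i) y - 4 * y$i * (c\<^sup>2 - (norm y)\<^sup>2) * ?G i y)
      = (\<Sum>i\<in>UNIV. (c\<^sup>2 - (norm y)\<^sup>2)\<^sup>2 * (pd i (pd i u) y * p y - u y * pd i (pd i p) y)
          - 4 * y$i * (c\<^sup>2 - (norm y)\<^sup>2) * ?G i y)"
      by (simp only: pG[OF y])
    also have "\<dots> = (c\<^sup>2 - (norm y)\<^sup>2)\<^sup>2 * ((\<Sum>i\<in>UNIV. pd i (pd i u) y) * p y - u y * (\<Sum>i\<in>UNIV. pd i (pd i p) y))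
       - 4 * ((c\<^sup>2 - (norm y)\<^sup>2) * (euler u y * p y - u y * euler p y))"
      by (simp add: euler_def sum_subtractf sum.distrib sum_distrib_left sum_distrib_right algebra_simps)
    finally show "(\<Sum>i\<in>UNIV. (c\<^sup>2 - (norm y)\<^sup>2)\<^sup>2 * pd i (?G i) y - 4 * y$i * (c\<^sup>2 - (norm y)\<^sup>2) * ?G i y)
      = - 4 * ((c\<^sup>2 - (norm y)\<^sup>2) * (euler u y * p y - u y * euler p y))"
      by (simp add: harmonic_lap[OF u yW] harmonic_lap[OF p yW])
  qed
  finally show ?thesis unfolding bint_cmult by simp
qed

text \<open>Thin shells stand in for spheres: as \<open>d\<close> tends to \<open>c\<close>, only
  the size of \<open>f\<close> near the sphere matters.\<close>

lemma bint_shell: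
  assumes cd: "0 \<le> c" "c \<le> d" and f: "continuous_on (cball 0 d) f"
    and B: "\<And>y. y \<in> cball 0 d \<Longrightarrow> norm y \<ge> c \<Longrightarrow> \<bar>f y\<bar> \<le> B"
  shows "\<bar>bint d f - bint c f\<bar> \<le> B * ((d^3 - c^3) * bint 1 (\<lambda>y. 1))"
proof -
  have fc: "continuous_on (cball 0 c) f" using cd by (intro continuous_on_subset[OF f]) auto
  let ?D = "\<lambda>g (y::real^3). indicat_real (cball 0 d) y *\<^sub>R g y - indicat_real (cball 0 c) y *\<^sub>R g y"
  have I: "integrable lborel (?D g)" "integral\<^sup>L lborel (?D g) = bint d g - bint c g"
    if "continuous_on (cball 0 d) g" "continuous_on (cball 0 c) g" for g
    using bint_integrable[OF that(1)] bint_integrable[OF that(2)]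
    unfolding set_integrable_def bint_def set_lebesgue_integral_def by auto
  have le: "?D f y \<le> ?D (\<lambda>_. B) y" "?D (\<lambda>_. - B) y \<le> ?D f y" for y
    using B[of y] cd by (auto simp: indicator_def abs_le_iff)
  have 1: "bint d f - bint c f \<le> bint d (\<lambda>_. B) - bint c (\<lambda>_. B)"
    using integral_mono[OF I(1)[OF f fc] I(1)[OF continuous_on_const continuous_on_const] le(1)]
    unfolding I(2)[OF f fc] I(2)[OF continuous_on_const continuous_on_const] .
  have 2: "bint d (\<lambda>_. - B) - bint c (\<lambda>_. - B) \<le> bint d f - bint c f"
    using integral_mono[OF I(1)[OF continuous_on_const continuous_on_const] I(1)[OF f fc] le(2)]
    unfolding I(2)[OF f fc] I(2)[OF continuous_on_const continuous_on_const] .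
  have 3: "bint d (\<lambda>_. k) - bint c (\<lambda>_. k) = k * ((d^3 - c^3) * bint 1 (\<lambda>y. 1))" for k
    unfolding bint_const[of d k] bint_const[of c k] using bint_one[of d] bint_one[of c] cd
    by (simp add: algebra_simps)
  have "bint d f - bint c f \<le> B * ((d^3 - c^3) * bint 1 (\<lambda>y. 1))"
    using 1 by (simp only: 3)
  moreover have "- (B * ((d^3 - c^3) * bint 1 (\<lambda>y. 1))) \<le> bint d f - bint c f"
    using 2 by (simp only: 3 mult_minus_left)
  ultimately show ?thesis unfolding abs_le_iff by (intro conjI) linarith+
qed

text \<open>The weight \<open>c\<^sup>2 - |y|\<^sup>2\<close> is removed by a difference quotient in \<open>c\<^sup>2\<close>.\<close>

lemma bint_euler_symmetric:
  assumes W: "open W" "cball 0 c \<subseteq> W" and u: "harmonic W u" and p: "harmonic W p" and c: "c > 0"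
  shows "bint c (\<lambda>y. euler u y * p y - u y * euler p y) = 0"
proof -
  let ?q = "\<lambda>y. euler u y * p y - u y * euler p y"
  obtain e where e: "e > 0" "cball 0 (c + e) \<subseteq> W"
    using cball_subset_open_margin[OF W] c by auto
  have cq: "continuous_on W ?q"
    by (intro continuous_intros euler_continuous C1_continuous harmonic_C1 u p)
  have "compact (?q ` cball 0 (c + e))"
    by (intro compact_continuous_image continuous_on_subset[OF cq e(2)]) auto
  then have "bounded (?q ` cball 0 (c + e))" by (rule compact_imp_bounded)
  then obtain M where "\<forall>z\<in>?q ` cball 0 (c + e). norm z \<le> M" unfolding bounded_iff ..
  then have M: "\<bar>?q y\<bar> \<le> M" if "y \<in> cball 0 (c + e)" for y
    using that by auto
  have M0: "M \<ge> 0" using M[of 0] c e by auto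
  \<comment> \<open>On the inner ball \<open>d^2 - |y|^2\<close> is the constant
    \<open>d^2 - c^2\<close> plus the weight for \<open>c\<close>, and both weighted integrals
    vanish. The shell contributes at most a multiple of \<open>(d^2 - c^2)(d^3 - c^3)\<close>, so a
    small factor survives division by \<open>d^2 - c^2\<close>.\<close>
  have est: "\<bar>bint c ?q\<bar> \<le> M * ((d^3 - c^3) * bint 1 (\<lambda>y. 1))" if d: "c < d" "d < c + e" for d
  proof -
    let ?f = "\<lambda>y. (d\<^sup>2 - (norm y)\<^sup>2) * ?q y"
    have sub: "cball 0 d \<subseteq> cball (0::real^3) (c + e)" "cball 0 c \<subseteq> cball (0::real^3) (c + e)" using d by auto
    have cqd: "continuous_on (cball 0 d) ?q" "continuous_on (cball 0 c) ?q"
      by (rule continuous_on_subset[OF cq], use sub e in blast)+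
    have d0: "d\<^sup>2 - c\<^sup>2 > 0" using d c by (simp add: power_strict_mono)
    have "bint d ?f = 0"
      by (rule bint_euler_weighted[OF W(1) _ u p]) (use sub e d c in auto)
    moreover have "bint c ?f = (d\<^sup>2 - c\<^sup>2) * bint c ?q"
    proof -
      have "bint c ?f = bint c (\<lambda>y. (d\<^sup>2 - c\<^sup>2) * ?q y + (c\<^sup>2 - (norm y)\<^sup>2) * ?q y)"
        by (rule bint_cong) (simp add: algebra_simps)
      also have "\<dots> = bint c (\<lambda>y. (d\<^sup>2 - c\<^sup>2) * ?q y) + bint c (\<lambda>y. (c\<^sup>2 - (norm y)\<^sup>2) * ?q y)"
        by (rule bint_add) (intro continuous_intros cqd)+
      finally show ?thesis
        using bint_euler_weighted[OF W u p] c by (simp add: bint_cmult)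
    qed
    moreover have "\<bar>bint d ?f - bint c ?f\<bar> \<le> ((d\<^sup>2 - c\<^sup>2) * M) * ((d^3 - c^3) * bint 1 (\<lambda>y. 1))"
    proof (rule bint_shell)
      fix y :: "real^3" assume y: "y \<in> cball 0 d" "norm y \<ge> c"
      have "(norm y)\<^sup>2 \<le> d\<^sup>2" "c\<^sup>2 \<le> (norm y)\<^sup>2" using y c by (auto intro!: power_mono)
      then have 1: "\<bar>d\<^sup>2 - (norm y)\<^sup>2\<bar> \<le> d\<^sup>2 - c\<^sup>2" by simp
      have "y \<in> cball 0 (c + e)" using y sub by blast
      then have 2: "\<bar>?q y\<bar> \<le> M" by (rule M)
      show "\<bar>?f y\<bar> \<le> (d\<^sup>2 - c\<^sup>2) * M"
        unfolding abs_mult by (rule mult_mono[OF 1 2]) (use d0 in simp_all)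
    next
      show "continuous_on (cball 0 d) ?f" by (intro continuous_intros cqd)
    qed (use c d in auto)
    ultimately have "\<bar>(d\<^sup>2 - c\<^sup>2) * bint c ?q\<bar> \<le> ((d\<^sup>2 - c\<^sup>2) * M) * ((d^3 - c^3) * bint 1 (\<lambda>y. 1))"
      by simp
    then have "(d\<^sup>2 - c\<^sup>2) * \<bar>bint c ?q\<bar> \<le> (d\<^sup>2 - c\<^sup>2) * (M * ((d^3 - c^3) * bint 1 (\<lambda>y. 1)))"
      using d0 by (simp only: abs_mult mult.assoc abs_of_pos)
    then show ?thesis by (simp only: mult_le_cancel_left_pos[OF d0])
  qed
  have lim: "((\<lambda>d. M * ((d^3 - c^3) * bint 1 (\<lambda>y. 1))) \<longlongrightarrow> M * ((c^3 - c^3) * bint 1 (\<lambda>y. 1))) (at_right c)"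
    by (intro tendsto_intros)
  have ev: "\<forall>\<^sub>F d in at_right c. \<bar>bint c ?q\<bar> \<le> M * ((d^3 - c^3) * bint 1 (\<lambda>y. 1))"
    unfolding eventually_at_right_field using est e by (intro exI[of _ "c + e"]) auto
  have "\<bar>bint c ?q\<bar> \<le> M * ((c^3 - c^3) * bint 1 (\<lambda>y. 1))"
    by (rule tendsto_lowerbound[OF lim ev]) simp
  then show ?thesis by simp
qed

section \<open>Homogeneous expansion\<close>

lemma continuous_cball_bounded:
  fixes f :: "'a::euclidean_space \<Rightarrow> real"
  assumes "continuous_on (cball 0 r) f"
  shows "\<exists>C. \<forall>y. norm y \<le> r \<longrightarrow> \<bar>f y\<bar> \<le> C"
proof -
  have "bounded (f ` cball 0 r)"
    by (intro compact_imp_bounded compact_continuous_image assms) simp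
  then obtain a where "\<forall>z\<in>f ` cball 0 r. norm z \<le> a" unfolding bounded_iff ..
  then show ?thesis by (intro exI[of _ a]) auto
qed

text \<open>With the Euler operator symmetric, \<open>\<integral> u(\<tau> y) p(s y / \<tau>)\<close> does not depend on \<open>\<tau>\<close>.\<close>

lemma bint_scale_symmetric:
  assumes u: "harmonic (ball 0 1) u" and p: "harmonic (ball 0 1) p"
    and c: "0 < c" "c < 1" and s: "0 < s" "s \<le> 1"
  shows "bint c (\<lambda>y. u (s *\<^sub>R y) * p y) = bint c (\<lambda>y. u y * p (s *\<^sub>R y))"
proof (cases "s = 1")
  case False
  with s have s1: "s < 1" by simp
  let ?B = "ball (0::real^3) 1" and ?K = "cball (0::real^3) c"
  \<comment> \<open>The \<open>tau\<close> for which \<open>tau y\<close> and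
    \<open>(s / tau) y\<close> both stay in the open unit ball whenever
    \<open>|y| <= c\<close>.\<close>
  define T where "T = {s * c<..<1 / c}"
  have T: "open T" by (simp add: T_def)
  have st: "{s..1} \<subseteq> T"
  proof
    fix \<tau> assume \<tau>: "\<tau> \<in> {s..1}"
    have "s * c < s * 1" using s c by (intro mult_strict_left_mono) auto
    then have "s * c < \<tau>" using \<tau> by simp
    have "\<tau> * c \<le> 1 * c" using \<tau> s c by (intro mult_right_mono) auto
    then have "\<tau> * c < 1" using c by linarith
    with \<open>s * c < \<tau>\<close> show "\<tau> \<in> T" using c by (simp add: T_def less_divide_eq)
  qed
  have pos: "\<tau> > 0" if "\<tau> \<in> T" for \<tau>
    using that s c by (auto simp: T_def intro: less_trans[of 0 "s * c"])
  have inB: "\<tau> *\<^sub>R y \<in> ?B" "(s / \<tau>) *\<^sub>R y \<in> ?B" if "\<tau> \<in> T" "y \<in> ?K" for \<tau> y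
  proof -
    have "\<tau> * norm y \<le> \<tau> * c" using that pos[OF that(1)] by (intro mult_left_mono) auto
    moreover have "\<tau> * c < 1" using that c by (simp add: T_def field_simps)
    moreover have "norm (\<tau> *\<^sub>R y) = \<tau> * norm y" using pos[OF that(1)] by simp
    ultimately have "norm (\<tau> *\<^sub>R y) < 1" by linarith
    then show "\<tau> *\<^sub>R y \<in> ?B" by (simp only: mem_ball dist_0_norm)
    have "s / \<tau> * norm y \<le> s / \<tau> * c" using that pos[OF that(1)] s by (intro mult_left_mono) auto
    moreover have "s / \<tau> * c < 1" using that pos[OF that(1)] by (simp add: T_def field_simps)
    moreover have "norm ((s / \<tau>) *\<^sub>R y) = s / \<tau> * norm y" using pos[OF that(1)] s by simp
    ultimately have "norm ((s / \<tau>) *\<^sub>R y) < 1" by linarith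
    then show "(s / \<tau>) *\<^sub>R y \<in> ?B" by (simp only: mem_ball dist_0_norm)
  qed
  let ?\<Phi> = "\<lambda>\<tau>. LINT y:?K|lborel. u (\<tau> *\<^sub>R y) * p ((s / \<tau>) *\<^sub>R y)"
  let ?g = "\<lambda>\<tau> y. (\<Sum>i\<in>UNIV. y$i * pd i u (\<tau> *\<^sub>R y)) * p ((s / \<tau>) *\<^sub>R y)
      + (\<Sum>i\<in>UNIV. ((- s / \<tau>\<^sup>2) *\<^sub>R y)$i * pd i p ((s / \<tau>) *\<^sub>R y)) * u (\<tau> *\<^sub>R y)"
  note cu = C1_continuous[OF harmonic_C1[OF u]] C1_continuous_pd[OF harmonic_C1[OF u]]
  note cp = C1_continuous[OF harmonic_C1[OF p]] C1_continuous_pd[OF harmonic_C1[OF p]]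
  have D: "(?\<Phi> has_real_derivative (LINT y:?K|lborel. ?g \<tau> y)) (at \<tau>)" if "\<tau> \<in> T" for \<tau>
  proof (rule leibniz_compact_real[OF _ T that])
    fix \<tau> y assume ty: "\<tau> \<in> T" "y \<in> ?K"
    have 1: "((\<lambda>\<tau>. \<tau> *\<^sub>R y) has_vector_derivative y) (at \<tau>)"
      by (auto intro!: derivative_eq_intros)
    have "((\<lambda>\<tau>. s / \<tau>) has_real_derivative (- s / \<tau>\<^sup>2)) (at \<tau>)"
      using pos[OF ty(1)] by (auto intro!: derivative_eq_intros simp: power2_eq_square)
    from has_vector_derivative_scaleR[OF this has_vector_derivative_const[of y]]
    have 2: "((\<lambda>\<tau>. (s / \<tau>) *\<^sub>R y) has_vector_derivative ((- s / \<tau>\<^sup>2) *\<^sub>R y)) (at \<tau>)"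
      by simp
    show "((\<lambda>\<tau>. u (\<tau> *\<^sub>R y) * p ((s / \<tau>) *\<^sub>R y)) has_real_derivative ?g \<tau> y) (at \<tau>)"
      by (rule DERIV_mult[OF C1_curve[OF harmonic_C1[OF u] inB(1)[OF ty] 1]
            C1_curve[OF harmonic_C1[OF p] inB(2)[OF ty] 2]])
  next
    show "continuous_on ?K (\<lambda>y. u (\<tau> *\<^sub>R y) * p ((s / \<tau>) *\<^sub>R y))" if "\<tau> \<in> T" for \<tau>
      by (intro continuous_on_mult continuous_on_compose2[OF cu(1)] continuous_on_compose2[OF cp(1)] continuous_intros)
        (use inB[OF that] in auto)
    show "continuous_on (T \<times> ?K) (\<lambda>(\<tau>, y). ?g \<tau> y)"
      unfolding case_prod_unfold
      by (intro continuous_on_add continuous_on_mult continuous_on_sum continuous_on_compose2[OF cu(1)]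
          continuous_on_compose2[OF cp(1)] continuous_on_compose2[OF cu(2)] continuous_on_compose2[OF cp(2)] continuous_intros)
        (use inB pos in \<open>auto simp: less_imp_neq[symmetric]\<close>)
  qed auto
  \<comment> \<open>Up to the factor \<open>1 / tau\<close> this is the pairing of
    \<open>bint_euler_symmetric\<close> for the two dilated functions.\<close>
  have Z: "(LINT y:?K|lborel. ?g \<tau> y) = 0" if \<tau>: "\<tau> \<in> T" for \<tau>
  proof -
    define W where "W = (\<lambda>y. \<tau> *\<^sub>R y) -` ?B \<inter> (\<lambda>y. (s / \<tau>) *\<^sub>R y) -` ?B"
    have W: "open W" unfolding W_def
      by (intro open_Int open_vimage continuous_intros) auto
    have KW: "?K \<subseteq> W" using inB[OF \<tau>] by (auto simp: W_def)
    let ?u = "\<lambda>y. u (\<tau> *\<^sub>R y)" and ?p = "\<lambda>y. p ((s / \<tau>) *\<^sub>R y)"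
    have hu: "harmonic W ?u" using harmonic_affine[OF u W, of 0 \<tau>] by (simp add: W_def)
    have hp: "harmonic W ?p" using harmonic_affine[OF p W, of 0 "s / \<tau>"] by (simp add: W_def)
    have eu: "euler ?u y = \<tau> * (\<Sum>i\<in>UNIV. y$i * pd i u (\<tau> *\<^sub>R y))" if "y \<in> ?K" for y
      using pd_affine(1)[where a=0 and t=\<tau> and x=y] C1_differentiable[OF harmonic_C1[OF u] inB(1)[OF \<tau> that]]
      by (simp add: euler_def sum_distrib_left mult_ac)
    have ep: "euler ?p y = (s / \<tau>) * (\<Sum>i\<in>UNIV. y$i * pd i p ((s / \<tau>) *\<^sub>R y))" if "y \<in> ?K" for y
      using pd_affine(1)[where a=0 and t="s / \<tau>" and x=y] C1_differentiable[OF harmonic_C1[OF p] inB(2)[OF \<tau> that]]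
      by (simp add: euler_def sum_distrib_left mult_ac)
    have "0 = (1 / \<tau>) * bint c (\<lambda>y. euler ?u y * ?p y - ?u y * euler ?p y)"
      by (simp add: bint_euler_symmetric[OF W KW hu hp c(1)])
    also have "\<dots> = bint c (\<lambda>y. (1 / \<tau>) * (euler ?u y * ?p y - ?u y * euler ?p y))"
      by (rule bint_cmult[symmetric])
    also have "\<dots> = bint c (?g \<tau>)"
    proof (rule bint_cong)
      fix y assume y: "y \<in> ?K"
      have s2: "(\<Sum>i\<in>UNIV. ((- s / \<tau>\<^sup>2) *\<^sub>R y)$i * pd i p ((s / \<tau>) *\<^sub>R y))
          = (- s / \<tau>\<^sup>2) * (\<Sum>i\<in>UNIV. y$i * pd i p ((s / \<tau>) *\<^sub>R y))"
        unfolding sum_distrib_left by (simp add: mult.assoc)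
      show "(1 / \<tau>) * (euler ?u y * ?p y - ?u y * euler ?p y) = ?g \<tau> y"
        unfolding eu[OF y] ep[OF y] s2 using pos[OF \<tau>]
        by (simp add: field_simps power2_eq_square)
    qed
    finally show ?thesis by (simp add: bint_def)
  qed
  \<comment> \<open>The end points \<open>1\<close> and \<open>s\<close> of the interval give the
    two sides of the claim.\<close>
  have "?\<Phi> 1 = ?\<Phi> s"
  proof (rule DERIV_isconst_end[OF s1])
    show "continuous_on {s..1} ?\<Phi>"
    proof (rule continuous_at_imp_continuous_on, rule ballI)
      fix \<tau> assume "\<tau> \<in> {s..1}"
      then show "isCont ?\<Phi> \<tau>" using st by (intro DERIV_isCont[OF D]) auto
    qed
    show "(?\<Phi> has_real_derivative 0) (at \<tau>)" if "s < \<tau>" "\<tau> < 1" for \<tau>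
    proof -
      have "\<tau> \<in> T" using st that by auto
      then show ?thesis using D[of \<tau>] Z[of \<tau>] by simp
    qed
  qed
  then show ?thesis using s by (simp add: bint_def)
qed simp

text \<open>By homogeneity and \<open>bint_scale_symmetric\<close>, \<open>s^m\<close> times the
  integral is the integral of \<open>w (s y) p y\<close>, which is \<open>O(s^(N+1))\<close>. As
  \<open>m <= N\<close>, division by \<open>s^m\<close> leaves a factor \<open>s\<close> that tends
  to zero.\<close>

lemma bint_vanishing:
  assumes w: "harmonic (ball 0 1) w" and p: "harmonic (ball 0 1) p" and c: "0 < c" "c < 1"
    and hom: "\<And>s y. p (s *\<^sub>R y) = s ^ m * p y" and mN: "m \<le> N"
    and r: "r > 0" and van: "\<And>y. norm y \<le> r \<Longrightarrow> \<bar>w y\<bar> \<le> C * norm y ^ Suc N"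
  shows "bint c (\<lambda>y. w y * p y) = 0"
proof -
  let ?K = "cball (0::real^3) c" and ?I = "bint c (\<lambda>y. w y * p y)"
  have KB: "?K \<subseteq> ball 0 1" using c by auto
  have cw: "continuous_on ?K w" and cp: "continuous_on ?K p"
    using harmonic_continuous_cball[OF w KB] harmonic_continuous_cball[OF p KB] .
  obtain M0 where M0: "\<bar>p y\<bar> \<le> M0" if "y \<in> ?K" for y
    using continuous_cball_bounded[OF cp] by auto
  define M where "M = max M0 0"
  have M: "\<bar>p y\<bar> \<le> M" "M \<ge> 0" if "y \<in> ?K" for y using M0[OF that] by (auto simp: M_def)
  define C' where "C' = max C 0"
  have van': "\<bar>w y\<bar> \<le> C' * norm y ^ Suc N" if "norm y \<le> r" for y
    using van[OF that] mult_right_mono[of C C' "norm y ^ Suc N"] by (simp add: C'_def)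
  have C': "C' \<ge> 0" by (simp add: C'_def)
  let ?V = "bint c (\<lambda>y. 1)"
  have est: "\<bar>?I\<bar> \<le> C' * M * ?V * s" if s: "0 < s" "s \<le> min 1 r" for s
  proof -
    have cws: "continuous_on ?K (\<lambda>y. w (s *\<^sub>R y))"
    proof (intro continuous_on_compose2[OF cw] continuous_intros)
      show "(\<lambda>y. s *\<^sub>R y) ` ?K \<subseteq> ?K"
      proof
        fix z assume "z \<in> (\<lambda>y. s *\<^sub>R y) ` ?K"
        then obtain y where "z = s *\<^sub>R y" "y \<in> ?K" by blast
        then have "norm y \<le> c" by simp
        have "s * norm y \<le> 1 * c" using s c \<open>norm y \<le> c\<close> by (intro mult_mono) auto
        then show "z \<in> ?K" using s \<open>z = s *\<^sub>R y\<close> by simp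
      qed
    qed
    have "s ^ m * ?I = bint c (\<lambda>y. s ^ m * (w y * p y))"
      by (rule bint_cmult[symmetric])
    also have "\<dots> = bint c (\<lambda>y. w y * p (s *\<^sub>R y))"
      by (rule bint_cong) (simp add: hom)
    also have "\<dots> = bint c (\<lambda>y. w (s *\<^sub>R y) * p y)"
      using bint_scale_symmetric[OF w p c, of s] s by simp
    finally have eq: "s ^ m * ?I = bint c (\<lambda>y. w (s *\<^sub>R y) * p y)" .
    have "\<bar>bint c (\<lambda>y. w (s *\<^sub>R y) * p y)\<bar> \<le> (C' * s ^ Suc N * M) * ?V"
    proof (rule bint_abs_le)
      fix y assume y: "y \<in> ?K"
      then have ny: "norm y \<le> 1" using c by simp
      have "norm (s *\<^sub>R y) \<le> s" using ny s by (simp add: mult_left_le)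
      then have "norm (s *\<^sub>R y) \<le> r" using s by linarith
      then have "\<bar>w (s *\<^sub>R y)\<bar> \<le> C' * norm (s *\<^sub>R y) ^ Suc N" by (rule van')
      also have "\<dots> \<le> C' * s ^ Suc N"
        using \<open>norm (s *\<^sub>R y) \<le> s\<close> C' by (intro mult_left_mono power_mono) auto
      finally show "\<bar>w (s *\<^sub>R y) * p y\<bar> \<le> C' * s ^ Suc N * M"
        unfolding abs_mult using M[OF y] C' s by (intro mult_mono) auto
    qed (intro continuous_intros cws cp)
    then have "s ^ m * \<bar>?I\<bar> \<le> (C' * s ^ Suc N * M) * ?V"
      using s unfolding eq[symmetric] abs_mult by simp
    also have "s ^ Suc N = s ^ m * (s * s ^ (N - m))"
      using mN by (simp add: power_add[symmetric])
    also have "(C' * (s ^ m * (s * s ^ (N - m))) * M) * ?V = s ^ m * (C' * M * ?V * s * s ^ (N - m))"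
      by (simp add: mult_ac)
    finally have "\<bar>?I\<bar> \<le> C' * M * ?V * s * s ^ (N - m)"
      using s by (simp add: mult_le_cancel_left_pos)
    also have "\<dots> \<le> C' * M * ?V * s * 1"
      using s C' M[of 0] c bint_one_pos[of c] by (intro mult_left_mono power_le_one) auto
    finally show ?thesis by simp
  qed
  have lim: "((\<lambda>s. C' * M * ?V * s) \<longlongrightarrow> C' * M * ?V * 0) (at_right 0)"
    by (intro tendsto_intros)
  have ev: "\<forall>\<^sub>F s in at_right 0. \<bar>?I\<bar> \<le> C' * M * ?V * s"
    unfolding eventually_at_right_field using est r by (intro exI[of _ "min 1 r"]) auto
  have "\<bar>?I\<bar> \<le> C' * M * ?V * 0"
    by (rule tendsto_lowerbound[OF lim ev]) simp
  then show ?thesis by simp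
qed

text \<open>For smooth \<open>h\<close>, \<open>hom n h\<close> is the degree \<open>n\<close> part of the Taylor expansion of \<open>h\<close> at \<open>0\<close>.\<close>

primrec hom :: "nat \<Rightarrow> (real^3 \<Rightarrow> real) \<Rightarrow> real^3 \<Rightarrow> real" where
  "hom 0 h x = h 0"
| "hom (Suc n) h x = (\<Sum>i\<in>UNIV. x$i * hom n (pd i h) x) / Suc n"

lemma hom_cong:
  assumes "open U" "0 \<in> U" "\<And>y. y \<in> U \<Longrightarrow> f y = g y"
  shows "hom n f x = hom n g x"
  using assms(3)
proof (induction n arbitrary: f g)
  case (Suc n)
  have "hom n (pd i f) x = hom n (pd i g) x" for i
    by (rule Suc.IH) (rule pd_cong[OF assms(1) _ Suc.prems])
  then show ?case by simp
qed (use assms in simp)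

lemma hom_scale: "hom n h (s *\<^sub>R x) = s ^ n * hom n h x"
  by (induction n arbitrary: h) (simp_all add: sum_distrib_left mult_ac)

text \<open>The form with a vanishing sum serves twice: for the Laplace equation and for the zero
  trace of the homogeneous parts.\<close>

lemma hom_sum_eq_0:
  assumes U: "open U" "0 \<in> U" and A: "finite A"
    and "\<And>a. a \<in> A \<Longrightarrow> smooth U (g a)" "\<And>y. y \<in> U \<Longrightarrow> (\<Sum>a\<in>A. g a y) = 0"
  shows "(\<Sum>a\<in>A. hom n (g a) x) = 0"
  using assms(4,5)
proof (induction n arbitrary: g)
  case 0
  then show ?case using U by simp
next
  case (Suc n)
  have "(\<Sum>a\<in>A. hom n (pd i (g a)) x) = 0" for i
  proof (rule Suc.IH)
    show "(\<Sum>a\<in>A. pd i (g a) y) = 0" if y: "y \<in> U" for y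
    proof -
      have "(\<Sum>a\<in>A. pd i (g a) y) = pd i (\<lambda>y. \<Sum>a\<in>A. g a y) y"
        by (rule pd_sum[symmetric]) (use A Suc.prems(1) y C1_differentiable smooth_C1 in blast)+
      also have "\<dots> = pd i (\<lambda>y. 0) y"
        by (rule pd_cong[OF U(1) y]) (rule Suc.prems(2))
      finally show ?thesis by simp
    qed
  qed (use Suc.prems smooth_pd in auto)
  then have "(\<Sum>i\<in>UNIV. x$i * (\<Sum>a\<in>A. hom n (pd i (g a)) x)) = 0" by simp
  then have "(\<Sum>a\<in>A. \<Sum>i\<in>UNIV. x$i * hom n (pd i (g a)) x) = 0"
    unfolding sum_distrib_left by (subst sum.swap)
  then show ?case by (simp add: sum_divide_distrib[symmetric])
qed

lemma smooth_pd_commute: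
  assumes "open U" "smooth U h" "x \<in> U"
  shows "pd i (pd j h) x = pd j (pd i h) x"
  by (rule pd_commute[OF assms(1) smooth_C1[OF assms(2)] smooth_C1[OF smooth_pd[OF assms(2)]] assms(3)])

text \<open>Both claims go through one strong induction. The product rule leaves the sum of
  \<open>x$j * pd i (hom n (pd j h)) x\<close>, which the formula one degree lower and commuting
  partial derivatives turn into \<open>n * hom n (pd i h) x\<close>.\<close>

lemma hom_C1_pd:
  assumes U: "open U" "0 \<in> U" and h: "smooth U h"
  shows "C1 UNIV (hom n h) \<and> (\<forall>i x. pd i (hom (Suc n) h) x = hom n (pd i h) x)"
  using h
proof (induction n arbitrary: h rule: less_induct)
  case (less n)
  have c1: "C1 UNIV (hom n h)" if "smooth U h" for h
  proof (cases n)
    case (Suc m)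
    have "C1 UNIV (\<lambda>x. (1 / Suc m) * (\<Sum>i\<in>UNIV. x$i * hom m (pd i h) x))"
      using less.IH[of m] Suc smooth_pd[OF that] by (intro C1_cmult C1_sum C1_mult C1_coord) auto
    moreover have "hom (Suc m) h = (\<lambda>x. (1 / Suc m) * (\<Sum>i\<in>UNIV. x$i * hom m (pd i h) x))" by auto
    ultimately show ?thesis using Suc by simp
  next
    case 0
    have "hom 0 h = (\<lambda>x. h 0)" by auto
    then show ?thesis using 0 by simp
  qed
  have d: "hom n (pd j h) differentiable at x" for j x
    by (rule C1_differentiable[OF c1[OF smooth_pd[OF less.prems]]]) simp
  have "pd i (hom (Suc n) h) x = hom n (pd i h) x" for i x
  proof -
    let ?S = "\<lambda>x. \<Sum>j\<in>UNIV. x$j * hom n (pd j h) x"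
    have dm: "(\<lambda>x. x$j * hom n (pd j h) x) differentiable at x" for j
      by (rule C1_differentiable[OF C1_mult[OF C1_coord c1[OF smooth_pd[OF less.prems]]]]) simp
    have dS: "?S differentiable at x"
      by (rule differentiable_sum) (use dm in auto)
    have "hom (Suc n) h = (\<lambda>x. (1 / Suc n) * ?S x)" by auto
    then have "pd i (hom (Suc n) h) x = (1 / Suc n) * pd i ?S x"
      by (simp only: pd_cmult[OF dS])
    also have "pd i ?S x = (\<Sum>j\<in>UNIV. pd i (\<lambda>x. x$j * hom n (pd j h) x) x)"
      by (intro pd_sum dm) auto
    also have "\<dots> = (\<Sum>j\<in>UNIV. x$j * pd i (hom n (pd j h)) x + (if i = j then 1 else 0) * hom n (pd j h) x)"
      by (simp add: pd_mult[OF differentiable_coord d] pd_coord)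
    also have "\<dots> = (\<Sum>j\<in>UNIV. x$j * pd i (hom n (pd j h)) x) + hom n (pd i h) x"
      by (simp add: sum.distrib mult_delta_left)
    also have "(\<Sum>j\<in>UNIV. x$j * pd i (hom n (pd j h)) x) = n * hom n (pd i h) x"
    proof (cases n)
      case 0
      have "hom 0 (pd j h) = (\<lambda>x. pd j h 0)" for j by auto
      then show ?thesis using 0 by simp
    next
      case (Suc m)
      have "pd i (hom (Suc m) (pd j h)) x = hom m (pd j (pd i h)) x" for j
      proof -
        have "pd i (hom (Suc m) (pd j h)) x = hom m (pd i (pd j h)) x"
          using less.IH[of m "pd j h"] Suc smooth_pd[OF less.prems] by (simp del: hom.simps)
        also have "\<dots> = hom m (pd j (pd i h)) x"
          by (rule hom_cong[OF U]) (rule smooth_pd_commute[OF U(1) less.prems])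
        finally show ?thesis .
      qed
      then show ?thesis using Suc by simp
    qed
    also have "1 / real (Suc n) * (real n * hom n (pd i h) x + hom n (pd i h) x) = hom n (pd i h) x"
      by (simp add: field_simps del: hom.simps)
    finally show ?thesis .
  qed
  with c1[OF less.prems] show ?case by blast
qed

lemma hom_C1: "open U \<Longrightarrow> 0 \<in> U \<Longrightarrow> smooth U h \<Longrightarrow> C1 UNIV (hom n h)"
  using hom_C1_pd by blast

lemma pd_hom_Suc: "open U \<Longrightarrow> 0 \<in> U \<Longrightarrow> smooth U h \<Longrightarrow> pd i (hom (Suc n) h) = hom n (pd i h)"
  using hom_C1_pd by blast

lemma pd_hom_0: "pd i (hom 0 h) = (\<lambda>x. 0)"
proof -
  have "hom 0 h = (\<lambda>x. h 0)" by auto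
  then show ?thesis by simp
qed

lemma euler_hom:
  assumes "open U" "0 \<in> U" "smooth U h"
  shows "(\<Sum>i\<in>UNIV. x$i * pd i (hom n h) x) = n * hom n h x"
proof (cases n)
  case 0
  then show ?thesis by (simp add: pd_hom_0)
next
  case (Suc m)
  then show ?thesis by (simp add: pd_hom_Suc[OF assms] del: hom.simps) (simp add: field_simps)
qed

lemma hom_harmonic:
  assumes U: "open U" "0 \<in> U" and h: "smooth U h" and lap: "\<And>x. x \<in> U \<Longrightarrow> (\<Sum>i\<in>UNIV. pd i (pd i h) x) = 0"
  shows "harmonic UNIV (hom n h)"
proof -
  have 1: "C1 UNIV (pd i (hom n h))" for i
    by (cases n) (auto simp: pd_hom_0 pd_hom_Suc[OF U h] hom_C1[OF U smooth_pd[OF h]] simp del: hom.simps)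
  have 2: "(\<Sum>i\<in>UNIV. pd i (pd i (hom n h)) x) = 0" for x
  proof (cases n)
    case 0
    then show ?thesis by (simp add: pd_hom_0)
  next
    case (Suc m)
    show ?thesis
    proof (cases m)
      case 0
      then show ?thesis using Suc by (simp add: pd_hom_0 pd_hom_Suc[OF U h] del: hom.simps)
    next
      case (Suc k)
      have "(\<Sum>i\<in>UNIV. hom k (pd i (pd i h)) x) = 0"
        by (rule hom_sum_eq_0[OF U]) (auto simp: lap intro!: smooth_pd h)
      then show ?thesis using Suc \<open>n = Suc m\<close>
        by (simp add: pd_hom_Suc[OF U h] pd_hom_Suc[OF U smooth_pd[OF h]] del: hom.simps)
    qed
  qed
  show ?thesis unfolding harmonic_def using hom_C1[OF U h] 1 2 by auto
qed

text \<open>The mean value theorem on the segment from \<open>0\<close> gains one power of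
  \<open>norm x\<close>; this drives the induction for the Taylor remainder.\<close>

lemma C1_vanishing_order:
  assumes U: "cball 0 r \<subseteq> U" and w: "C1 U w" and w0: "w 0 = 0"
    and b: "\<And>i y. norm y \<le> r \<Longrightarrow> \<bar>pd i w y\<bar> \<le> C i * norm y ^ N" and x: "norm x \<le> r"
  shows "\<bar>w x\<bar> \<le> (\<Sum>i\<in>UNIV. \<bar>C i\<bar>) * norm x ^ Suc N"
proof -
  have nb: "norm (t *\<^sub>R x) \<le> norm x" if "0 \<le> t" "t \<le> 1" for t
    using that by (simp add: mult_left_le_one_le)
  have D: "((\<lambda>t. w (t *\<^sub>R x)) has_real_derivative (\<Sum>i\<in>UNIV. x$i * pd i w (t *\<^sub>R x))) (at t)"
    if "0 \<le> t" "t \<le> 1" for t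
  proof -
    have "((\<lambda>t. t *\<^sub>R x) has_vector_derivative x) (at t)"
      by (auto intro!: derivative_eq_intros)
    moreover have "t *\<^sub>R x \<in> U" using nb[OF that] x U by (auto simp: subset_iff)
    ultimately show ?thesis by (intro C1_curve[OF w])
  qed
  have "\<exists>t>0. t < 1 \<and> w (1 *\<^sub>R x) - w (0 *\<^sub>R x) = (1 - 0) * (\<Sum>i\<in>UNIV. x$i * pd i w (t *\<^sub>R x))"
    by (rule MVT2) (use D in auto)
  then obtain t where t: "0 < t" "t < 1" "w x = (\<Sum>i\<in>UNIV. x$i * pd i w (t *\<^sub>R x))"
    using w0 by auto
  have "\<bar>w x\<bar> \<le> (\<Sum>i\<in>UNIV. \<bar>x$i * pd i w (t *\<^sub>R x)\<bar>)"
    unfolding t(3) by (rule sum_abs)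
  also have "\<dots> \<le> (\<Sum>i\<in>UNIV. norm x * (\<bar>C i\<bar> * norm x ^ N))"
  proof (rule sum_mono)
    fix i
    have le: "norm (t *\<^sub>R x) \<le> norm x" by (rule nb) (use t in auto)
    have "\<bar>pd i w (t *\<^sub>R x)\<bar> \<le> C i * norm (t *\<^sub>R x) ^ N" using le x by (intro b) auto
    also have "\<dots> \<le> \<bar>C i\<bar> * norm x ^ N" using le by (intro mult_mono power_mono) auto
    finally show "\<bar>x$i * pd i w (t *\<^sub>R x)\<bar> \<le> norm x * (\<bar>C i\<bar> * norm x ^ N)"
      unfolding abs_mult using component_le_norm_cart[of x i] by (intro mult_mono) auto
  qed
  also have "\<dots> = (\<Sum>i\<in>UNIV. \<bar>C i\<bar>) * norm x ^ Suc N"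
    by (simp add: sum_distrib_left sum_distrib_right mult_ac)
  finally show ?thesis .
qed

text \<open>By \<open>pd_hom_Suc\<close>, \<open>pd i\<close> maps the remainder of \<open>h\<close>
  after degree \<open>N + 1\<close> to the remainder of \<open>pd i h\<close> after degree
  \<open>N\<close>.\<close>

lemma hom_taylor:
  assumes U: "open U" "cball 0 r \<subseteq> U" "r > 0" and h: "smooth U h"
  shows "\<exists>C. \<forall>x. norm x \<le> r \<longrightarrow> \<bar>h x - (\<Sum>n\<le>N. hom n h x)\<bar> \<le> C * norm x ^ Suc N"
  using h
proof (induction N arbitrary: h)
  have U0: "0 \<in> U" using U by auto
  case 0
  have "\<exists>C. \<forall>y. norm y \<le> r \<longrightarrow> \<bar>pd i h y\<bar> \<le> C" for i
    by (rule continuous_cball_bounded[OF continuous_on_subset[OF C1_continuous_pd[OF smooth_C1[OF 0]] U(2)]])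
  then obtain C where C: "\<And>i y. norm y \<le> r \<Longrightarrow> \<bar>pd i h y\<bar> \<le> C i" by metis
  have "\<bar>h x - h 0\<bar> \<le> (\<Sum>i\<in>UNIV. \<bar>C i\<bar>) * norm x ^ Suc 0" if "norm x \<le> r" for x
  proof (rule C1_vanishing_order[OF U(2) _ _ _ that])
    show "C1 U (\<lambda>x. h x - h 0)" using smooth_C1[OF 0] by auto
    show "\<bar>pd i (\<lambda>x. h x - h 0) y\<bar> \<le> C i * norm y ^ 0" if "norm y \<le> r" for i y
      using C[OF that, of i] pd_diff[of h y "\<lambda>_. h 0"] C1_differentiable[OF smooth_C1[OF 0], of y] U that
      by (auto simp: subset_iff)
  qed simp
  then show ?case by auto
next
  have U0: "0 \<in> U" using U by auto
  case (Suc N)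
  have "\<exists>C. \<forall>x. norm x \<le> r \<longrightarrow> \<bar>pd i h x - (\<Sum>n\<le>N. hom n (pd i h) x)\<bar> \<le> C * norm x ^ Suc N" for i
    by (rule Suc.IH[OF smooth_pd[OF Suc.prems]])
  then obtain C where C: "\<And>i x. norm x \<le> r \<Longrightarrow> \<bar>pd i h x - (\<Sum>n\<le>N. hom n (pd i h) x)\<bar> \<le> C i * norm x ^ Suc N"
    by metis
  let ?w = "\<lambda>x. h x - (\<Sum>n\<le>Suc N. hom n h x)"
  have hd: "hom n h differentiable at x" for n x
    by (rule C1_differentiable[OF hom_C1[OF U(1) U0 Suc.prems]]) simp
  have "\<bar>?w x\<bar> \<le> (\<Sum>i\<in>UNIV. \<bar>C i\<bar>) * norm x ^ Suc (Suc N)" if "norm x \<le> r" for x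
  proof (rule C1_vanishing_order[OF U(2) _ _ _ that])
    show "C1 U ?w"
      by (intro C1_diff C1_sum smooth_C1[OF Suc.prems] C1_subset[OF hom_C1[OF U(1) U0 Suc.prems]]) auto
    have "hom n h 0 = (if n = 0 then h 0 else 0)" for n
      by (cases n) auto
    then show "?w 0 = 0" by (simp del: hom.simps)
    show "\<bar>pd i ?w y\<bar> \<le> C i * norm y ^ Suc N" if y: "norm y \<le> r" for i y
    proof -
      have yU: "y \<in> U" using y U by (auto simp: subset_iff)
      have "pd i ?w y = pd i h y - (\<Sum>n\<le>Suc N. pd i (hom n h) y)"
        using pd_diff[OF C1_differentiable[OF smooth_C1[OF Suc.prems] yU], of "\<lambda>y. \<Sum>n\<le>Suc N. hom n h y" i]
          pd_sum[of "{..Suc N}" "\<lambda>n. hom n h" y i] hd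
        by (auto simp del: sum.atMost_Suc hom.simps)
      also have "(\<Sum>n\<le>Suc N. pd i (hom n h) y) = (\<Sum>n\<le>N. hom n (pd i h) y)"
        unfolding sum.atMost_Suc_shift by (simp add: pd_hom_0 pd_hom_Suc[OF U(1) U0 Suc.prems] del: hom.simps)
      finally show ?thesis using C[OF y, of i] by simp
    qed
  qed
  then show ?case by blast
qed

section \<open>Convergence of the homogeneous expansion\<close>

lemma bint_square_diff:
  assumes f: "continuous_on (cball 0 c) f" and g: "continuous_on (cball 0 c) g"
  shows "bint c (\<lambda>y. (f y - g y)\<^sup>2) = bint c (\<lambda>y. (f y)\<^sup>2) - 2 * bint c (\<lambda>y. f y * g y) + bint c (\<lambda>y. (g y)\<^sup>2)"
proof -
  have "bint c (\<lambda>y. (f y - g y)\<^sup>2) = bint c (\<lambda>y. ((f y)\<^sup>2 - 2 * (f y * g y)) + (g y)\<^sup>2)"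
    by (rule bint_cong) (simp add: power2_eq_square algebra_simps)
  also have "\<dots> = bint c (\<lambda>y. (f y)\<^sup>2 - 2 * (f y * g y)) + bint c (\<lambda>y. (g y)\<^sup>2)"
    by (rule bint_add) (intro continuous_intros f g)+
  also have "bint c (\<lambda>y. (f y)\<^sup>2 - 2 * (f y * g y)) = bint c (\<lambda>y. (f y)\<^sup>2) - bint c (\<lambda>y. 2 * (f y * g y))"
    by (rule bint_diff) (intro continuous_intros f g)+
  finally show ?thesis by (simp only: bint_cmult)
qed

lemma bint_Cauchy_Schwarz:
  assumes f: "continuous_on (cball 0 c) f" and g: "continuous_on (cball 0 c) g"
  shows "(bint c (\<lambda>y. f y * g y))\<^sup>2 \<le> bint c (\<lambda>y. (f y)\<^sup>2) * bint c (\<lambda>y. (g y)\<^sup>2)"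
proof -
  let ?a = "bint c (\<lambda>y. (f y)\<^sup>2)" and ?b = "bint c (\<lambda>y. f y * g y)" and ?d = "bint c (\<lambda>y. (g y)\<^sup>2)"
  have q: "0 \<le> ?a - 2 * t * ?b + t\<^sup>2 * ?d" for t
  proof -
    have "0 \<le> bint c (\<lambda>y. (f y - t * g y)\<^sup>2)"
      by (rule bint_nonneg) (intro continuous_intros f g, simp)
    also have "\<dots> = ?a - 2 * bint c (\<lambda>y. f y * (t * g y)) + bint c (\<lambda>y. (t * g y)\<^sup>2)"
      by (rule bint_square_diff) (intro continuous_intros f g)+
    also have "bint c (\<lambda>y. f y * (t * g y)) = t * ?b"
      unfolding bint_cmult[symmetric] by (simp add: mult_ac)
    also have "bint c (\<lambda>y. (t * g y)\<^sup>2) = t\<^sup>2 * ?d"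
      unfolding bint_cmult[symmetric] by (simp add: power_mult_distrib)
    finally show ?thesis by simp
  qed
  have d: "?d \<ge> 0" by (rule bint_nonneg) (intro continuous_intros g, simp)
  show ?thesis
  proof (cases "?d = 0")
    case True
    have "?b = 0"
    proof (rule ccontr)
      assume "?b \<noteq> 0"
      \<comment> \<open>With \<open>?d = 0\<close> the quadratic is affine in \<open>t\<close>, and
        at this \<open>t\<close> its value is \<open>-1\<close>.\<close>
      then show False using q[of "(?a + 1) / (2 * ?b)"] unfolding True by simp
    qed
    then show ?thesis by (simp add: True)
  next
    case False
    with d have dp: "?d > 0" by simp
    have "0 \<le> ?d * (?a - 2 * (?b / ?d) * ?b + (?b / ?d)\<^sup>2 * ?d)"
      using q[of "?b / ?d"] d by (intro mult_nonneg_nonneg) auto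
    also have "\<dots> = ?a * ?d - ?b\<^sup>2"
      using dp by (simp add: field_simps power2_eq_square)
    finally show ?thesis by simp
  qed
qed

lemma lint_mono_set:
  fixes f :: "real^3 \<Rightarrow> real"
  assumes "compact K" "compact L" "K \<subseteq> L" and f: "continuous_on L f" "\<And>y. y \<in> L \<Longrightarrow> 0 \<le> f y"
  shows "(LINT y:K|lborel. f y) \<le> (LINT y:L|lborel. f y)"
  unfolding set_lebesgue_integral_def
proof (rule integral_mono)
  show "integrable lborel (\<lambda>y. indicat_real K y *\<^sub>R f y)"
    using set_integrable_compact[OF assms(1) continuous_on_subset[OF f(1) assms(3)]] by (simp add: set_integrable_def)
  show "integrable lborel (\<lambda>y. indicat_real L y *\<^sub>R f y)"
    using set_integrable_compact[OF assms(2) f(1)] by (simp add: set_integrable_def)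
  show "indicat_real K y *\<^sub>R f y \<le> indicat_real L y *\<^sub>R f y" for y
    using assms(3) f(2)[of y] by (cases "y \<in> K"; cases "y \<in> L") auto
qed

text \<open>Moving a dilation by \<open>1/2\<close> from one factor to the other multiplies the
  integral by \<open>(1/2)^m\<close> on one side and by \<open>(1/2)^k\<close> on the other.\<close>

lemma homogeneous_orthogonal:
  assumes p: "harmonic (ball 0 1) p" "\<And>s y. p (s *\<^sub>R y) = s ^ m * p y"
    and q: "harmonic (ball 0 1) q" "\<And>s y. q (s *\<^sub>R y) = s ^ k * q y"
    and mk: "m \<noteq> k" and c: "0 < c" "c < 1"
  shows "bint c (\<lambda>y. p y * q y) = 0"
proof -
  let ?I = "bint c (\<lambda>y. p y * q y)"
  have "(1/2) ^ m * ?I = bint c (\<lambda>y. p ((1/2) *\<^sub>R y) * q y)"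
    unfolding bint_cmult[symmetric] p(2) by (simp add: mult.assoc)
  also have "\<dots> = bint c (\<lambda>y. p y * q ((1/2) *\<^sub>R y))"
    by (rule bint_scale_symmetric[OF p(1) q(1) c]) auto
  also have "\<dots> = (1/2) ^ k * ?I"
    unfolding bint_cmult[symmetric] q(2) by (simp add: mult_ac)
  finally have "((1/2) ^ m - (1/2) ^ k) * ?I = 0" by (simp add: algebra_simps)
  moreover have "(1/2::real) ^ m \<noteq> (1/2) ^ k"
  proof -
    have "(1/2::real) ^ b < (1/2) ^ a" if "a < b" for a b :: nat
      by (rule power_strict_decreasing[OF that]) auto
    from this[of m k] this[of k m] mk show ?thesis by linarith
  qed
  ultimately show ?thesis by (metis mult_eq_0_iff right_minus_eq)
qed

lemma harmonic_continuous_unit: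
  "harmonic (ball 0 1) h \<Longrightarrow> c < 1 \<Longrightarrow> continuous_on (cball 0 c) h"
  by (rule harmonic_continuous_cball) auto

text \<open>Derivatives of all orders are assumed because \<open>hom\<close> takes them;
  \<open>harmonic\<close> speaks of two.\<close>

locale smooth_harmonic =
  fixes u :: "real^3 \<Rightarrow> real"
  assumes smooth: "smooth (ball 0 1) u"
    and laplace: "\<And>x. x \<in> ball 0 1 \<Longrightarrow> (\<Sum>i\<in>UNIV. pd i (pd i u) x) = 0"
begin

lemma harmonic: "harmonic (ball 0 1) u"
  unfolding harmonic_def using smooth smooth_C1 smooth_pd laplace by blast

lemma hom_harm: "harmonic UNIV (hom n u)"
  by (rule hom_harmonic[OF _ _ smooth laplace]) auto

lemma hom_harm_ball: "harmonic (ball 0 1) (hom n u)"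
  using harmonic_subset[OF hom_harm] by auto

lemma hom_cont: "continuous_on S (hom n u)"
  using continuous_on_subset[OF C1_continuous[OF harmonic_C1[OF hom_harm]]] by auto

definition rem :: "nat \<Rightarrow> real^3 \<Rightarrow> real" where
  "rem N x = u x - (\<Sum>n\<le>N. hom n u x)"

lemma rem_harmonic: "harmonic (ball 0 1) (rem N)"
proof -
  have "harmonic (ball 0 1) (\<lambda>x. u x + (-1) * (\<Sum>n\<le>N. hom n u x))"
    by (intro harmonic_add harmonic harmonic_sum hom_harm_ball) auto
  then show ?thesis unfolding rem_def by simp
qed

lemma rem_bound: "\<exists>C. \<forall>x. norm x \<le> 1/2 \<longrightarrow> \<bar>rem N x\<bar> \<le> C * norm x ^ Suc N"
  unfolding rem_def by (rule hom_taylor[OF _ _ _ smooth]) auto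

lemma rem_orthogonal:
  assumes p: "harmonic (ball 0 1) p" "\<And>s y. p (s *\<^sub>R y) = s ^ m * p y" and m: "m \<le> N"
    and c: "0 < c" "c < 1"
  shows "bint c (\<lambda>y. rem N y * p y) = 0"
proof -
  obtain C where C: "\<And>x. norm x \<le> 1/2 \<Longrightarrow> \<bar>rem N x\<bar> \<le> C * norm x ^ Suc N"
    using rem_bound by blast
  show ?thesis
    by (rule bint_vanishing[OF rem_harmonic p(1) c p(2) m _ C, where r="1/2"]) auto
qed

lemma cball_cont:
  assumes "c < 1"
  shows "continuous_on (cball 0 c) u" "continuous_on (cball 0 c) (rem N)"
  using assms harmonic_continuous_unit[OF harmonic] harmonic_continuous_unit[OF rem_harmonic] by auto

text \<open>The remainder after degree \<open>m\<close> and the parts of degree below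
  \<open>m\<close> are orthogonal to \<open>p\<close>, so \<open>p\<close> sees the part of degree
  \<open>m\<close> only.\<close>

lemma hom_projection:
  assumes p: "harmonic (ball 0 1) p" "\<And>s y. p (s *\<^sub>R y) = s ^ m * p y" and c: "0 < c" "c < 1"
  shows "bint c (\<lambda>y. u y * p y) = bint c (\<lambda>y. hom m u y * p y)"
proof -
  have cp: "continuous_on (cball 0 c) p"
    using harmonic_continuous_unit[OF p(1)] c by auto
  have "bint c (\<lambda>y. u y * p y) = bint c (\<lambda>y. rem m y * p y + (\<Sum>n\<le>m. hom n u y * p y))"
    by (rule bint_cong) (simp add: rem_def left_diff_distrib sum_distrib_right del: hom.simps)
  also have "\<dots> = bint c (\<lambda>y. rem m y * p y) + bint c (\<lambda>y. \<Sum>n\<le>m. hom n u y * p y)"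
    by (rule bint_add) (intro continuous_intros cball_cont c cp hom_cont)+
  also have "bint c (\<lambda>y. \<Sum>n\<le>m. hom n u y * p y) = (\<Sum>n\<le>m. bint c (\<lambda>y. hom n u y * p y))"
    by (rule bint_sum) (auto intro!: continuous_intros cp hom_cont)
  also have "\<dots> = (\<Sum>n\<le>m. if n = m then bint c (\<lambda>y. hom m u y * p y) else 0)"
    by (rule sum.cong) (auto intro!: homogeneous_orthogonal[OF hom_harm_ball hom_scale p] c)
  also have "\<dots> = bint c (\<lambda>y. hom m u y * p y)" by simp
  finally show ?thesis using rem_orthogonal[OF p order_refl c] by simp
qed

text \<open>Pythagoras for the Taylor polynomial and its remainder. The bound is uniform in
  \<open>N\<close>.\<close>

lemma rem_l2_le:
  assumes c: "0 < c" "c < 1"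
  shows "bint c (\<lambda>y. (rem N y)\<^sup>2) \<le> bint c (\<lambda>y. (u y)\<^sup>2)"
proof -
  let ?T = "\<lambda>y. \<Sum>n\<le>N. hom n u y"
  have cT: "continuous_on (cball 0 c) ?T" by (intro continuous_intros hom_cont)
  have "bint c (\<lambda>y. rem N y * ?T y) = (\<Sum>n\<le>N. bint c (\<lambda>y. rem N y * hom n u y))"
    unfolding sum_distrib_left by (rule bint_sum) (auto intro!: continuous_intros cball_cont c hom_cont)
  also have "\<dots> = 0"
    by (rule sum.neutral) (auto intro!: rem_orthogonal[OF hom_harm_ball hom_scale] c)
  finally have o: "bint c (\<lambda>y. rem N y * ?T y) = 0" .
  have "bint c (\<lambda>y. (u y)\<^sup>2) = bint c (\<lambda>y. (?T y - (- 1) * rem N y)\<^sup>2)"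
    by (rule bint_cong) (simp add: rem_def)
  also have "\<dots> = bint c (\<lambda>y. (?T y)\<^sup>2) - 2 * bint c (\<lambda>y. ?T y * ((- 1) * rem N y)) + bint c (\<lambda>y. ((- 1) * rem N y)\<^sup>2)"
    by (rule bint_square_diff) (intro cT continuous_intros cball_cont c)+
  also have "bint c (\<lambda>y. ?T y * ((- 1) * rem N y)) = (- 1) * bint c (\<lambda>y. rem N y * ?T y)"
    unfolding bint_cmult[symmetric] by (simp add: mult.commute)
  finally have "bint c (\<lambda>y. (u y)\<^sup>2) = bint c (\<lambda>y. (?T y)\<^sup>2) + bint c (\<lambda>y. (rem N y)\<^sup>2)"
    by (simp add: o)
  moreover have "0 \<le> bint c (\<lambda>y. (?T y)\<^sup>2)"
    by (rule bint_nonneg) (intro continuous_intros cT, simp)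
  ultimately show ?thesis by simp
qed

end

text \<open>A three-balls inequality. \<open>bint_scale_symmetric\<close> turns the square of the
  dilate by \<open>s\<close> into the product of \<open>w\<close> and its dilate by
  \<open>s^2\<close>, to which Cauchy-Schwarz applies.\<close>

lemma harmonic_log_convex:
  assumes w: "harmonic (ball 0 1) w" and c: "0 < c" "c < 1" and s: "0 < s" "s \<le> 1"
  shows "(bint c (\<lambda>y. (w (s *\<^sub>R y))\<^sup>2))\<^sup>2 \<le> bint c (\<lambda>y. (w y)\<^sup>2) * bint c (\<lambda>y. (w (s\<^sup>2 *\<^sub>R y))\<^sup>2)"
proof -
  have sub: "t *\<^sub>R y \<in> ball 0 1" if "y \<in> ball (0::real^3) 1" "0 < t" "t \<le> 1" for t y
    using that mult_left_le_one_le[of "norm y" t] by simp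
  have hs: "harmonic (ball 0 1) (\<lambda>y. w (t *\<^sub>R y))" if "0 < t" "t \<le> 1" for t
    using harmonic_affine[OF w, of "ball 0 1" 0 t] sub that by simp
  have s2: "0 < s\<^sup>2" "s\<^sup>2 \<le> 1" using s by (auto simp: power_le_one)
  have "bint c (\<lambda>y. (w (s *\<^sub>R y))\<^sup>2) = bint c (\<lambda>y. w (s *\<^sub>R y) * w (s *\<^sub>R y))"
    by (simp add: power2_eq_square)
  also have "\<dots> = bint c (\<lambda>y. w y * w (s *\<^sub>R s *\<^sub>R y))"
    by (rule bint_scale_symmetric[OF w hs[OF s] c s])
  also have "\<dots> = bint c (\<lambda>y. w y * w (s\<^sup>2 *\<^sub>R y))" by (simp add: power2_eq_square)
  finally have e: "bint c (\<lambda>y. (w (s *\<^sub>R y))\<^sup>2) = bint c (\<lambda>y. w y * w (s\<^sup>2 *\<^sub>R y))" .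
  show ?thesis
    unfolding e
    by (rule bint_Cauchy_Schwarz)
      (use harmonic_continuous_unit[OF w] harmonic_continuous_unit[OF hs[OF s2]] c in auto)
qed

text \<open>Iterating log-convexity \<open>k\<close> times compares the scale \<open>s\<close> with the scale \<open>s ^ 2 ^ k\<close>, where the order
  of vanishing at \<open>0\<close> takes over.\<close>

lemma harmonic_decay:
  assumes w: "harmonic (ball 0 1) w" and c: "0 < c" "c < 1" and s: "0 < s" "s < 1"
    and r: "r > 0" and van: "\<And>y. norm y \<le> r \<Longrightarrow> \<bar>w y\<bar> \<le> C * norm y ^ M"
  shows "bint c (\<lambda>y. (w (s *\<^sub>R y))\<^sup>2) \<le> s ^ (2 * M) * bint c (\<lambda>y. (w y)\<^sup>2)"
proof -
  define A where "A t = bint c (\<lambda>y. (w (t *\<^sub>R y))\<^sup>2)" for t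
  have cA: "continuous_on (cball 0 c) (\<lambda>y. (w (t *\<^sub>R y))\<^sup>2)" if "0 < t" "t \<le> 1" for t
  proof -
    have "continuous_on (ball 0 1) w" by (rule C1_continuous[OF harmonic_C1[OF w]])
    moreover have "t *\<^sub>R y \<in> ball 0 1" if "y \<in> cball (0::real^3) c" for y
      using that \<open>0 < t\<close> \<open>t \<le> 1\<close> mult_left_le_one_le[of "norm y" t] c by simp
    ultimately show ?thesis
      by (intro continuous_intros) (auto intro!: continuous_on_compose2[of "ball 0 1" w] continuous_intros)
  qed
  have A0: "A t \<ge> 0" if "0 < t" "t \<le> 1" for t
    unfolding A_def by (rule bint_nonneg[OF cA[OF that]]) simp
  have lc: "(A t)\<^sup>2 \<le> A 1 * A (t\<^sup>2)" if "0 < t" "t \<le> 1" for t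
    using harmonic_log_convex[OF w c that] by (simp add: A_def)
  let ?V = "bint c (\<lambda>y. 1)"
  have V: "?V > 0" using c bint_one_pos by simp
  have small: "A t \<le> C\<^sup>2 * ?V * t ^ (2 * M)" if t: "0 < t" "t \<le> min 1 r" for t
  proof -
    have "\<bar>bint c (\<lambda>y. (w (t *\<^sub>R y))\<^sup>2)\<bar> \<le> C\<^sup>2 * t ^ (2 * M) * ?V"
    proof (rule bint_abs_le)
      fix y :: "real^3" assume "y \<in> cball 0 c"
      then have ny: "norm y \<le> 1" using c by simp
      then have n: "norm (t *\<^sub>R y) \<le> t" using t by (simp add: mult_left_le)
      then have "\<bar>w (t *\<^sub>R y)\<bar> \<le> C * norm (t *\<^sub>R y) ^ M" using t by (intro van) linarith
      also have "\<dots> \<le> \<bar>C\<bar> * t ^ M" using n by (intro mult_mono power_mono) auto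
      finally have "\<bar>w (t *\<^sub>R y)\<bar>\<^sup>2 \<le> (\<bar>C\<bar> * t ^ M)\<^sup>2" by (intro power_mono) auto
      then show "\<bar>(w (t *\<^sub>R y))\<^sup>2\<bar> \<le> C\<^sup>2 * t ^ (2 * M)"
        by (simp add: power_mult_distrib power_mult[symmetric] mult.commute)
    qed (use cA t in auto)
    then show ?thesis by (simp add: A_def mult_ac)
  qed
  have "A s \<le> s ^ (2 * M) * A 1"
  proof (cases "A 1 = 0")
    case True
    then have "(A s)\<^sup>2 \<le> 0" using lc[of s] s by simp
    then show ?thesis using True by simp
  next
    case False
    then have A1: "A 1 > 0" using A0[of 1] by simp
    \<comment> \<open>After division by \<open>A 1\<close>, log-convexity reads
      \<open>(A t / A 1)^2 <= A (t^2) / A 1\<close> and can be iterated.\<close>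
    define \<beta> where "\<beta> = A s / A 1"
    have b0: "\<beta> \<ge> 0" using A0[of s] s A1 by (simp add: \<beta>_def)
    have sk: "0 < s ^ 2 ^ k" "s ^ 2 ^ k \<le> 1" for k :: nat using s by (auto simp: power_le_one)
    have it: "\<beta> ^ 2 ^ k \<le> A (s ^ 2 ^ k) / A 1" for k
    proof (induction k)
      case (Suc k)
      have "\<beta> ^ 2 ^ Suc k = (\<beta> ^ 2 ^ k)\<^sup>2" by (simp add: power_mult[symmetric] mult.commute)
      also have "\<dots> \<le> (A (s ^ 2 ^ k) / A 1)\<^sup>2" by (rule power_mono[OF Suc]) (use b0 in simp)
      also have "\<dots> \<le> (A 1 * A ((s ^ 2 ^ k)\<^sup>2)) / (A 1)\<^sup>2"
        unfolding power_divide by (rule divide_right_mono[OF lc[OF sk]]) simp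
      also have "\<dots> = A (s ^ 2 ^ Suc k) / A 1"
        using A1 by (simp add: power2_eq_square[of "A 1"] power_mult[symmetric] mult.commute)
      finally show ?case .
    qed (simp add: \<beta>_def)
    \<comment> \<open>If \<open>q > 1\<close>, the powers \<open>q ^ 2 ^ k\<close> are unbounded,
      while the order of vanishing bounds them by the constant \<open>K\<close> as soon as
      \<open>s ^ 2 ^ k\<close> is small.\<close>
    define q where "q = \<beta> / s ^ (2 * M)"
    have "q \<le> 1"
    proof (rule ccontr)
      assume "\<not> q \<le> 1"
      then have q: "q > 1" by simp
      define K where "K = C\<^sup>2 * ?V / A 1"
      have ev1: "\<forall>\<^sub>F n in sequentially. s ^ n < min 1 r"
        using order_tendstoD(2)[OF LIMSEQ_power_zero[of s], of "min 1 r"] s r by auto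
      have ev2: "\<forall>\<^sub>F n in sequentially. K < q ^ n"
      proof -
        obtain n1 where n1: "K < q ^ n1" using real_arch_pow[OF q] by blast
        have "K < q ^ n" if "n \<ge> n1" for n
          using n1 power_increasing[OF that, of q] q by linarith
        then show ?thesis unfolding eventually_sequentially by blast
      qed
      obtain n0 where n0: "\<And>n. n \<ge> n0 \<Longrightarrow> s ^ n < min 1 r \<and> K < q ^ n"
        using eventually_conj[OF ev1 ev2] unfolding eventually_sequentially by blast
      define k where "k = n0"
      have "2 ^ k \<ge> n0" using less_exp[of n0] by (simp add: k_def less_imp_le)
      with n0 have a: "s ^ 2 ^ k < min 1 r" "K < q ^ 2 ^ k" by auto
      have "\<beta> ^ 2 ^ k \<le> A (s ^ 2 ^ k) / A 1" by (rule it)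
      also have "\<dots> \<le> (C\<^sup>2 * ?V * (s ^ 2 ^ k) ^ (2 * M)) / A 1"
        by (rule divide_right_mono[OF small]) (use sk a A1 in auto)
      also have "\<dots> = K * (s ^ (2 * M)) ^ 2 ^ k"
        by (simp add: K_def power_mult[symmetric] mult.commute)
      finally have "q ^ 2 ^ k \<le> K"
        unfolding q_def power_divide using s by (simp add: pos_divide_le_eq)
      with a show False by simp
    qed
    then have "\<beta> \<le> s ^ (2 * M)" using s by (simp add: q_def)
    then show ?thesis using A1 by (simp add: \<beta>_def field_simps)
  qed
  then show ?thesis by (simp add: A_def)
qed

text \<open>\<open>u - u 0\<close> is orthogonal to constants, which is the mean value property; the
  inequality then follows by expanding the integral of \<open>(u - u 0)^2\<close>.\<close>

lemma harmonic_value_l2: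
  assumes u: "harmonic (ball 0 1) u" and c: "0 < c" "c < 1"
  shows "(u 0)\<^sup>2 * bint c (\<lambda>y. 1) \<le> bint c (\<lambda>y. (u y)\<^sup>2)"
proof -
  let ?w = "\<lambda>y. u y - u 0"
  have cu: "continuous_on (cball 0 c) u" using harmonic_continuous_unit[OF u] c by auto
  have hw: "harmonic (ball 0 1) ?w"
    using harmonic_add[OF _ u harmonic_const[of "ball 0 1" "u 0"], of "-1"] by simp
  have pw: "pd i ?w y = pd i u y" if "norm y < 1" for i y
    using pd_diff[OF C1_differentiable[OF harmonic_C1[OF u]], of y "\<lambda>_. u 0"] that by simp
  have "\<exists>C. \<forall>y. norm y \<le> 1/2 \<longrightarrow> \<bar>pd i u y\<bar> \<le> C" for i
    by (rule continuous_cball_bounded[OF continuous_on_subset[OF C1_continuous_pd[OF harmonic_C1[OF u]]]]) auto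
  then obtain C where C: "\<And>i y. norm y \<le> 1/2 \<Longrightarrow> \<bar>pd i u y\<bar> \<le> C i" by metis
  have v: "\<bar>?w y\<bar> \<le> (\<Sum>i\<in>UNIV. \<bar>C i\<bar>) * norm y ^ Suc 0" if y: "norm y \<le> 1/2" for y
    by (rule C1_vanishing_order[OF _ harmonic_C1[OF hw] _ _ y]) (use C pw in auto)
  have "bint c (\<lambda>y. ?w y * 1) = 0"
    by (rule bint_vanishing[where m=0 and N=0 and r="1/2" and p="\<lambda>_. 1", OF hw harmonic_const c _ _ _ v]) auto
  then have "bint c ?w = 0" by simp
  then have e: "bint c u = u 0 * bint c (\<lambda>y. 1)"
    unfolding bint_diff[OF cu continuous_on_const] bint_const[of c "u 0"] by linarith
  have "0 \<le> bint c (\<lambda>y. (u y - u 0)\<^sup>2)"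
    by (rule bint_nonneg) (intro continuous_intros cu, simp)
  also have "\<dots> = bint c (\<lambda>y. (u y)\<^sup>2) - 2 * bint c (\<lambda>y. u y * u 0) + bint c (\<lambda>y. (u 0)\<^sup>2)"
    by (rule bint_square_diff) (intro continuous_intros cu)+
  also have "bint c (\<lambda>y. u y * u 0) = (u 0)\<^sup>2 * bint c (\<lambda>y. 1)"
    using bint_cmult[of c "u 0" u] e by (simp add: mult.commute power2_eq_square)
  also have "bint c (\<lambda>y. (u 0)\<^sup>2) = (u 0)\<^sup>2 * bint c (\<lambda>y. 1)" by (rule bint_const)
  finally show ?thesis by (simp add: mult.commute)
qed

text \<open>The value at \<open>x\<close> is controlled by an L2 mean over a small ball about
  \<open>x\<close>, which lies in the ball of radius \<open>s^2\<close>. That ball is the dilate by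
  \<open>s\<close> of the ball of radius \<open>s\<close>, so \<open>harmonic_decay\<close> gives
  the factor \<open>s^(2 N + 2)\<close>, and \<open>rem_l2_le\<close> bounds what it
  multiplies.\<close>

lemma (in smooth_harmonic) hom_series:
  assumes x: "norm x < 1"
  shows "(\<lambda>N. rem N x) \<longlonglongrightarrow> 0"
proof -
  \<comment> \<open>The quarter is small enough for
    \<open>norm x + delta <= (1 - delta)^2\<close>.\<close>
  define \<delta> where "\<delta> = (1 - norm x) / 4"
  define s where "s = 1 - \<delta>"
  have d: "\<delta> > 0" "\<delta> \<le> 1/4" using x by (auto simp: \<delta>_def)
  have s: "0 < s" "s < 1" using d by (auto simp: s_def)
  let ?V = "bint (1/2) (\<lambda>y. 1)"
  have V: "?V > 0" by (rule bint_one_pos) simp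
  have ss: "norm x + \<delta> \<le> s * s"
  proof -
    have "norm x + \<delta> \<le> 1 - 2 * \<delta>" using x by (simp add: \<delta>_def field_simps)
    also have "\<dots> \<le> s * s" by (simp add: s_def algebra_simps)
    finally show ?thesis .
  qed
  let ?B = "bint s (\<lambda>y. (u y)\<^sup>2)"
  let ?k = "1 / (\<delta>^3 * ?V) * ?B"
  have est: "(rem N x)\<^sup>2 \<le> ?k * s ^ N" for N
  proof -
    have sub: "ball x \<delta> \<subseteq> ball 0 1" "cball x (\<delta> * (1/2)) \<subseteq> cball 0 (s * s)"
    proof -
      show "ball x \<delta> \<subseteq> ball 0 1"
      proof
        fix z assume "z \<in> ball x \<delta>"
        then have "norm z < norm x + \<delta>" using norm_triangle_sub[of z x] by (simp add: dist_norm norm_minus_commute)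
        then show "z \<in> ball 0 1" using ss s mult_strict_mono[of s 1 s 1] by simp
      qed
      show "cball x (\<delta> * (1/2)) \<subseteq> cball 0 (s * s)"
      proof
        fix z assume "z \<in> cball x (\<delta> * (1/2))"
        then have "norm z \<le> norm x + \<delta> * (1/2)" using norm_triangle_sub[of z x] by (simp add: dist_norm norm_minus_commute)
        then show "z \<in> cball 0 (s * s)" using ss d by simp
      qed
    qed
    have ss1: "s * s < 1" using s mult_strict_mono[of s 1 s 1] by simp
    have cr: "continuous_on (cball 0 (s * s)) (\<lambda>y. (rem N y)\<^sup>2)"
      by (intro continuous_intros cball_cont ss1)
    have h: "harmonic (ball 0 1) (\<lambda>y. rem N (x + \<delta> *\<^sub>R y))"
    proof (rule harmonic_affine[OF rem_harmonic])
      fix y :: "real^3" assume "y \<in> ball 0 1"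
      then have "x + \<delta> *\<^sub>R y \<in> ball x \<delta>" using d by (simp add: dist_norm)
      then show "x + \<delta> *\<^sub>R y \<in> ball 0 1" using sub by blast
    qed simp
    have "\<delta>^3 * ((rem N x)\<^sup>2 * ?V) \<le> \<delta>^3 * bint (1/2) (\<lambda>y. (rem N (x + \<delta> *\<^sub>R y))\<^sup>2)"
      using harmonic_value_l2[OF h, of "1/2"] d by (intro mult_left_mono) auto
    also have "\<dots> = (LINT z:cball x (\<delta> * (1/2))|lborel. (rem N z)\<^sup>2)"
      unfolding bint_def by (rule lint_cball_affine[symmetric]) (use d continuous_on_subset[OF cr sub(2)] in auto)
    also have "\<dots> \<le> bint (s * s) (\<lambda>y. (rem N y)\<^sup>2)"
      unfolding bint_def by (rule lint_mono_set) (use sub cr in auto)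
    also have "\<dots> = s^3 * bint s (\<lambda>y. (rem N (s *\<^sub>R y))\<^sup>2)"
      by (rule bint_scale[OF s(1) cr])
    also have "\<dots> \<le> 1 * bint s (\<lambda>y. (rem N (s *\<^sub>R y))\<^sup>2)"
    proof (rule mult_right_mono)
      show "s^3 \<le> 1" using s by (simp add: power_le_one)
      have "s *\<^sub>R y \<in> cball 0 (s * s)" if "y \<in> cball 0 s" for y :: "real^3"
      proof -
        have "s * norm y \<le> s * s" using that s by (intro mult_left_mono) auto
        moreover have "norm (s *\<^sub>R y) = s * norm y" using s by simp
        ultimately show ?thesis unfolding mem_cball dist_0_norm by linarith
      qed
      then have "(\<lambda>y. s *\<^sub>R y) ` cball (0::real^3) s \<subseteq> cball 0 (s * s)" by blast
      then show "0 \<le> bint s (\<lambda>y. (rem N (s *\<^sub>R y))\<^sup>2)"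
        by (intro bint_nonneg continuous_on_compose2[OF cr] continuous_intros) auto
    qed
    also have "\<dots> \<le> s ^ (2 * Suc N) * bint s (\<lambda>y. (rem N y)\<^sup>2)"
    proof -
      obtain C where C: "\<And>x. norm x \<le> 1/2 \<Longrightarrow> \<bar>rem N x\<bar> \<le> C * norm x ^ Suc N"
        using rem_bound by blast
      show ?thesis
        unfolding mult_1_left by (rule harmonic_decay[OF rem_harmonic s s _ C, where r="1/2"]) auto
    qed
    also have "\<dots> \<le> s ^ N * ?B"
    proof (rule mult_mono)
      show "s ^ (2 * Suc N) \<le> s ^ N" using s by (intro power_decreasing) auto
      show "bint s (\<lambda>y. (rem N y)\<^sup>2) \<le> ?B" by (rule rem_l2_le[OF s])
      show "0 \<le> bint s (\<lambda>y. (rem N y)\<^sup>2)"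
        by (rule bint_nonneg) (intro continuous_intros cball_cont s, simp)
    qed (use s in simp)
    finally show ?thesis using d V by (simp add: field_simps)
  qed
  have "(\<lambda>N. ?k * s ^ N) \<longlonglongrightarrow> ?k * 0"
    by (intro tendsto_intros LIMSEQ_power_zero) (use s in simp)
  then have lim: "(\<lambda>N. ?k * s ^ N) \<longlonglongrightarrow> 0" by (simp only: mult_zero_right)
  have "(\<lambda>N. (rem N x)\<^sup>2) \<longlonglongrightarrow> 0"
  proof (rule tendsto_sandwich[OF _ _ tendsto_const lim])
    show "\<forall>\<^sub>F N in sequentially. 0 \<le> (rem N x)\<^sup>2" by (rule always_eventually) simp
    show "\<forall>\<^sub>F N in sequentially. (rem N x)\<^sup>2 \<le> ?k * s ^ N" by (rule always_eventually, rule allI, rule est)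
  qed
  then show ?thesis by simp
qed

section \<open>Gradient estimates\<close>

lemma bint_linear_square_cong:
  fixes a b :: "real^3"
  assumes "norm a = norm b"
  shows "bint c (\<lambda>y. (a \<bullet> y)\<^sup>2) = bint c (\<lambda>y. (b \<bullet> y)\<^sup>2)"
proof -
  obtain f where f: "orthogonal_transformation f" "f b = a"
    using orthogonal_transformation_exists[of b a] assms by metis
  have "bint c (\<lambda>y. (a \<bullet> y)\<^sup>2) = bint c (\<lambda>y. (a \<bullet> f y)\<^sup>2)"
    by (rule bint_rotate[OF f(1), symmetric]) (intro continuous_intros)
  also have "\<dots> = bint c (\<lambda>y. (b \<bullet> y)\<^sup>2)"
    using f by (auto simp: orthogonal_transformation_def)
  finally show ?thesis .
qed

text \<open>By rotation the integral depends on \<open>a\<close> only through its norm; summing over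
  the three coordinate axes gives the factor \<open>3\<close>.\<close>

lemma bint_linear_square:
  fixes a :: "real^3"
  shows "3 * bint c (\<lambda>y. (a \<bullet> y)\<^sup>2) = (norm a)\<^sup>2 * bint c (\<lambda>y. (norm y)\<^sup>2)"
proof -
  have "bint c (\<lambda>y. (a \<bullet> y)\<^sup>2) = (norm a)\<^sup>2 * bint c (\<lambda>y. (y$i)\<^sup>2)" for i
  proof -
    have "bint c (\<lambda>y. (a \<bullet> y)\<^sup>2) = bint c (\<lambda>y. ((norm a *\<^sub>R axis i 1) \<bullet> y)\<^sup>2)"
      by (rule bint_linear_square_cong) simp
    also have "\<dots> = bint c (\<lambda>y. (norm a)\<^sup>2 * (y$i)\<^sup>2)"
      by (simp add: inner_axis' power_mult_distrib)
    finally show ?thesis by (simp only: bint_cmult)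
  qed
  then have "(\<Sum>i\<in>(UNIV::3 set). bint c (\<lambda>y. (a \<bullet> y)\<^sup>2)) = (\<Sum>i\<in>UNIV. (norm a)\<^sup>2 * bint c (\<lambda>y. (y$i)\<^sup>2))"
    by (rule sum.cong[OF refl])
  also have "\<dots> = (norm a)\<^sup>2 * bint c (\<lambda>y. \<Sum>i\<in>UNIV. (y$i)\<^sup>2)"
    unfolding sum_distrib_left[symmetric]
    by (subst bint_sum) (auto intro!: continuous_intros)
  also have "(\<lambda>y::real^3. \<Sum>i\<in>UNIV. (y$i)\<^sup>2) = (\<lambda>y. (norm y)\<^sup>2)"
    by (auto simp: norm_vec_def L2_set_def sum_nonneg)
  finally show ?thesis by simp
qed

lemma left_limit_nonneg:
  fixes F :: "real \<Rightarrow> real"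
  assumes "isCont F b" "a < b" "\<And>s. a < s \<Longrightarrow> s < b \<Longrightarrow> 0 \<le> F s"
  shows "0 \<le> F b"
proof (rule tendsto_lowerbound)
  show "(F \<longlongrightarrow> F b) (at_left b)"
    using assms(1) by (simp add: continuous_at_imp_continuous_at_within continuous_within[symmetric])
  show "\<forall>\<^sub>F s in at_left b. 0 \<le> F s"
    unfolding eventually_at_left[OF assms(2)] using assms by (intro exI[of _ a]) auto
qed simp

text \<open>In polar coordinates this is an equality. On the shell \<open>s <= |y| <= 1\<close> the
  function \<open>1 - |y|^2\<close> is at most \<open>1 - s^2\<close>; with scaling this is a
  polynomial inequality in \<open>s\<close> with the common factor \<open>1 - s\<close>, which is
  divided out before \<open>s\<close> tends to \<open>1\<close>.\<close>

lemma bint_norm_square_ge: "3 * bint 1 (\<lambda>y. 1) \<le> 5 * bint 1 (\<lambda>y. (norm y)\<^sup>2)"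
proof -
  let ?V = "bint 1 (\<lambda>y. 1)" and ?M = "bint 1 (\<lambda>y. (norm y)\<^sup>2)"
  let ?F = "\<lambda>s::real. (1 + s + s^2 + s^3 + s^4) * ?M - s^2 * (1 + s + s^2) * ?V"
  have "0 \<le> ?F 1"
  proof (rule left_limit_nonneg[where a=0 and b=1 and F="?F"])
    fix s :: real assume s: "0 < s" "s < 1"
    have c: "continuous_on S (\<lambda>y::real^3. 1 - (norm y)\<^sup>2)" for S by (intro continuous_intros)
    have e: "bint t (\<lambda>y. 1 - (norm y)\<^sup>2) = t^3 * ?V - t^5 * ?M" if t: "t > 0" for t
    proof -
      have "bint t (\<lambda>y. 1 - (norm y)\<^sup>2) = bint t (\<lambda>y. 1) - bint t (\<lambda>y. (norm y)\<^sup>2)"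
        by (rule bint_diff) (intro continuous_intros)+
      also have "bint t (\<lambda>y. (norm y)\<^sup>2) = t^3 * bint 1 (\<lambda>y. t\<^sup>2 * (norm y)\<^sup>2)"
        using bint_scale[OF t, of 1 "\<lambda>y. (norm y)\<^sup>2"] t by (simp add: continuous_intros power_mult_distrib)
      also have "\<dots> = t^5 * ?M" unfolding bint_cmult by (simp add: eval_nat_numeral)
      finally show ?thesis using bint_one[of t] t by simp
    qed
    have "\<bar>bint 1 (\<lambda>y. 1 - (norm y)\<^sup>2) - bint s (\<lambda>y. 1 - (norm y)\<^sup>2)\<bar> \<le> (1 - s\<^sup>2) * ((1^3 - s^3) * ?V)"
    proof (rule bint_shell[OF _ _ c])
      fix y :: "real^3" assume y: "y \<in> cball 0 1" "s \<le> norm y"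
      have "s\<^sup>2 \<le> (norm y)\<^sup>2" using y s by (intro power_mono) auto
      moreover have "(norm y)\<^sup>2 \<le> 1" using y by (simp add: power_le_one)
      ultimately show "\<bar>1 - (norm y)\<^sup>2\<bar> \<le> 1 - s\<^sup>2" by simp
    qed (use s in auto)
    then have "(1 - s^3) * ?V - (1 - s^5) * ?M \<le> (1 - s\<^sup>2) * ((1 - s^3) * ?V)"
      using e[of s] e[of 1] s by (simp add: algebra_simps abs_le_iff)
    then have "0 \<le> (1 - s) * ?F s"
      by (simp add: algebra_simps eval_nat_numeral)
    then show "0 \<le> ?F s" using s by (simp add: zero_le_mult_iff)
  qed (auto intro!: continuous_intros)
  then show ?thesis by simp
qed

text \<open>The linear part \<open>?p\<close> of \<open>u\<close> at \<open>0\<close> is orthogonal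
  to constants and to \<open>?w\<close>, which vanishes to second order. Hence the integral of
  \<open>?p^2\<close> is at most that of \<open>u^2\<close>, and it is at least
  \<open>|g|^2 c^5 / 5\<close> times the volume of the unit ball.\<close>

lemma harmonic_gradient_l2_aux:
  assumes u: "harmonic UNIV u" and c: "0 < c" "c < 1"
  shows "(\<Sum>i\<in>UNIV. (pd i u 0)\<^sup>2) * (c^5 * bint 1 (\<lambda>y. 1)) \<le> 5 * bint c (\<lambda>y. (u y)\<^sup>2)"
proof -
  define g where "g = (\<chi> i. pd i u 0)"
  let ?p = "\<lambda>y. g \<bullet> y"
  have pd_p: "pd i ?p = (\<lambda>y. pd i u 0)" for i
  proof
    fix y
    have "(?p has_derivative (\<lambda>v. g \<bullet> v)) (at y)" by (auto intro!: derivative_eq_intros)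
    from pd_eqI[OF this] show "pd i ?p y = pd i u 0" by (simp add: inner_axis g_def)
  qed
  have C1p: "C1 U ?p" for U
    unfolding C1_def pd_p by (auto intro!: continuous_intros simp: inner_commute)
  have hp: "harmonic U ?p" for U
    unfolding harmonic_def by (auto simp: pd_p C1p)
  have ub: "harmonic (ball 0 1) u" using harmonic_subset[OF u] by simp
  have cu: "continuous_on S u" for S
    using continuous_on_subset[OF C1_continuous[OF harmonic_C1[OF u]]] by auto
  let ?w = "\<lambda>y. u y + (- 1) * u 0 + (- 1) * ?p y"
  have hw: "harmonic UNIV ?w"
    by (intro harmonic_add u hp harmonic_const) auto
  have du: "u differentiable at y" and dpu: "pd i u differentiable at y" for i y
    using C1_differentiable[OF harmonic_C1[OF u]] C1_differentiable[OF harmonic_C1_pd[OF u]] by auto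
  have dp: "?p differentiable at y" for y using C1_differentiable[OF C1p] by blast
  have pw: "pd i ?w y = pd i u y - pd i u 0" for i y
  proof -
    have 1: "(\<lambda>y. u y + (- 1) * u 0) differentiable at y" "(\<lambda>y. (- 1) * ?p y) differentiable at y"
      using du dp by (auto intro!: derivative_intros)
    have "pd i ?w y = pd i (\<lambda>y. u y + (- 1) * u 0) y + pd i (\<lambda>y. (- 1) * ?p y) y"
      by (rule pd_add[OF 1])
    also have "pd i (\<lambda>y. u y + (- 1) * u 0) y = pd i u y" using pd_add[OF du, of "\<lambda>_. (- 1) * u 0"] by simp
    also have "pd i (\<lambda>y. (- 1) * ?p y) y = - pd i u 0" by (subst pd_cmult[OF dp]) (simp add: pd_p)
    finally show ?thesis by simp
  qed
  have "\<exists>C. \<forall>y. norm y \<le> 1/2 \<longrightarrow> \<bar>pd i ?w y\<bar> \<le> C * norm y ^ 1" for i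
  proof -
    have "\<exists>C. \<forall>y. norm y \<le> 1/2 \<longrightarrow> \<bar>pd j (pd i u) y\<bar> \<le> C" for j
      by (rule continuous_cball_bounded[OF continuous_on_subset[OF C1_continuous_pd[OF harmonic_C1_pd[OF u]]]]) auto
    then obtain C where C: "\<And>j y. norm y \<le> 1/2 \<Longrightarrow> \<bar>pd j (pd i u) y\<bar> \<le> C j" by metis
    have "\<bar>pd i u y - pd i u 0\<bar> \<le> (\<Sum>j\<in>UNIV. \<bar>C j\<bar>) * norm y ^ Suc 0" if y: "norm y \<le> 1/2" for y
    proof (rule C1_vanishing_order[OF _ _ _ _ y])
      show "C1 UNIV (\<lambda>y. pd i u y - pd i u 0)" using harmonic_C1_pd[OF u] by auto
      show "\<bar>pd j (\<lambda>y. pd i u y - pd i u 0) y\<bar> \<le> C j * norm y ^ 0" if "norm y \<le> 1/2" for j y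
        using C[OF that, of j] pd_diff[OF dpu, of "\<lambda>_. pd i u 0"] by simp
    qed auto
    then show ?thesis by (intro exI[of _ "\<Sum>j\<in>UNIV. \<bar>C j\<bar>"]) (unfold pw, auto)
  qed
  then obtain C where C: "\<And>i y. norm y \<le> 1/2 \<Longrightarrow> \<bar>pd i ?w y\<bar> \<le> C i * norm y ^ 1" by metis
  have v: "\<bar>?w y\<bar> \<le> (\<Sum>i\<in>UNIV. \<bar>C i\<bar>) * norm y ^ Suc 1" if y: "norm y \<le> 1/2" for y
    by (rule C1_vanishing_order[OF _ harmonic_C1[OF hw] _ C y]) auto
  have cp: "continuous_on S ?p" for S by (intro continuous_intros)
  have "bint c (\<lambda>y. ?w y * ?p y) = 0"
    by (rule bint_vanishing[where m=1 and N=1 and r="1/2", OF harmonic_subset[OF hw] hp c _ _ _ v]) auto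
  moreover have "bint c (\<lambda>y. 1 * ?p y) = 0"
    by (rule homogeneous_orthogonal[where m=0 and k=1]) (auto simp: hp c)
  moreover have "bint c (\<lambda>y. u y * ?p y) = bint c (\<lambda>y. (?w y * ?p y + u 0 * (1 * ?p y)) + (?p y)\<^sup>2)"
    by (rule bint_cong) (simp add: algebra_simps power2_eq_square)
  moreover have "\<dots> = bint c (\<lambda>y. ?w y * ?p y + u 0 * (1 * ?p y)) + bint c (\<lambda>y. (?p y)\<^sup>2)"
    by (rule bint_add) (intro continuous_intros cu)+
  moreover have "bint c (\<lambda>y. ?w y * ?p y + u 0 * (1 * ?p y)) = bint c (\<lambda>y. ?w y * ?p y) + bint c (\<lambda>y. u 0 * (1 * ?p y))"
    by (rule bint_add) (intro continuous_intros cu)+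
  ultimately have up: "bint c (\<lambda>y. u y * ?p y) = bint c (\<lambda>y. (?p y)\<^sup>2)"
    by (simp only: bint_cmult mult_zero_right add_0)
  have "0 \<le> bint c (\<lambda>y. (u y - ?p y)\<^sup>2)"
    by (rule bint_nonneg) (intro continuous_intros cu, simp)
  also have "\<dots> = bint c (\<lambda>y. (u y)\<^sup>2) - 2 * bint c (\<lambda>y. u y * ?p y) + bint c (\<lambda>y. (?p y)\<^sup>2)"
    by (rule bint_square_diff) (intro cu cp)+
  finally have le: "bint c (\<lambda>y. (?p y)\<^sup>2) \<le> bint c (\<lambda>y. (u y)\<^sup>2)" by (simp add: up)
  have sc: "bint c (\<lambda>y. (?p y)\<^sup>2) = c^5 * bint 1 (\<lambda>y. (?p y)\<^sup>2)"
  proof -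
    have "bint (c * 1) (\<lambda>y. (?p y)\<^sup>2) = c^3 * bint 1 (\<lambda>y. (?p (c *\<^sub>R y))\<^sup>2)"
      by (rule bint_scale) (auto intro!: continuous_intros c)
    also have "(\<lambda>y. (?p (c *\<^sub>R y))\<^sup>2) = (\<lambda>y. c\<^sup>2 * (?p y)\<^sup>2)"
      by (simp add: power_mult_distrib)
    also have "c^3 * bint 1 (\<lambda>y. c\<^sup>2 * (?p y)\<^sup>2) = c^5 * bint 1 (\<lambda>y. (?p y)\<^sup>2)"
      by (simp only: bint_cmult) (simp add: eval_nat_numeral)
    finally show ?thesis by simp
  qed
  have n: "(norm g)\<^sup>2 = (\<Sum>i\<in>UNIV. (pd i u 0)\<^sup>2)"
    by (simp add: norm_vec_def L2_set_def sum_nonneg g_def)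
  have "(norm g)\<^sup>2 * (3 * bint 1 (\<lambda>y. 1)) \<le> (norm g)\<^sup>2 * (5 * bint 1 (\<lambda>y. (norm y)\<^sup>2))"
    by (intro mult_left_mono bint_norm_square_ge) simp
  also have "\<dots> = 15 * bint 1 (\<lambda>y. (?p y)\<^sup>2)" using bint_linear_square[of 1 g] by simp
  finally have "(norm g)\<^sup>2 * bint 1 (\<lambda>y. 1) \<le> 5 * bint 1 (\<lambda>y. (?p y)\<^sup>2)" by (simp add: mult.commute)
  then have "c^5 * ((norm g)\<^sup>2 * bint 1 (\<lambda>y. 1)) \<le> c^5 * (5 * bint 1 (\<lambda>y. (?p y)\<^sup>2))"
    using c by (intro mult_left_mono) auto
  then have "(norm g)\<^sup>2 * (c^5 * bint 1 (\<lambda>y. 1)) \<le> 5 * bint c (\<lambda>y. (?p y)\<^sup>2)"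
    unfolding sc by (simp only: mult_ac)
  then show ?thesis using le unfolding n by linarith
qed

lemma harmonic_gradient_l2:
  assumes u: "harmonic UNIV u"
  shows "(\<Sum>i\<in>UNIV. (pd i u 0)\<^sup>2) * bint 1 (\<lambda>y. 1) \<le> 5 * bint 1 (\<lambda>y. (u y)\<^sup>2)"
proof -
  \<comment> \<open>Dilation by \<open>2\<close> brings the unit ball to radius \<open>1/2\<close>,
    which is below the bound \<open>1\<close> of the previous lemma.\<close>
  let ?u = "\<lambda>y. u (0 + 2 *\<^sub>R y)"
  have h: "harmonic UNIV ?u" by (rule harmonic_affine[OF u]) auto
  have cu: "continuous_on S u" for S
    using continuous_on_subset[OF C1_continuous[OF harmonic_C1[OF u]]] by auto
  have "pd i ?u 0 = 2 * pd i u 0" for i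
    using pd_affine(1)[where a=0 and t=2 and x=0 and f=u] C1_differentiable[OF harmonic_C1[OF u]] by simp
  then have "(\<Sum>i\<in>UNIV. (pd i ?u 0)\<^sup>2) = 4 * (\<Sum>i\<in>UNIV. (pd i u 0)\<^sup>2)"
    by (simp add: power_mult_distrib sum_distrib_left)
  moreover have "bint (2 * (1/2)) (\<lambda>y. (u y)\<^sup>2) = 2^3 * bint (1/2) (\<lambda>y. (u (2 *\<^sub>R y))\<^sup>2)"
    by (rule bint_scale) (auto intro!: continuous_intros cu)
  ultimately show ?thesis
    using harmonic_gradient_l2_aux[OF h, of "1/2"] by (simp add: eval_nat_numeral mult.commute)
qed

lemma homogeneous_l2_scale:
  assumes h: "continuous_on UNIV h" "\<And>s y. h (s *\<^sub>R y) = s ^ n * h y" and c: "c > 0"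
  shows "bint c (\<lambda>y. (h y)\<^sup>2) = c ^ (2 * n + 3) * bint 1 (\<lambda>y. (h y)\<^sup>2)"
proof -
  have "continuous_on S h" for S using h continuous_on_subset by blast
  then have "bint (c * 1) (\<lambda>y. (h y)\<^sup>2) = c^3 * bint 1 (\<lambda>y. (h (c *\<^sub>R y))\<^sup>2)"
    by (intro bint_scale c continuous_intros)
  also have "\<dots> = c^3 * (c ^ (2 * n) * bint 1 (\<lambda>y. (h y)\<^sup>2))"
    unfolding h(2) power_mult_distrib bint_cmult by (simp add: power_mult[symmetric] mult.commute)
  finally show ?thesis by (simp add: power_add mult_ac)
qed

text \<open>Comparing the integrals over thin shells at the boundary gives the factor \<open>1 / (2 n + 3)\<close>; the whole
  ball would only give a bound independent of \<open>n\<close>.\<close>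

lemma (in smooth_harmonic) hom_l2_bound:
  assumes S: "\<And>y. y \<in> ball 0 1 \<Longrightarrow> \<bar>u y - u 0\<bar> \<le> S" and n: "n \<ge> 1"
  shows "real (2 * n + 3) * bint 1 (\<lambda>y. (hom n u y)\<^sup>2) \<le> 3 * S\<^sup>2 * bint 1 (\<lambda>y. 1)"
proof -
  let ?h = "hom n u" and ?v = "\<lambda>y. u y - u 0" and ?m = "2 * n + 3"
  let ?a = "bint 1 (\<lambda>y. (?h y)\<^sup>2)" and ?V = "bint 1 (\<lambda>y. 1)"
  have H: "bint c (\<lambda>y. (?h y)\<^sup>2) = c ^ ?m * ?a" if "c > 0" for c
    by (rule homogeneous_l2_scale[OF hom_cont hom_scale that])
  have cv: "continuous_on (cball 0 c) ?v" if "c < 1" for c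
    by (intro continuous_intros cball_cont that)
  \<comment> \<open>Constants are orthogonal to degree \<open>n >= 1\<close>, so subtracting
    \<open>u 0\<close> keeps the projection to degree \<open>n\<close>.\<close>
  have vh: "bint c (\<lambda>y. ?v y * ?h y) = bint c (\<lambda>y. (?h y)\<^sup>2)" if c: "0 < c" "c < 1" for c
  proof -
    have "bint c (\<lambda>y. ?v y * ?h y) = bint c (\<lambda>y. u y * ?h y - u 0 * (1 * ?h y))"
      by (rule bint_cong) (simp add: algebra_simps del: hom.simps)
    also have "\<dots> = bint c (\<lambda>y. u y * ?h y) - bint c (\<lambda>y. u 0 * (1 * ?h y))"
      by (rule bint_diff) (intro continuous_intros cball_cont c hom_cont)+
    also have "bint c (\<lambda>y. u 0 * (1 * ?h y)) = u 0 * bint c (\<lambda>y. 1 * ?h y)" by (rule bint_cmult)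
    also have "bint c (\<lambda>y. 1 * ?h y) = 0"
      by (rule homogeneous_orthogonal[where m=0 and k=n])
        (use n c hom_harm_ball hom_scale in \<open>auto simp del: hom.simps\<close>)
    also have "bint c (\<lambda>y. u y * ?h y) = bint c (\<lambda>y. ?h y * ?h y)"
      by (rule hom_projection[OF hom_harm_ball hom_scale c])
    finally show ?thesis by (simp add: power2_eq_square del: hom.simps)
  qed
  have sq: "bint c (\<lambda>y. (?v y - ?h y)\<^sup>2) = bint c (\<lambda>y. (?v y)\<^sup>2) - bint c (\<lambda>y. (?h y)\<^sup>2)" if c: "0 < c" "c < 1" for c
    using bint_square_diff[OF cv[OF c(2)] hom_cont, of n] vh[OF c] by (simp del: hom.simps)
  \<comment> \<open>The integral of \<open>(?v - ?h)^2\<close> is the difference of those of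
    \<open>?v^2\<close> and \<open>?h^2\<close>. It grows with the radius, so over a shell
    \<open>?h^2\<close> contributes at most what \<open>?v^2\<close> does.\<close>
  have 1: "(c ^ ?m - s ^ ?m) * ?a \<le> S\<^sup>2 * ((c^3 - s^3) * ?V)" if s: "0 < s" "s \<le> c" "c < 1" for s c
  proof -
    have c: "0 < c" "s < 1" using s by auto
    have "bint s (\<lambda>y. (?v y - ?h y)\<^sup>2) \<le> bint c (\<lambda>y. (?v y - ?h y)\<^sup>2)"
      by (rule bint_mono_radius[OF s(2)]) (intro continuous_intros cv s hom_cont, simp)
    then have "bint c (\<lambda>y. (?h y)\<^sup>2) - bint s (\<lambda>y. (?h y)\<^sup>2) \<le> bint c (\<lambda>y. (?v y)\<^sup>2) - bint s (\<lambda>y. (?v y)\<^sup>2)"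
      unfolding sq[OF c(1) s(3)] sq[OF s(1) c(2)] by linarith
    also have "\<dots> \<le> \<bar>bint c (\<lambda>y. (?v y)\<^sup>2) - bint s (\<lambda>y. (?v y)\<^sup>2)\<bar>" by simp
    also have "\<dots> \<le> S\<^sup>2 * ((c^3 - s^3) * ?V)"
    proof (rule bint_shell[OF _ s(2)])
      fix y :: "real^3" assume "y \<in> cball 0 c"
      then have "\<bar>?v y\<bar> \<le> S" using s by (intro S) simp
      then have "\<bar>?v y\<bar>\<^sup>2 \<le> S\<^sup>2" by (intro power_mono) auto
      then show "\<bar>(?v y)\<^sup>2\<bar> \<le> S\<^sup>2" by simp
    qed (use s in \<open>auto intro!: continuous_intros cv\<close>)
    finally show ?thesis unfolding H[OF c(1)] H[OF s(1)] by (simp only: left_diff_distrib)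
  qed
  have 2: "0 \<le> S\<^sup>2 * ((1^3 - s^3) * ?V) - (1 ^ ?m - s ^ ?m) * ?a" if s: "0 < s" "s < 1" for s
  proof (rule left_limit_nonneg[where a=s and b=1 and F="\<lambda>c. S\<^sup>2 * ((c^3 - s^3) * ?V) - (c ^ ?m - s ^ ?m) * ?a"])
    show "0 \<le> S\<^sup>2 * ((c^3 - s^3) * ?V) - (c ^ ?m - s ^ ?m) * ?a" if "s < c" "c < 1" for c
      using 1[of s c] s that by simp
  qed (use s in \<open>auto intro!: continuous_intros simp del: hom.simps\<close>)
  \<comment> \<open>Both differences of powers contain \<open>1 - s\<close>; after division,
    \<open>s = 1\<close> gives the factors \<open>2 n + 3\<close> and \<open>3\<close>.\<close>
  let ?F = "\<lambda>s::real. S\<^sup>2 * ((1 + s + s^2) * ?V) - (\<Sum>i<?m. s ^ i) * ?a"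
  have "0 \<le> ?F 1"
  proof (rule left_limit_nonneg[where a=0 and b=1 and F="?F"])
    fix s :: real assume s: "0 < s" "s < 1"
    have "1 ^ ?m - s ^ ?m = (1 - s) * (\<Sum>i<?m. s ^ i)"
      using one_diff_power_eq[of s ?m] by simp
    moreover have "1^3 - s^3 = (1 - s) * (1 + s + s^2)" by (simp add: algebra_simps eval_nat_numeral)
    ultimately have "0 \<le> S\<^sup>2 * ((1 - s) * (1 + s + s^2) * ?V) - (1 - s) * (\<Sum>i<?m. s ^ i) * ?a"
      using 2[OF s] by (simp only:)
    also have "\<dots> = (1 - s) * ?F s" by (simp only: right_diff_distrib mult_ac)
    finally show "0 \<le> ?F s" using s by (simp add: zero_le_mult_iff del: hom.simps)
  qed (auto intro!: continuous_intros simp del: hom.simps)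
  then show ?thesis by (simp del: hom.simps)
qed

text \<open>The ball of radius \<open>delta\<close> about \<open>x\<close> lies in the ball of
  radius \<open>1 + delta\<close>, where homogeneity reduces the L2 norm to the unit ball.
  \<open>delta\<close> stays free; the later choice \<open>2 / n\<close> keeps
  \<open>(1 + delta)^(2 n + 3)\<close> bounded in \<open>n\<close>.\<close>

lemma homogeneous_gradient_bound:
  assumes h: "harmonic UNIV h" "\<And>s y. h (s *\<^sub>R y) = s ^ n * h y"
    and x: "norm x = 1" and d: "\<delta> > 0"
  shows "(\<Sum>i\<in>UNIV. (pd i h x)\<^sup>2) * \<delta>^5 * bint 1 (\<lambda>y. 1) \<le> 5 * (1 + \<delta>) ^ (2 * n + 3) * bint 1 (\<lambda>y. (h y)\<^sup>2)"
proof -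
  let ?u = "\<lambda>y. h (x + \<delta> *\<^sub>R y)"
  have ch: "continuous_on S h" for S
    using continuous_on_subset[OF C1_continuous[OF harmonic_C1[OF h(1)]]] by auto
  have hu: "harmonic UNIV ?u" by (rule harmonic_affine[OF h(1)]) auto
  have "pd i ?u 0 = \<delta> * pd i h x" for i
    using pd_affine(1)[where a=x and t=\<delta> and x=0 and f=h] C1_differentiable[OF harmonic_C1[OF h(1)]] by simp
  then have e: "(\<Sum>i\<in>UNIV. (pd i ?u 0)\<^sup>2) = \<delta>\<^sup>2 * (\<Sum>i\<in>UNIV. (pd i h x)\<^sup>2)"
    by (simp add: power_mult_distrib sum_distrib_left)
  have "\<delta>^3 * bint 1 (\<lambda>y. (?u y)\<^sup>2) = (LINT z:cball x (\<delta> * 1)|lborel. (h z)\<^sup>2)"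
    unfolding bint_def by (rule lint_cball_affine[symmetric]) (intro d continuous_intros ch)+
  also have "\<dots> \<le> bint (1 + \<delta>) (\<lambda>y. (h y)\<^sup>2)"
    unfolding bint_def
  proof (rule lint_mono_set)
    show "cball x (\<delta> * 1) \<subseteq> cball 0 (1 + \<delta>)"
    proof
      fix z assume "z \<in> cball x (\<delta> * 1)"
      then show "z \<in> cball 0 (1 + \<delta>)" using norm_triangle_sub[of z x] x by (simp add: dist_norm norm_minus_commute)
    qed
  qed (auto intro!: continuous_intros ch)
  also have "\<dots> = (1 + \<delta>) ^ (2 * n + 3) * bint 1 (\<lambda>y. (h y)\<^sup>2)"
    by (rule homogeneous_l2_scale[OF ch h(2)]) (use d in simp)
  finally have 1: "\<delta>^3 * bint 1 (\<lambda>y. (?u y)\<^sup>2) \<le> (1 + \<delta>) ^ (2 * n + 3) * bint 1 (\<lambda>y. (h y)\<^sup>2)" .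
  have "\<delta>^3 * (\<delta>\<^sup>2 * (\<Sum>i\<in>UNIV. (pd i h x)\<^sup>2) * bint 1 (\<lambda>y. 1)) \<le> \<delta>^3 * (5 * bint 1 (\<lambda>y. (?u y)\<^sup>2))"
    using harmonic_gradient_l2[OF hu] d unfolding e by (intro mult_left_mono) auto
  with 1 show ?thesis by (simp add: eval_nat_numeral mult_ac)
qed

lemma (in smooth_harmonic) hom_gradient_bound:
  assumes S: "\<And>y. y \<in> ball 0 1 \<Longrightarrow> \<bar>u y - u 0\<bar> \<le> S" and n: "n \<ge> 1"
    and x: "norm x = 1" and d: "\<delta> > 0"
  shows "(\<Sum>i\<in>UNIV. (pd i (hom n u) x)\<^sup>2) * \<delta>^5 * real (2 * n + 3) \<le> 15 * (1 + \<delta>) ^ (2 * n + 3) * S\<^sup>2"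
proof -
  let ?G = "\<Sum>i\<in>UNIV. (pd i (hom n u) x)\<^sup>2" and ?V = "bint 1 (\<lambda>y. 1)" and ?a = "bint 1 (\<lambda>y. (hom n u y)\<^sup>2)"
  have "?G * \<delta>^5 * ?V * real (2 * n + 3) \<le> 5 * (1 + \<delta>) ^ (2 * n + 3) * ?a * real (2 * n + 3)"
    using homogeneous_gradient_bound[OF hom_harm hom_scale x d] by (intro mult_right_mono) auto
  also have "\<dots> = 5 * (1 + \<delta>) ^ (2 * n + 3) * (real (2 * n + 3) * ?a)" by (simp only: mult_ac)
  also have "\<dots> \<le> 5 * (1 + \<delta>) ^ (2 * n + 3) * (3 * S\<^sup>2 * ?V)"
    by (rule mult_left_mono[OF hom_l2_bound[OF S n]]) (use d in auto)
  finally have "?V * (?G * \<delta>^5 * real (2 * n + 3)) \<le> ?V * (15 * (1 + \<delta>) ^ (2 * n + 3) * S\<^sup>2)"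
    by (simp add: mult_ac)
  then show ?thesis using bint_one_pos[of 1] by (simp only: mult_le_cancel_left_pos)
qed

section \<open>Rotations about the real axis\<close>

definition zc :: "real^3 \<Rightarrow> complex" where
  "zc x = Complex (x$2) (x$3)"

definition rot :: "real \<Rightarrow> real^3 \<Rightarrow> real^3" where
  "rot \<theta> x = vector [x$1, cos \<theta> * x$2 - sin \<theta> * x$3, sin \<theta> * x$2 + cos \<theta> * x$3]"

lemma rot_nth [simp]:
  "rot \<theta> x $ 1 = x$1"
  "rot \<theta> x $ 2 = cos \<theta> * x$2 - sin \<theta> * x$3"
  "rot \<theta> x $ 3 = sin \<theta> * x$2 + cos \<theta> * x$3"
  by (simp_all add: rot_def)

lemma zc_rot: "zc (rot \<theta> x) = cis \<theta> * zc x"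
  by (simp add: zc_def complex_eq_iff)

lemma rot_orthogonal: "orthogonal_transformation (rot \<theta>)"
  unfolding orthogonal_transformation
proof
  show "linear (rot \<theta>)"
    by (rule linearI) (simp_all add: vec_eq_iff forall_3 algebra_simps)
  have "(c * a - s * b)\<^sup>2 + (s * a + c * b)\<^sup>2 = (s\<^sup>2 + c\<^sup>2) * (a\<^sup>2 + b\<^sup>2)" for a b c s :: real
    by (simp add: power2_eq_square algebra_simps)
  then have "(cos \<theta> * a - sin \<theta> * b)\<^sup>2 + (sin \<theta> * a + cos \<theta> * b)\<^sup>2 = a\<^sup>2 + b\<^sup>2" for a b
    by (simp only: sin_cos_squared_add mult_1)
  then show "\<forall>v. norm (rot \<theta> v) = norm v"
    by (simp add: norm_vec_def L2_set_def sum_3 add.assoc)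
qed

lemma norm_rot [simp]: "norm (rot \<theta> x) = norm x"
  using orthogonal_transformation_norm[OF rot_orthogonal] .

lemma rot_0 [simp]: "rot 0 x = x"
  by (simp add: vec_eq_iff forall_3)

lemma zc_linear: "bounded_linear zc"
  by (intro linear_conv_bounded_linear[THEN iffD1] linearI)
    (simp_all add: zc_def complex_eq_iff)

text \<open>The complex factor \<open>k\<close> makes the family closed under \<open>pd\<close>;
  \<open>k = 1\<close> and \<open>k = - i\<close> give the real and the imaginary part of
  \<open>zc x ^ n\<close>.\<close>

definition Rz :: "complex \<Rightarrow> nat \<Rightarrow> real^3 \<Rightarrow> real" where
  "Rz k n x = Re (k * zc x ^ n)"

lemma Rz_scale: "Rz k n (s *\<^sub>R x) = s ^ n * Rz k n x"
proof -
  have "zc (s *\<^sub>R x) = of_real s * zc x" by (simp add: zc_def complex_eq_iff)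
  then have "k * zc (s *\<^sub>R x) ^ n = of_real (s ^ n) * (k * zc x ^ n)"
    by (simp add: power_mult_distrib mult_ac)
  moreover have "Re (of_real r * z) = r * Re z" for r z by simp
  ultimately show ?thesis by (simp only: Rz_def)
qed

lemma Rz_continuous: "continuous_on S (Rz k n)"
  unfolding Rz_def by (intro continuous_intros linear_continuous_on zc_linear)

lemma Rz_has_derivative:
  "(Rz k n has_derivative (\<lambda>v. Re (k * (of_nat n * zc v * zc x ^ (n - 1))))) (at x)"
proof -
  have "(zc has_derivative zc) (at x)"
    by (rule bounded_linear_imp_has_derivative[OF zc_linear])
  from has_derivative_power[OF this, of n]
  have "((\<lambda>x. k * zc x ^ n) has_derivative (\<lambda>v. k * (of_nat n * zc v * zc x ^ (n - 1)))) (at x)"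
    by (intro has_derivative_mult_right)
  then show ?thesis unfolding Rz_def[abs_def] by (rule has_derivative_Re)
qed

lemma pd_Rz: "pd i (Rz k n) = Rz (k * of_nat n * zc (axis i 1)) (n - 1)"
  by (rule ext) (simp add: pd_eqI[OF Rz_has_derivative] Rz_def mult_ac)

lemma Rz_C1: "C1 U (Rz k n)"
  unfolding C1_def using Rz_has_derivative by (auto simp: differentiable_def pd_Rz Rz_continuous)

lemma zc_axis: "zc (axis 1 1) = 0" "zc (axis 2 1) = 1" "zc (axis 3 1) = \<i>"
  by (simp_all add: zc_def axis_def complex_eq_iff)

lemma Rz_harmonic: "harmonic U (Rz k n)"
proof -
  have "k * a * \<i> * b * \<i> = - (k * a * b)" for a b
  proof -
    have "k * a * \<i> * b * \<i> = k * a * b * (\<i> * \<i>)" by (simp only: mult_ac)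
    then show ?thesis by simp
  qed
  then have "Rz (k * of_nat n * \<i> * of_nat (n - 1) * \<i>) (n - 1 - 1) x = - Rz (k * of_nat n * 1 * of_nat (n - 1) * 1) (n - 1 - 1) x" for x
    by (simp add: Rz_def)
  moreover have "Rz 0 m x = 0" for m x by (simp add: Rz_def)
  ultimately show ?thesis
    unfolding harmonic_def pd_Rz by (simp only: pd_Rz Rz_C1 sum_3 zc_axis mult_zero_left mult_zero_right) simp
qed

text \<open>The angular modes of a homogeneous polynomial of degree \<open>n\<close> lie between \<open>-n\<close> and \<open>n\<close>, so \<open>2 n + 1\<close>
  equally spaced rotations suffice to separate them.\<close>

definition angle :: "nat \<Rightarrow> nat \<Rightarrow> real" where
  "angle n k = 2 * pi * (real k - real n) / real (2 * n + 1)"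

lemma sum_abs_diff: "(\<Sum>k<2 * n + 1. \<bar>real k - real n\<bar>) = real n * (real n + 1)"
proof (induction n)
  case (Suc n)
  have gen: "(\<Sum>k<Suc (Suc M). f k) = f 0 + (\<Sum>k<M. f (Suc k)) + f (Suc M)" for f :: "nat \<Rightarrow> real" and M
    by (simp only: sum.lessThan_Suc[of f "Suc M"] sum.lessThan_Suc_shift[of f M])
  have "2 * Suc n + 1 = Suc (Suc (2 * n + 1))" by simp
  then have "(\<Sum>k<2 * Suc n + 1. \<bar>real k - real (Suc n)\<bar>)
      = \<bar>real 0 - real (Suc n)\<bar> + (\<Sum>k<2 * n + 1. \<bar>real (Suc k) - real (Suc n)\<bar>) + \<bar>real (Suc (2 * n + 1)) - real (Suc n)\<bar>"
    by (simp only: gen)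
  also have "(\<Sum>k<2 * n + 1. \<bar>real (Suc k) - real (Suc n)\<bar>) = (\<Sum>k<2 * n + 1. \<bar>real k - real n\<bar>)"
    by simp
  finally show ?case unfolding Suc.IH by (simp add: algebra_simps)
qed simp

text \<open>The angles are placed symmetrically about \<open>0\<close>, so their mean distance to
  \<open>0\<close> is at most \<open>pi / 2\<close>. This is the factor in
  \<open>W_bound\<close>.\<close>

lemma sum_abs_angle: "(\<Sum>k<2 * n + 1. \<bar>angle n k\<bar>) \<le> real (2 * n + 1) * (pi / 2)"
proof -
  have "(\<Sum>k<2 * n + 1. \<bar>angle n k\<bar>) = (2 * pi / real (2 * n + 1)) * (\<Sum>k<2 * n + 1. \<bar>real k - real n\<bar>)"
    unfolding sum_distrib_left by (rule sum.cong) (auto simp: angle_def abs_mult)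
  also have "\<dots> = (2 * pi / real (2 * n + 1)) * (real n * (real n + 1))"
    by (simp only: sum_abs_diff)
  also have "\<dots> \<le> (2 * pi / real (2 * n + 1)) * ((real (2 * n + 1))\<^sup>2 / 4)"
    by (intro mult_left_mono) (auto simp: power2_eq_square field_simps)
  also have "\<dots> = real (2 * n + 1) * (pi / 2)"
    by (simp add: power2_eq_square)
  finally show ?thesis .
qed

text \<open>A geometric sum whose ratio is a \<open>(2 n + 1)\<close>-st root of unity other than
  \<open>1\<close>.\<close>

lemma sum_cis_angle:
  assumes m: "0 < m" "m < 2 * n + 1"
  shows "(\<Sum>k<2 * n + 1. cis (- (real m * angle n k))) = 0"
proof -
  define N where "N = real (2 * n + 1)"
  define w where "w = cis (- (2 * pi * real m / N))"
  have N0: "N > 0" by (simp add: N_def)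
  have ang: "angle n k = 2 * pi * (real k - real n) / N" for k
    by (simp only: angle_def N_def)
  have "cis (- (real m * angle n k)) = cis (2 * pi * real m * real n / N) * w ^ k" for k
  proof -
    have "- (real m * angle n k) = 2 * pi * real m * real n / N + real k * (- (2 * pi * real m / N))"
      using N0 by (simp add: ang field_simps)
    then show ?thesis unfolding w_def Complex.DeMoivre cis_mult by (rule arg_cong[where f=cis])
  qed
  then have "(\<Sum>k<2 * n + 1. cis (- (real m * angle n k))) = cis (2 * pi * real m * real n / N) * (\<Sum>k<2 * n + 1. w ^ k)"
    by (simp only: sum_distrib_left)
  moreover have "(\<Sum>k<2 * n + 1. w ^ k) = 0"
  proof -
    have "w ^ (2 * n + 1) = cis (- (2 * pi * real m))"
    proof -
      have "w ^ (2 * n + 1) = cis (N * (- (2 * pi * real m / N)))"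
        unfolding w_def Complex.DeMoivre N_def ..
      also have "N * (- (2 * pi * real m / N)) = - (2 * pi * real m)" using N0 by (simp add: field_simps)
      finally show ?thesis .
    qed
    also have "\<dots> = 1"
      using cis_multiple_2pi[of "- real m"] by (simp add: mult_ac)
    finally have wN: "w ^ (2 * n + 1) = 1" .
    have "w \<noteq> 1"
    proof
      assume "w = 1"
      then have "cos (2 * pi * real m / N) = 1" by (simp add: w_def complex_eq_iff)
      then obtain j :: int where j: "2 * pi * real m / N = real_of_int j * 2 * pi"
        using cos_one_2pi_int by blast
      then have "real m = real_of_int j * N" using N0 by (simp add: field_simps)
      then have "of_int (int m) = (of_int (j * int (2 * n + 1)) :: real)" by (simp add: N_def)
      then have jm: "int m = j * int (2 * n + 1)" by (simp only: of_int_eq_iff)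
      then have "j > 0" using m by (metis of_nat_0_less_iff zero_less_mult_pos2 zero_less_Suc add.commute plus_1_eq_Suc)
      then have "int m \<ge> 1 * int (2 * n + 1)" unfolding jm by (intro mult_right_mono) auto
      then show False using m by simp
    qed
    then show ?thesis using wN by (simp only: sum_gp_strict if_False diff_self div_0)
  qed
  ultimately show ?thesis by simp
qed

text \<open>The discrete Fourier coefficient of frequency \<open>m\<close> along the rotation orbit
  of \<open>x\<close>, without the factor \<open>1 / (2 n + 1)\<close>.\<close>

definition mode :: "nat \<Rightarrow> nat \<Rightarrow> (real^3 \<Rightarrow> real) \<Rightarrow> real^3 \<Rightarrow> complex" where
  "mode n m h x = (\<Sum>k<2 * n + 1. cis (- (real m * angle n k)) * of_real (h (rot (angle n k) x)))"

text \<open>Along the orbit the second and third coordinates are combinations of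
  \<open>cis t\<close> and \<open>cis (- t)\<close>, so multiplication by them shifts the frequency
  by one in either direction. \<open>m >= 1\<close> makes \<open>m - 1\<close> a genuine difference
  of naturals.\<close>

lemma mode_hom_Suc:
  assumes m: "m \<ge> 1"
  shows "mode n m (hom (Suc j) h) x = (of_real (x$1) * mode n m (hom j (pd 1 h)) x
      + (zc x * mode n (m - 1) (hom j (pd 2 h)) x + cnj (zc x) * mode n (m + 1) (hom j (pd 2 h)) x) / 2
      + (zc x * mode n (m - 1) (hom j (pd 3 h)) x - cnj (zc x) * mode n (m + 1) (hom j (pd 3 h)) x) / (2 * \<i>)) / of_nat (Suc j)"
proof -
  let ?c = "\<lambda>m k. cis (- (real m * angle n k))"
  let ?r = "\<lambda>k. rot (angle n k) x"
  have t: "?c m k * of_real (hom (Suc j) h (?r k)) =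
     (of_real (x$1) * (?c m k * of_real (hom j (pd 1 h) (?r k)))
      + (zc x * (?c (m - 1) k * of_real (hom j (pd 2 h) (?r k))) + cnj (zc x) * (?c (m + 1) k * of_real (hom j (pd 2 h) (?r k)))) / 2
      + (zc x * (?c (m - 1) k * of_real (hom j (pd 3 h) (?r k))) - cnj (zc x) * (?c (m + 1) k * of_real (hom j (pd 3 h) (?r k)))) / (2 * \<i>)) / of_nat (Suc j)" for k
  proof -
    let ?t = "angle n k"
    have c1: "?c (m - 1) k = ?c m k * cis ?t"
      using m by (simp add: cis_mult of_nat_diff algebra_simps)
    have c2: "?c (m + 1) k = ?c m k * cis (- ?t)"
      by (simp add: cis_mult algebra_simps)
    have e2: "complex_of_real (?r k $ 2) = (zc x * cis ?t + cnj (zc x) * cis (- ?t)) / 2"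
      by (simp add: zc_def complex_eq_iff)
    have e3: "complex_of_real (?r k $ 3) = (zc x * cis ?t - cnj (zc x) * cis (- ?t)) / (2 * \<i>)"
      by (simp add: zc_def complex_eq_iff Re_divide Im_divide) (simp add: field_simps)
    have e4: "complex_of_real (hom (Suc j) h (?r k)) = (of_real (x$1) * of_real (hom j (pd 1 h) (?r k))
       + of_real (?r k $ 2) * of_real (hom j (pd 2 h) (?r k)) + of_real (?r k $ 3) * of_real (hom j (pd 3 h) (?r k))) / of_nat (Suc j)"
      by (simp add: sum_3)
    show ?thesis unfolding c1 c2 e4 e2 e3
      by (simp add: algebra_simps add_divide_distrib diff_divide_distrib del: of_nat_Suc hom.simps)
  qed
  show ?thesis
    unfolding mode_def t
    by (simp only: sum_divide_distrib[symmetric] sum.distrib sum_subtractf sum_distrib_left[symmetric])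
qed

text \<open>A part of degree \<open>j\<close> has frequencies from \<open>-j\<close> to
  \<open>j\<close> only, and \<open>m + j < 2 n + 1\<close> rules out one that agrees with
  \<open>m\<close> modulo \<open>2 n + 1\<close>. The top frequency arises only if every step
  contributes a factor \<open>zc x\<close>, which gives \<open>zc x ^ j\<close>.\<close>

lemma mode_hom:
  assumes "j \<le> n"
  shows "(\<forall>m x. j < m \<longrightarrow> m + j < 2 * n + 1 \<longrightarrow> mode n m (hom j h) x = 0) \<and> (\<exists>c. \<forall>x. mode n j (hom j h) x = c * zc x ^ j)"
  using assms
proof (induction j arbitrary: h)
  case 0
  have "mode n m (hom 0 h) x = 0" if "0 < m" "m + 0 < 2 * n + 1" for m x
    using sum_cis_angle[of m n] that by (simp add: mode_def sum_distrib_right[symmetric])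
  moreover have "mode n 0 (hom 0 h) x = of_nat (2 * n + 1) * of_real (h 0) * zc x ^ 0" for x
    by (simp add: mode_def)
  ultimately show ?case by blast
next
  case (Suc j)
  have z: "mode n m (hom j g) x = 0" if "j < m" "m + j < 2 * n + 1" for m x g
    using Suc.IH[of g] Suc.prems that by simp
  have "mode n m (hom (Suc j) h) x = 0" if "Suc j < m" "m + Suc j < 2 * n + 1" for m x
    using that by (subst mode_hom_Suc) (auto simp: z simp del: hom.simps)
  moreover obtain c2 where c2: "\<And>x. mode n j (hom j (pd 2 h)) x = c2 * zc x ^ j"
    using Suc.IH[of "pd 2 h"] Suc.prems by auto
  moreover obtain c3 where c3: "\<And>x. mode n j (hom j (pd 3 h)) x = c3 * zc x ^ j"
    using Suc.IH[of "pd 3 h"] Suc.prems by auto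
  have "mode n (Suc j) (hom (Suc j) h) x = ((c2 / 2 + c3 / (2 * \<i>)) / of_nat (Suc j)) * zc x ^ Suc j" for x
  proof -
    have "mode n (Suc j) (hom j (pd 1 h)) x = 0" "mode n (Suc j + 1) (hom j (pd 2 h)) x = 0" "mode n (Suc j + 1) (hom j (pd 3 h)) x = 0"
      using Suc.prems by (auto intro!: z)
    then show ?thesis
      by (subst mode_hom_Suc) (simp_all add: c2 c3 field_simps del: hom.simps of_nat_Suc)
  qed
  ultimately show ?case by blast
qed

section \<open>The estimate on the unit ball\<close>

lemma bint_zc_power_pos: "bint 1 (\<lambda>y. cmod (zc y) ^ (2 * n)) > 0"
proof -
  \<comment> \<open>A ball away from the real axis, on which
    \<open>cmod (zc y) >= 1/4\<close>.\<close>
  let ?K = "cball (axis 2 (1/2) :: real^3) (1/4)"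
  have cz: "continuous_on S (\<lambda>y. cmod (zc y) ^ (2 * n))" for S
    by (intro continuous_intros linear_continuous_on zc_linear)
  have low: "1/4 \<le> cmod (zc y)" if "y \<in> ?K" for y
  proof -
    have "\<bar>(y - axis 2 (1/2)) $ 2\<bar> \<le> 1/4"
      using component_le_norm_cart[of "y - axis 2 (1/2)" 2] that by (simp add: dist_norm norm_minus_commute)
    then have "\<bar>y $ 2 - 1/2\<bar> \<le> 1/4" by (simp add: axis_def)
    then have "1/4 \<le> y $ 2" by linarith
    also have "\<dots> \<le> cmod (zc y)" using complex_Re_le_cmod[of "zc y"] by (simp add: zc_def)
    finally show ?thesis .
  qed
  have sub: "?K \<subseteq> cball 0 1"
  proof
    fix y assume "y \<in> ?K"
    then have "norm y \<le> norm (axis 2 (1/2) :: real^3) + 1/4"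
      using norm_triangle_sub[of y "axis 2 (1/2)"] by (simp add: dist_norm norm_minus_commute)
    moreover have "(axis 2 (1/2) :: real^3) = (1/2) *\<^sub>R axis 2 1"
      by (simp add: vec_eq_iff axis_def)
    ultimately show "y \<in> cball 0 1" by simp
  qed
  have "0 < (1/4) ^ (2 * n) * measure lborel ?K"
    using content_cball_pos[of "1/4" "axis 2 (1/2) :: real^3"] by simp
  also have "\<dots> = (LINT y:?K|lborel. (1/4) ^ (2 * n))"
    using emeasure_bounded_finite[of ?K] by (subst set_integral_const) auto
  also have "\<dots> \<le> (LINT y:?K|lborel. cmod (zc y) ^ (2 * n))"
    by (intro set_integral_mono set_integrable_compact cz power_mono low) auto
  also have "\<dots> \<le> bint 1 (\<lambda>y. cmod (zc y) ^ (2 * n))"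
    unfolding bint_def by (rule lint_mono_set) (use sub cz in auto)
  finally show ?thesis .
qed

lemma rot_has_vector_derivative:
  "((\<lambda>\<theta>. rot \<theta> x) has_vector_derivative vector [0, - rot \<theta> x $ 3, rot \<theta> x $ 2]) (at \<theta>)"
proof -
  let ?p = "x$2 *\<^sub>R axis 2 1 + x$3 *\<^sub>R axis 3 1 :: real^3"
  let ?q = "x$2 *\<^sub>R axis 3 1 - x$3 *\<^sub>R axis 2 1 :: real^3"
  have "rot \<theta> x = x$1 *\<^sub>R axis 1 1 + cos \<theta> *\<^sub>R ?p + sin \<theta> *\<^sub>R ?q" for \<theta>
    by (simp add: vec_eq_iff forall_3 axis_def)
  moreover have "((\<lambda>\<theta>. x$1 *\<^sub>R axis 1 1 + cos \<theta> *\<^sub>R ?p + sin \<theta> *\<^sub>R ?q) has_vector_derivative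
       (- sin \<theta> *\<^sub>R ?p + cos \<theta> *\<^sub>R ?q)) (at \<theta>)"
    by (auto intro!: derivative_eq_intros)
  moreover have "- sin \<theta> *\<^sub>R ?p + cos \<theta> *\<^sub>R ?q = vector [0, - rot \<theta> x $ 3, rot \<theta> x $ 2]"
    by (simp add: vec_eq_iff forall_3 axis_def)
  ultimately show ?thesis by simp
qed

text \<open>The left side has two of the three components of a cross product. By Lagrange's identity
  the difference is the square of the third plus the square of the inner product.\<close>

lemma cross_product_bound:
  fixes x1 x2 x3 g1 g2 g3 :: real
  shows "(x3 * g1 - x1 * g3)\<^sup>2 + (x2 * g1 - x1 * g2)\<^sup>2 \<le> (x1\<^sup>2 + x2\<^sup>2 + x3\<^sup>2) * (g1\<^sup>2 + g2\<^sup>2 + g3\<^sup>2)"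
proof -
  have "(x1\<^sup>2 + x2\<^sup>2 + x3\<^sup>2) * (g1\<^sup>2 + g2\<^sup>2 + g3\<^sup>2) - ((x3 * g1 - x1 * g3)\<^sup>2 + (x2 * g1 - x1 * g2)\<^sup>2)
      = (x1 * g1 + x2 * g2 + x3 * g3)\<^sup>2 + (x2 * g3 - x3 * g2)\<^sup>2"
    by (simp add: power2_eq_square algebra_simps)
  moreover have "\<dots> \<ge> 0" by simp
  ultimately show ?thesis by linarith
qed

text \<open>In terms of \<open>m = n - 3\<close> all coefficients of the difference are positive. At
  \<open>n = 2\<close> the inequality fails, which is why \<open>degree_constant_bound\<close>
  evaluates \<open>n = 1\<close> and \<open>n = 2\<close> directly. \<open>2.56 = 3.2^2 / 4\<close>
  bounds \<open>pi^2 / 4\<close>; in \<open>3645 = 15 * 81 * 3\<close> the \<open>81\<close> bounds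
  \<open>e^4\<close> and the \<open>3\<close> comes from the target factor
  \<open>2/3\<close>.\<close>

lemma degree_constant_polynomial_bound:
  assumes n: "(n::real) \<ge> 3"
  shows "(1 + 2.56 * n\<^sup>2) * 3645 * (n + 2) \<le> 64 * (2 * n + 3) * (n + 1)\<^sup>2 * (2 * n + 1)\<^sup>2"
proof -
  define m where "m = n - 3"
  have m: "m \<ge> 0" "n = m + 3" using n by (auto simp: m_def)
  have "64 * (2 * n + 3) * (n + 1)\<^sup>2 * (2 * n + 1)\<^sup>2 - (1 + 2.56 * n\<^sup>2) * 3645 * (n + 2) \<ge> 0"
  proof -
    have "0 \<le> m * m" "0 \<le> m * (m * m)" "0 \<le> m * (m * (m * m))" "0 \<le> m * (m * (m * (m * m)))"
      using m(1) by auto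
    then show ?thesis
      unfolding m(2) by (simp only: power2_eq_square algebra_simps) (use m(1) in linarith)
  qed
  then show ?thesis by simp
qed

text \<open>The left-hand side is the squared bound for the degree \<open>n\<close> part, with the radius \<open>\<delta> = 2 / n\<close> in the
  gradient estimate.\<close>

lemma degree_constant_bound:
  assumes n: "n \<ge> 1"
  shows "(1 / (real n)\<^sup>2 + pi\<^sup>2 / 4) * (15 * (1 + 2 / real n) ^ (2 * n + 3) / ((2 / real n)^5 * real (2 * n + 3)))
      \<le> 2 / 3 * ((2 * real n + 1) * (real n + 1) * (real n + 2))\<^sup>2" (is "?L * ?M \<le> ?R")
proof -
  have "pi \<le> 3.2" using pi_approx by simp
  then have "pi\<^sup>2 \<le> 3.2\<^sup>2" by (intro power_mono) auto
  then have pi: "?L \<le> 1 / (real n)\<^sup>2 + 2.56" by (simp add: power2_eq_square)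
  have M0: "0 \<le> ?M" by simp
  have 1: "?L * ?M \<le> (1 / (real n)\<^sup>2 + 2.56) * ?M"
    by (rule mult_right_mono[OF pi M0])
  consider "n = 1" | "n = 2" | "n \<ge> 3" using n by linarith
  then show ?thesis
  proof cases
    case 3
    define N where "N = real n"
    have N: "N \<ge> 3" using 3 by (simp add: N_def)
    \<comment> \<open>The power is at most \<open>e^4\<close>, and \<open>e <= 3\<close>; the
      remaining cube of \<open>1 + 2 / N\<close> is kept exactly.\<close>
    have "(1 + 2 / N) ^ (2 * n) \<le> (exp (2 / N)) ^ (2 * n)"
      using N exp_ge_add_one_self[of "2 / N"] by (intro power_mono) auto
    also have "\<dots> = exp (real (2 * n) * (2 / N))" by (simp only: exp_of_nat_mult)
    also have "real (2 * n) * (2 / N) = real 4 * 1" using N by (simp add: N_def)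
    also have "exp (real 4 * 1) = exp 1 ^ 4" by (simp only: exp_of_nat_mult)
    also have "\<dots> \<le> 3 ^ 4" by (intro power_mono exp_le) auto
    finally have e: "(1 + 2 / N) ^ (2 * n) \<le> 81" by simp
    have "?M = 15 * ((1 + 2 / N) ^ (2 * n) * (1 + 2 / N)^3) / ((2 / N)^5 * (2 * N + 3))"
      by (simp add: N_def power_add)
    also have "\<dots> \<le> 15 * (81 * (1 + 2 / N)^3) / ((2 / N)^5 * (2 * N + 3))"
      using N by (intro divide_right_mono mult_left_mono mult_right_mono e) auto
    also have "\<dots> = 1215 * N\<^sup>2 * (N + 2)^3 / (32 * (2 * N + 3))"
    proof -
      have "1 + 2 / N = (N + 2) / N" using N by (simp add: field_simps)
      then have a: "(1 + 2 / N)^3 = (N + 2)^3 / N^3" by (simp add: power_divide)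
      have "N^5 = N^3 * N\<^sup>2" by (simp add: eval_nat_numeral)
      then have b: "(2 / N)^5 = 32 / (N^3 * N\<^sup>2)" by (simp add: power_divide)
      have gen: "15 * (81 * (A / P)) / (32 / (P * q) * c) = 1215 * q * A / (32 * c)"
        if "P > 0" "q > 0" "c > 0" for A P q c :: real
        using that by (simp add: field_simps)
      show ?thesis unfolding a b by (rule gen) (use N in auto)
    qed
    finally have "(1 / N\<^sup>2 + 2.56) * ?M \<le> (1 / N\<^sup>2 + 2.56) * (1215 * N\<^sup>2 * (N + 2)^3 / (32 * (2 * N + 3)))"
      by (intro mult_left_mono) auto
    also have "\<dots> = ((1 + 2.56 * N\<^sup>2) * 3645 * (N + 2)) * ((N + 2)\<^sup>2 / (96 * (2 * N + 3)))"
    proof -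
      have gen: "(1 / q + 2.56) * (1215 * q * B^3 / (32 * c)) = ((1 + 2.56 * q) * 3645 * B) * (B\<^sup>2 / (96 * c))"
        if "q > 0" "c > 0" for B q c :: real
        using that by (simp add: field_simps power3_eq_cube power2_eq_square)
      show ?thesis by (rule gen) (use N in auto)
    qed
    also have "\<dots> \<le> (64 * (2 * N + 3) * (N + 1)\<^sup>2 * (2 * N + 1)\<^sup>2) * ((N + 2)\<^sup>2 / (96 * (2 * N + 3)))"
      using N by (intro mult_right_mono degree_constant_polynomial_bound) auto
    also have "\<dots> = 2 / 3 * ((2 * N + 1) * (N + 1) * (N + 2))\<^sup>2"
    proof -
      have gen: "(64 * c * D * E) * (B / (96 * c)) = 2 / 3 * (E * D * B)" if "c > 0" for B c D E :: real
        using that by (simp add: field_simps)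
      show ?thesis unfolding power_mult_distrib by (rule gen) (use N in auto)
    qed
    finally show ?thesis using 1 by (simp only: N_def)
  qed (use 1 in \<open>auto simp: eval_nat_numeral\<close>)
qed

lemma degree_constant_sum:
  fixes r :: real
  assumes r: "0 \<le> r" "r < 1"
  shows "(\<Sum>n=1..N. (2 * real n + 1) * (real n + 1) * (real n + 2) * r ^ n) \<le> 2 * r * ((3 - r) * (3 - r + r\<^sup>2)) / (1 - r)^4"
proof -
  \<comment> \<open>\<open>r ^ M * Q M / (1 - r)^4\<close> is the tail of the series from \<open>n = M\<close> on.\<close>
  define Q where "Q M = (2*M+1)*(M+1)*(M+2)*(1-r)^3 + (M+2)*(6*M+8)*r*(1-r)^2 + (12*M+26)*r^2*(1-r) + 12*r^3" for M
  have step: "(1-r)^4 * ((2*M+1)*(M+1)*(M+2)) + r * Q (M+1) = Q M" for M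
    unfolding Q_def by (simp add: eval_nat_numeral algebra_simps)
  have "(1-r)^4 * (\<Sum>n=1..N. (2 * real n + 1) * (real n + 1) * (real n + 2) * r ^ n) + r ^ Suc N * Q (real (Suc N)) = r * Q 1" for N
  proof (induction N)
    case (Suc N)
    have "(1-r)^4 * (\<Sum>n=1..Suc N. (2 * real n + 1) * (real n + 1) * (real n + 2) * r ^ n) + r ^ Suc (Suc N) * Q (real (Suc (Suc N)))
      = (1-r)^4 * (\<Sum>n=1..N. (2 * real n + 1) * (real n + 1) * (real n + 2) * r ^ n)
        + r ^ Suc N * ((1-r)^4 * ((2 * real (Suc N) + 1) * (real (Suc N) + 1) * (real (Suc N) + 2)) + r * Q (real (Suc N) + 1))"
      by (simp add: algebra_simps)
    then show ?case unfolding step Suc.IH .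
  qed simp
  moreover have "r ^ Suc N * Q (real (Suc N)) \<ge> 0"
    unfolding Q_def using r by (intro mult_nonneg_nonneg add_nonneg_nonneg) auto
  moreover have "r * Q 1 = 2 * r * ((3 - r) * (3 - r + r\<^sup>2))"
    unfolding Q_def by (simp add: eval_nat_numeral algebra_simps)
  ultimately have "(\<Sum>n=1..N. (2 * real n + 1) * (real n + 1) * (real n + 2) * r ^ n) * (1-r)^4 \<le> 2 * r * ((3 - r) * (3 - r + r\<^sup>2))"
    by (smt (verit, best) mult.commute)
  then show ?thesis using r by (simp add: pos_le_divide_eq)
qed

section \<open>Homogeneous parts of a Riesz system\<close>

locale riesz_unit =
  fixes v :: "3 \<Rightarrow> real^3 \<Rightarrow> real"
  assumes riesz: "riesz (ball 0 1) v"
begin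

lemma smooth: "smooth (ball 0 1) (v j)"
  by (rule riesz_smooth[OF _ riesz]) simp

lemma sym: "x \<in> ball 0 1 \<Longrightarrow> pd i (v j) x = pd j (v i) x"
  and div: "x \<in> ball 0 1 \<Longrightarrow> (\<Sum>i\<in>UNIV. pd i (v i) x) = 0"
  using riesz by (auto simp: riesz_def)

text \<open>Symmetry turns the Laplacian of \<open>v j\<close> into \<open>pd j\<close> of the
  trace, with one exchange of partial derivatives.\<close>

sublocale comp: smooth_harmonic "v j" for j
proof
  fix x :: "real^3" assume x: "x \<in> ball 0 1"
  have "(\<Sum>i\<in>UNIV. pd i (pd i (v j)) x) = (\<Sum>i\<in>UNIV. pd j (pd i (v i)) x)"
  proof (rule sum.cong[OF refl])
    fix i
    have "pd i (pd i (v j)) x = pd i (pd j (v i)) x"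
      by (rule pd_cong[OF open_ball x sym])
    also have "\<dots> = pd j (pd i (v i)) x" by (rule smooth_pd_commute[OF open_ball smooth x])
    finally show "pd i (pd i (v j)) x = pd j (pd i (v i)) x" .
  qed
  also have "\<dots> = pd j (\<lambda>x. \<Sum>i\<in>UNIV. pd i (v i) x) x"
    by (rule pd_sum[symmetric]) (use C1_differentiable[OF smooth_C1[OF smooth_pd[OF smooth]] x] in auto)
  also have "\<dots> = pd j (\<lambda>x. 0) x" by (rule pd_cong[OF open_ball x div])
  finally show "(\<Sum>i\<in>UNIV. pd i (pd i (v j)) x) = 0" by simp
qed (rule smooth)

lemma hom_sym: "pd i (hom n (v j)) x = pd j (hom n (v i)) x"
proof (cases n)
  case 0
  then show ?thesis by (simp add: pd_hom_0)
next
  case (Suc m)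
  have "hom m (pd i (v j)) x = hom m (pd j (v i)) x"
    by (rule hom_cong[of "ball 0 1"]) (auto intro: sym)
  then show ?thesis unfolding Suc by (simp only: pd_hom_Suc[OF open_ball _ smooth] centre_in_ball zero_less_one)
qed

lemma hom_div: "(\<Sum>i\<in>UNIV. pd i (hom n (v i)) x) = 0"
proof (cases n)
  case 0
  then show ?thesis by (simp add: pd_hom_0)
next
  case (Suc m)
  have "(\<Sum>i\<in>UNIV. hom m (pd i (v i)) x) = 0"
    by (rule hom_sum_eq_0[of "ball 0 1"]) (auto intro: smooth_pd smooth div)
  then show ?thesis unfolding Suc by (simp only: pd_hom_Suc[OF open_ball _ smooth] centre_in_ball zero_less_one)
qed

lemma hom_euler: "(\<Sum>i\<in>UNIV. x$i * pd i (hom n (v j)) x) = n * hom n (v j) x"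
  by (rule euler_hom[OF open_ball _ smooth]) simp

text \<open>The minus sign makes \<open>W n\<close> holomorphic in \<open>zc x\<close> when the
  first component vanishes, as for \<open>phi_x - i phi_y\<close> with \<open>phi\<close> harmonic
  in the plane.\<close>

definition W :: "nat \<Rightarrow> real^3 \<Rightarrow> complex" where
  "W n x = Complex (hom n (v 2) x) (- hom n (v 3) x)"

end

text \<open>The two parts of \<open>orth\<close> say that the integral of \<open>W n y\<close> times
  the conjugate of \<open>zc y ^ n\<close> has real and imaginary part zero. They concern the parts
  of degree \<open>n\<close>; \<open>hom_moment\<close> derives them from the orthogonality of
  \<open>f\<close>.\<close>

locale riesz_ball = riesz_unit v for v +
  fixes S :: real
  assumes bound: "\<And>y. y \<in> ball 0 1 \<Longrightarrow> \<bar>v 1 y - v 1 0\<bar> \<le> S"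
    and orth: "\<And>n. n \<ge> 1 \<Longrightarrow> bint 1 (\<lambda>y. hom n (v 2) y * Rz 1 n y - hom n (v 3) y * Rz (- \<i>) n y) = 0"
      "\<And>n. n \<ge> 1 \<Longrightarrow> bint 1 (\<lambda>y. hom n (v 2) y * Rz (- \<i>) n y + hom n (v 3) y * Rz 1 n y) = 0"
begin

text \<open>By \<open>mode_hom\<close> the sum is \<open>c * zc x ^ n\<close>. Paired with
  \<open>zc y ^ n\<close>, every rotated copy has the same integral as \<open>W n\<close>, which is
  zero by \<open>orth\<close>, while together they give \<open>c\<close> times the positive integral
  of \<open>cmod (zc y) ^ (2 n)\<close>.\<close>

lemma sum_rot_W:
  assumes n: "n \<ge> 1"
  shows "(\<Sum>k<2 * n + 1. cis (- (real n * angle n k)) * W n (rot (angle n k) x)) = 0"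
proof -
  obtain c2 where c2: "\<And>x. mode n n (hom n (v 2)) x = c2 * zc x ^ n"
    using mode_hom[OF order_refl, of n "v 2"] by blast
  obtain c3 where c3: "\<And>x. mode n n (hom n (v 3)) x = c3 * zc x ^ n"
    using mode_hom[OF order_refl, of n "v 3"] by blast
  define c where "c = c2 - \<i> * c3"
  have m: "(\<Sum>k<2 * n + 1. cis (- (real n * angle n k)) * W n (rot (angle n k) x)) = c * zc x ^ n" for x
  proof -
    have W: "W n y = of_real (hom n (v 2) y) - \<i> * of_real (hom n (v 3) y)" for y
      by (simp add: W_def complex_eq_iff del: hom.simps)
    have "(\<Sum>k<2 * n + 1. cis (- (real n * angle n k)) * W n (rot (angle n k) x))
       = mode n n (hom n (v 2)) x - \<i> * mode n n (hom n (v 3)) x"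
      unfolding W mode_def right_diff_distrib sum_subtractf sum_distrib_left by (simp only: mult_ac)
    then show ?thesis by (simp add: c2 c3 c_def algebra_simps del: hom.simps)
  qed
  let ?F = "\<lambda>y. W n y * cnj (zc y ^ n)"
  have F: "Re (?F y) = hom n (v 2) y * Rz 1 n y - hom n (v 3) y * Rz (- \<i>) n y"
    "- Im (?F y) = hom n (v 2) y * Rz (- \<i>) n y + hom n (v 3) y * Rz 1 n y" for y
    by (simp_all add: W_def Rz_def del: hom.simps complex_cnj_power)
  have rF: "(\<Sum>k<2 * n + 1. ?F (rot (angle n k) y)) = c * of_real (cmod (zc y) ^ (2 * n))" for y
  proof -
    have "?F (rot t y) = (cis (- (real n * t)) * W n (rot t y)) * cnj (zc y ^ n)" for t
      by (simp add: zc_rot power_mult_distrib cis_cnj Complex.DeMoivre mult_ac)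
    then have "(\<Sum>k<2 * n + 1. ?F (rot (angle n k) y)) = c * zc y ^ n * cnj (zc y ^ n)"
      by (simp only: sum_distrib_right[symmetric] m)
    also have "\<dots> = c * of_real ((cmod (zc y ^ n))\<^sup>2)"
      by (simp only: mult.assoc complex_norm_square)
    also have "(cmod (zc y ^ n))\<^sup>2 = cmod (zc y) ^ (2 * n)"
      by (simp add: norm_power power_mult[symmetric] mult.commute)
    finally show ?thesis .
  qed
  have cont: "continuous_on S (\<lambda>y. g (?F y))" if "bounded_linear g" for g :: "complex \<Rightarrow> real" and S
  proof -
    have W: "W n = (\<lambda>y. of_real (hom n (v 2) y) - \<i> * of_real (hom n (v 3) y))"
      by (auto simp: W_def complex_eq_iff simp del: hom.simps)
    show ?thesis unfolding W
      by (intro bounded_linear.continuous_on[OF that] continuous_intros comp.hom_cont linear_continuous_on zc_linear)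
  qed
  \<comment> \<open>Used with \<open>Re\<close> and \<open>Im\<close> for \<open>g\<close>, since
    \<open>bint\<close> integrates real functions.\<close>
  have z: "g c * bint 1 (\<lambda>y. cmod (zc y) ^ (2 * n)) = 0"
    if g: "bounded_linear g" "bint 1 (\<lambda>y. g (?F y)) = 0" "\<And>a r. g (a * of_real r) = g a * r" for g
  proof -
    have "0 = (\<Sum>k<2 * n + 1. bint 1 (\<lambda>y. g (?F (rot (angle n k) y))))"
      using bint_rotate[OF rot_orthogonal cont[OF g(1)]] g(2) by simp
    also have "\<dots> = bint 1 (\<lambda>y. \<Sum>k<2 * n + 1. g (?F (rot (angle n k) y)))"
    proof (rule bint_sum[symmetric])
      have cr: "continuous_on UNIV (rot t)" for t
        using rot_orthogonal by (intro linear_continuous_on linear_conv_bounded_linear[THEN iffD1])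
          (auto simp: orthogonal_transformation_linear)
      show "continuous_on (cball 0 1) (\<lambda>y. g (?F (rot (angle n k) y)))" for k
        using continuous_on_compose2[OF cont[OF g(1), of UNIV] continuous_on_subset[OF cr]] by auto
    qed simp
    also have "\<dots> = bint 1 (\<lambda>y. g c * cmod (zc y) ^ (2 * n))"
    proof (rule bint_cong)
      fix y
      have "(\<Sum>k<2 * n + 1. g (?F (rot (angle n k) y))) = g (\<Sum>k<2 * n + 1. ?F (rot (angle n k) y))"
        by (rule linear_sum[symmetric, OF bounded_linear.linear[OF g(1)]])
      then show "(\<Sum>k<2 * n + 1. g (?F (rot (angle n k) y))) = g c * cmod (zc y) ^ (2 * n)"
        unfolding rF g(3) .
    qed
    finally show ?thesis by (simp only: bint_cmult)
  qed
  have "Re c = 0"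
    using z[of Re] bint_zc_power_pos[of n] orth(1)[OF n] unfolding F by (simp add: bounded_linear_Re)
  moreover have "Im c = 0"
  proof -
    have "bint 1 (\<lambda>y. Im (?F y)) = (- 1) * bint 1 (\<lambda>y. - Im (?F y))"
      unfolding bint_cmult[symmetric] by (simp only: mult_minus1 minus_minus)
    also have "\<dots> = 0" unfolding F using orth(2)[OF n] by simp
    finally show ?thesis using z[of Im] bint_zc_power_pos[of n] by (simp add: bounded_linear_Im)
  qed
  ultimately have "c = 0" by (simp add: complex_eq_iff)
  then show ?thesis using m by simp
qed

text \<open>For a homogeneous Riesz system of degree \<open>n\<close>, \<open>\<partial>W/\<partial>\<theta> - i n W\<close> is a combination of tangential
  derivatives of the first component.\<close>

lemma W_bound:
  assumes n: "n \<ge> 1" and x: "norm x = 1" and G: "G \<ge> 0"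
    and grad: "\<And>y. norm y = 1 \<Longrightarrow> (\<Sum>i\<in>UNIV. (pd i (hom n (v 1)) y)\<^sup>2) \<le> G\<^sup>2"
  shows "cmod (W n x) \<le> G * (pi / 2)"
proof -
  define \<Lambda> where "\<Lambda> \<theta> = cis (- (real n * \<theta>)) * W n (rot \<theta> x)" for \<theta>
  let ?d = "\<lambda>j \<theta>. - rot \<theta> x $ 3 * pd 2 (hom n (v j)) (rot \<theta> x) + rot \<theta> x $ 2 * pd 3 (hom n (v j)) (rot \<theta> x)"
  define D where "D \<theta> = cis (- (real n * \<theta>)) * Complex (?d 2 \<theta>) (- ?d 3 \<theta>)
      + (- \<i> * of_nat n * cis (- (real n * \<theta>))) * W n (rot \<theta> x)" for \<theta>
  have hd: "((\<lambda>\<theta>. hom n (v j) (rot \<theta> x)) has_real_derivative ?d j \<theta>) (at \<theta>)" for j \<theta>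
    using C1_curve[where h="hom n (v j)" and \<gamma>="\<lambda>\<theta>. rot \<theta> x" and t=\<theta> and T=UNIV,
        OF harmonic_C1[OF comp.hom_harm] _ rot_has_vector_derivative]
    by (simp add: sum_3 del: hom.simps rot_nth)
  have der: "(\<Lambda> has_vector_derivative D \<theta>) (at \<theta>)" for \<theta>
  proof -
    have "((\<lambda>\<theta>. W n (rot \<theta> x)) has_vector_derivative Complex (?d 2 \<theta>) (- ?d 3 \<theta>)) (at \<theta>)"
      unfolding has_vector_derivative_complex_iff W_def complex.sel
      using hd[of 2] DERIV_minus[OF hd[of 3]] by blast
    moreover have "((\<lambda>\<theta>. cis (- (real n * \<theta>))) has_vector_derivative (- \<i> * of_nat n * cis (- (real n * \<theta>)))) (at \<theta>)"
      unfolding has_vector_derivative_complex_iff by (auto intro!: derivative_eq_intros)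
    ultimately show ?thesis unfolding \<Lambda>_def D_def by (intro has_vector_derivative_mult)
  qed
  have D: "cmod (D \<theta>) \<le> G" for \<theta>
  proof -
    let ?y = "rot \<theta> x"
    let ?a = "\<lambda>j. hom n (v j) ?y" and ?p = "\<lambda>i j. pd i (hom n (v j)) ?y"
    have "D \<theta> = (Complex (?d 2 \<theta>) (- ?d 3 \<theta>) - \<i> * of_nat n * W n ?y) * cis (- (real n * \<theta>))"
      by (simp add: D_def algebra_simps)
    then have "cmod (D \<theta>) = cmod (Complex (?d 2 \<theta>) (- ?d 3 \<theta>) - \<i> * of_nat n * W n ?y)"
      by (simp add: norm_mult)
    also have "Complex (?d 2 \<theta>) (- ?d 3 \<theta>) - \<i> * of_nat n * W n ?y = Complex (?d 2 \<theta> - n * ?a 3) (- ?d 3 \<theta> - n * ?a 2)"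
      by (simp add: W_def complex_eq_iff del: hom.simps rot_nth)
    \<comment> \<open>Zero trace replaces the second and third diagonal derivatives by the first;
      symmetry cancels one mixed term and turns the other into a derivative of the first
      component.\<close>
    also have "?d 2 \<theta> - n * ?a 3 = ?y$3 * ?p 1 1 - ?y$1 * ?p 3 1"
      unfolding hom_euler[symmetric] using hom_div[of n ?y] hom_sym[of 3 n 2 ?y] hom_sym[of 1 n 3 ?y]
      by (simp add: sum_3 algebra_simps del: hom.simps rot_nth) (smt (verit) distrib_left mult_minus_right)
    also have "- ?d 3 \<theta> - n * ?a 2 = ?y$2 * ?p 1 1 - ?y$1 * ?p 2 1"
      unfolding hom_euler[symmetric] using hom_div[of n ?y] hom_sym[of 3 n 2 ?y] hom_sym[of 1 n 2 ?y]
      by (simp add: sum_3 algebra_simps del: hom.simps rot_nth) (smt (verit) distrib_left mult_minus_right)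
    finally have "(cmod (D \<theta>))\<^sup>2 = (?y$3 * ?p 1 1 - ?y$1 * ?p 3 1)\<^sup>2 + (?y$2 * ?p 1 1 - ?y$1 * ?p 2 1)\<^sup>2"
      by (simp only: cmod_power2 complex.sel)
    also have "\<dots> \<le> ((?y$1)\<^sup>2 + (?y$2)\<^sup>2 + (?y$3)\<^sup>2) * ((?p 1 1)\<^sup>2 + (?p 2 1)\<^sup>2 + (?p 3 1)\<^sup>2)"
      by (rule cross_product_bound)
    also have "(?y$1)\<^sup>2 + (?y$2)\<^sup>2 + (?y$3)\<^sup>2 = (norm ?y)\<^sup>2"
      by (simp add: norm_vec_def L2_set_def sum_3 del: rot_nth)
    also have "(norm ?y)\<^sup>2 * ((?p 1 1)\<^sup>2 + (?p 2 1)\<^sup>2 + (?p 3 1)\<^sup>2) \<le> G\<^sup>2"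
      using grad[of ?y] x by (simp add: sum_3 del: hom.simps)
    finally show ?thesis by (rule power2_le_imp_le[OF _ G])
  qed
  have lip: "cmod (\<Lambda> 0 - \<Lambda> t) \<le> G * \<bar>t\<bar>" for t
  proof -
    have "norm (\<Lambda> 0 - \<Lambda> t) \<le> G * norm (0 - t)"
    proof (rule differentiable_bound[where S=UNIV and f'="\<lambda>\<theta> h. h *\<^sub>R D \<theta>"])
      show "(\<Lambda> has_derivative (\<lambda>h. h *\<^sub>R D \<theta>)) (at \<theta> within UNIV)" for \<theta>
        using der[of \<theta>] by (simp add: has_vector_derivative_def)
      show "onorm (\<lambda>h. h *\<^sub>R D \<theta>) \<le> G" for \<theta>
      proof (rule onorm_le)
        show "norm (h *\<^sub>R D \<theta>) \<le> G * norm h" for h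
          using mult_right_mono[OF D[of \<theta>], of "norm h"] by (simp add: mult.commute)
      qed
    qed auto
    then show ?thesis by simp
  qed
  let ?N = "2 * n + 1"
  \<comment> \<open>The rotated values sum to zero, so the value at \<open>0\<close> is the mean of
    its differences to them.\<close>
  have "of_nat ?N * \<Lambda> 0 = (\<Sum>k<?N. \<Lambda> 0 - \<Lambda> (angle n k))"
    unfolding sum_subtractf using sum_rot_W[OF n, of x] by (simp add: \<Lambda>_def)
  moreover have "cmod (of_nat ?N * \<Lambda> 0) = real ?N * cmod (\<Lambda> 0)"
    by (simp only: norm_mult norm_of_nat)
  ultimately have "real ?N * cmod (\<Lambda> 0) = cmod (\<Sum>k<?N. \<Lambda> 0 - \<Lambda> (angle n k))"
    by (simp only:)
  also have "\<dots> \<le> (\<Sum>k<?N. G * \<bar>angle n k\<bar>)"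
    by (rule order_trans[OF norm_sum sum_mono[OF lip]])
  also have "\<dots> = G * (\<Sum>k<?N. \<bar>angle n k\<bar>)" by (simp only: sum_distrib_left)
  also have "\<dots> \<le> G * (real ?N * (pi / 2))"
    by (rule mult_left_mono[OF sum_abs_angle G])
  also have "\<dots> = real ?N * (G * (pi / 2))" by (simp only: mult_ac)
  finally have "real ?N * cmod (\<Lambda> 0) \<le> real ?N * (G * (pi / 2))" .
  moreover have N0: "0 < real ?N" by simp
  ultimately have "cmod (\<Lambda> 0) \<le> G * (pi / 2)" by (simp only: mult_le_cancel_left_pos[OF N0])
  then show ?thesis by (simp add: \<Lambda>_def)
qed

text \<open>One gradient bound \<open>G\<close>, taken at \<open>delta = 2 / n\<close>, controls all
  components: Euler's identity bounds the first by \<open>G / n\<close>, and \<open>W_bound\<close>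
  bounds the other two together by \<open>G pi / 2\<close>.\<close>

lemma hom_vector_bound:
  assumes n: "n \<ge> 1" and x: "norm x = 1"
  shows "norm (\<chi> j. hom n (v j) x) \<le> sqrt (2/3) * ((2 * real n + 1) * (real n + 1) * (real n + 2)) * S"
proof -
  have S0: "S \<ge> 0" using bound[of 0] by simp
  define M where "M = 15 * (1 + 2 / real n) ^ (2 * n + 3) / ((2 / real n)^5 * real (2 * n + 3))"
  have M0: "M \<ge> 0" by (simp add: M_def)
  define G where "G = sqrt M * S"
  have G: "G \<ge> 0" "G\<^sup>2 = M * S\<^sup>2" using M0 S0 by (auto simp: G_def power_mult_distrib)
  have grad: "(\<Sum>i\<in>UNIV. (pd i (hom n (v 1)) y)\<^sup>2) \<le> G\<^sup>2" if "norm y = 1" for y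
  proof -
    have "0 < (2 / real n)^5 * real (2 * n + 3)" using n by simp
    then show ?thesis
      unfolding G(2) M_def using comp.hom_gradient_bound[OF bound n that, of "2 / real n"] n
      by (simp add: pos_le_divide_eq mult.assoc)
  qed
  have w: "(cmod (W n x))\<^sup>2 \<le> G\<^sup>2 * (pi\<^sup>2 / 4)"
    using power_mono[OF W_bound[OF n x G(1) grad], of 2] by (simp add: power_mult_distrib power_divide)
  have "(real n * hom n (v 1) x)\<^sup>2 = (x \<bullet> (\<chi> i. pd i (hom n (v 1)) x))\<^sup>2"
    unfolding hom_euler[symmetric] inner_vec_def by simp
  also have "\<dots> \<le> (x \<bullet> x) * ((\<chi> i. pd i (hom n (v 1)) x) \<bullet> (\<chi> i. pd i (hom n (v 1)) x))"
    by (rule Cauchy_Schwarz_ineq)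
  also have "(\<chi> i. pd i (hom n (v 1)) x) \<bullet> (\<chi> i. pd i (hom n (v 1)) x) = (\<Sum>i\<in>UNIV. (pd i (hom n (v 1)) x)\<^sup>2)"
    by (simp add: inner_vec_def power2_eq_square)
  also have "(x \<bullet> x) * \<dots> \<le> G\<^sup>2"
    using grad[OF x] x by (simp add: norm_eq_1)
  finally have a: "(hom n (v 1) x)\<^sup>2 \<le> G\<^sup>2 * (1 / (real n)\<^sup>2)"
    using n by (simp add: power_mult_distrib field_simps del: hom.simps)
  have "(norm (\<chi> j. hom n (v j) x))\<^sup>2 = (hom n (v 1) x)\<^sup>2 + (cmod (W n x))\<^sup>2"
    by (simp add: norm_vec_def L2_set_def sum_3 W_def cmod_power2 del: hom.simps)
  also have "\<dots> \<le> G\<^sup>2 * (1 / (real n)\<^sup>2) + G\<^sup>2 * (pi\<^sup>2 / 4)" by (rule add_mono[OF a w])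
  also have "\<dots> = ((1 / (real n)\<^sup>2 + pi\<^sup>2 / 4) * M) * S\<^sup>2" unfolding G(2) by (simp add: algebra_simps)
  also have "\<dots> \<le> (2 / 3 * ((2 * real n + 1) * (real n + 1) * (real n + 2))\<^sup>2) * S\<^sup>2"
    unfolding M_def by (rule mult_right_mono[OF degree_constant_bound[OF n]]) simp
  also have "\<dots> = (sqrt (2/3) * ((2 * real n + 1) * (real n + 1) * (real n + 2)) * S)\<^sup>2"
    by (simp add: power_mult_distrib)
  finally show ?thesis by (rule power2_le_imp_le) (use S0 in simp)
qed

text \<open>The part of degree zero is \<open>v j 0\<close>, so the difference is the sum of the
  degrees \<open>1\<close> to \<open>N\<close> plus a remainder that tends to zero with
  \<open>N\<close>.\<close>

theorem unit_ball_bound: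
  assumes x: "norm x < 1"
  shows "norm (\<chi> j. v j x - v j 0)
     \<le> sqrt (2/3) * (2 * norm x * ((3 - norm x) * (3 - norm x + (norm x)\<^sup>2)) / (1 - norm x)^4) * S"
proof -
  let ?c = "\<lambda>n. (2 * real n + 1) * (real n + 1) * (real n + 2)"
  let ?B = "2 * norm x * ((3 - norm x) * (3 - norm x + (norm x)\<^sup>2)) / (1 - norm x)^4"
  have S0: "S \<ge> 0" using bound[of 0] by simp
  have h: "norm (\<chi> j. hom n (v j) x) \<le> (sqrt (2/3) * S) * (?c n * norm x ^ n)" if n: "n \<ge> 1" for n
  proof (cases "x = 0")
    case True
    have "hom n (v j) x = 0" for j
    proof -
      have "(0::real) ^ n = 0" using n by simp
      then show ?thesis using hom_scale[of n "v j" 0 x] True by (simp only: scaleR_zero_left mult_zero_left)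
    qed
    then have "(\<chi> j. hom n (v j) x) = 0" by (simp add: vec_eq_iff del: hom.simps)
    then show ?thesis using S0 by simp
  next
    case False
    define e where "e = (1 / norm x) *\<^sub>R x"
    have e: "norm e = 1" "x = norm x *\<^sub>R e" using False by (auto simp: e_def)
    have "hom n (v j) x = norm x ^ n * hom n (v j) e" for j
      using hom_scale[of n "v j" "norm x" e] e(2) by metis
    then have "(\<chi> j. hom n (v j) x) = norm x ^ n *\<^sub>R (\<chi> j. hom n (v j) e)"
      by (simp add: vec_eq_iff del: hom.simps)
    then have "norm (\<chi> j. hom n (v j) x) = norm x ^ n * norm (\<chi> j. hom n (v j) e)" by simp
    also have "\<dots> \<le> norm x ^ n * (sqrt (2/3) * ?c n * S)"
      by (rule mult_left_mono[OF hom_vector_bound[OF n e(1)]]) simp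
    finally show ?thesis by (simp only: mult_ac)
  qed
  have le: "norm (\<chi> j. v j x - v j 0) \<le> sqrt (2/3) * ?B * S + norm (\<chi> j. comp.rem j N x)" for N
  proof -
    have "v j x - v j 0 = (\<Sum>n=1..N. hom n (v j) x) + comp.rem j N x" for j
    proof -
      have "(\<Sum>n\<le>N. hom n (v j) x) = v j 0 + (\<Sum>n=1..N. hom n (v j) x)"
        by (simp add: atMost_atLeast0 sum.atLeast_Suc_atMost)
      then show ?thesis by (simp add: comp.rem_def del: hom.simps)
    qed
    then have "(\<chi> j. v j x - v j 0) = (\<Sum>n=1..N. (\<chi> j. hom n (v j) x)) + (\<chi> j. comp.rem j N x)"
      by (simp add: vec_eq_iff del: hom.simps)
    then have "norm (\<chi> j. v j x - v j 0) \<le> norm (\<Sum>n=1..N. (\<chi> j. hom n (v j) x)) + norm (\<chi> j. comp.rem j N x)"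
      by (simp only: norm_triangle_ineq)
    also have "norm (\<Sum>n=1..N. (\<chi> j. hom n (v j) x)) \<le> (\<Sum>n=1..N. (sqrt (2/3) * S) * (?c n * norm x ^ n))"
      by (rule order_trans[OF norm_sum sum_mono[OF h]]) simp
    also have "\<dots> = (sqrt (2/3) * S) * (\<Sum>n=1..N. ?c n * norm x ^ n)"
      by (simp only: sum_distrib_left)
    also have "\<dots> \<le> (sqrt (2/3) * S) * ?B"
      by (rule mult_left_mono[OF degree_constant_sum]) (use x S0 in auto)
    finally show ?thesis by (simp add: mult_ac)
  qed
  have z: "(\<lambda>N. \<chi> j. comp.rem j N x) \<longlonglongrightarrow> (0 :: real^3)"
  proof (rule vec_tendstoI)
    show "(\<lambda>N. (\<chi> j. comp.rem j N x) $ i) \<longlonglongrightarrow> (0 :: real^3) $ i" for i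
      using comp.hom_series[OF x, of i] by simp
  qed
  have lim: "(\<lambda>N. sqrt (2/3) * ?B * S + norm (\<chi> j. comp.rem j N x)) \<longlonglongrightarrow> sqrt (2/3) * ?B * S + norm (0 :: real^3)"
    by (intro tendsto_add tendsto_const tendsto_norm z)
  have "norm (\<chi> j. v j x - v j 0) \<le> sqrt (2/3) * ?B * S + norm (0 :: real^3)"
    by (rule tendsto_lowerbound[OF lim always_eventually]) (use le in simp_all)
  then show ?thesis by simp
qed

end

section \<open>Monogenic functions\<close>

lemma chebT_cos: "chebT n (cos t) = cos (real n * t)"
proof (induction n rule: induct_nat_012)
  case (ge2 n)
  have "cos (real (Suc (Suc n)) * t) = 2 * cos t * cos (real (Suc n) * t) - cos (real n * t)"
  proof -
    have "cos (real (Suc n) * t + t) + cos (real (Suc n) * t - t) = 2 * cos (real (Suc n) * t) * cos t"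
      unfolding cos_add cos_diff by simp
    moreover have "real (Suc n) * t + t = real (Suc (Suc n)) * t" "real (Suc n) * t - t = real n * t"
      by (simp_all add: algebra_simps)
    ultimately have "cos (real (Suc (Suc n)) * t) + cos (real n * t) = 2 * cos (real (Suc n) * t) * cos t"
      by (simp only:)
    moreover have "a + b = 2 * z * w \<Longrightarrow> a = 2 * w * z - b" for a b z w :: real by (simp add: mult_ac)
    ultimately show ?thesis by blast
  qed
  with ge2 show ?case by simp
qed auto

lemma chebU_sin: "sin t * chebU n (cos t) = sin (real (Suc n) * t)"
proof (induction n rule: induct_nat_012)
  case 1
  then show ?case by (simp add: sin_double)
next
  case (ge2 n)
  have "sin (real (Suc (Suc (Suc n))) * t) = 2 * cos t * sin (real (Suc (Suc n)) * t) - sin (real (Suc n) * t)"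
  proof -
    have "sin (real (Suc (Suc n)) * t + t) + sin (real (Suc (Suc n)) * t - t) = 2 * sin (real (Suc (Suc n)) * t) * cos t"
      unfolding sin_add sin_diff by simp
    moreover have "real (Suc (Suc n)) * t + t = real (Suc (Suc (Suc n))) * t" "real (Suc (Suc n)) * t - t = real (Suc n) * t"
      by (simp_all add: algebra_simps)
    ultimately have "sin (real (Suc (Suc (Suc n))) * t) + sin (real (Suc n) * t) = 2 * sin (real (Suc (Suc n)) * t) * cos t"
      by (simp only:)
    moreover have "a + b = 2 * z * w \<Longrightarrow> a = 2 * w * z - b" for a b z w :: real by (simp add: mult_ac)
    ultimately show ?thesis by blast
  qed
  moreover have "sin t * chebU (Suc (Suc n)) (cos t) = 2 * cos t * (sin t * chebU (Suc n) (cos t)) - sin t * chebU n (cos t)"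
    by (simp add: algebra_simps)
  ultimately show ?case using ge2 by simp
qed auto

text \<open>In total \<open>2 m\<close> derivatives fall on the monic polynomial
  \<open>(t^2 - 1)^m\<close> of degree \<open>2 m\<close>, which leaves a positive constant.\<close>

lemma higher_pderiv_legendre:
  obtains \<kappa> where "\<kappa> > 0" "\<And>t. poly ((pderiv ^^ m) (legendre m)) t = \<kappa>"
proof -
  let ?q = "[:-1, 0, 1:] ^ m :: real poly" and ?p = "(pderiv ^^ m) (legendre m)"
  have "lead_coeff ?q = (lead_coeff [:-1, 0, 1:]) ^ m" by (rule lead_coeff_power)
  then have dq: "degree ?q = 2 * m" "lead_coeff ?q = 1"
    by (simp_all add: degree_power_eq)
  have c: "coeff ?p i = pochhammer (of_nat (Suc i)) m * (1 / (2 ^ m * fact m) *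
      (pochhammer (of_nat (Suc (i + m))) m * coeff ?q (i + m + m)))" for i
    by (simp add: coeff_higher_pderiv legendre_def)
  have "?p = [:coeff ?p 0:]"
  proof (rule poly_eqI)
    fix i
    show "coeff ?p i = coeff [:coeff ?p 0:] i"
    proof (cases i)
      case (Suc j)
      have "coeff ?q (i + m + m) = 0"
        by (rule coeff_eq_0) (simp add: dq Suc)
      then show ?thesis using Suc c[of i] by simp
    qed simp
  qed
  then have p: "poly ?p t = coeff ?p 0" for t
    by (metis mult_zero_right poly_0 poly_pCons add.right_neutral)
  have "coeff ?q (0 + m + m) = 1" using dq by (metis add_0 mult_2)
  then have "coeff ?p 0 > 0"
    unfolding c by (simp add: pochhammer_pos del: of_nat_Suc)
  with p that show ?thesis by blast
qed

text \<open>The sine of \<open>theta1 y\<close> is \<open>cmod (zc y) / norm y\<close>, and its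
  \<open>m\<close>-th power is the factor \<open>(1 - t^2)^(m/2)\<close>. \<open>m >= 1\<close>
  settles the degenerate points: the origin, where the angle is a default value, and the axis, where
  \<open>0 powr a\<close> is \<open>0\<close>.\<close>

lemma norm_power_legendre:
  assumes m: "m \<ge> 1" and \<kappa>: "\<And>t. poly ((pderiv ^^ m) (legendre m)) t = \<kappa>"
  shows "norm y ^ m * assoc_legendre m m (cos (theta1 y)) = \<kappa> * cmod (zc y) ^ m"
proof (cases "y = 0")
  case True
  have "zc 0 = 0" by (simp add: zc_def complex_eq_iff)
  with True m show ?thesis by (cases m) simp_all
next
  case False
  define t where "t = y$1 / norm y"
  have "\<bar>y$1\<bar> \<le> norm y" by (rule component_le_norm_cart)
  then have t: "-1 \<le> t" "t \<le> 1" using False by (auto simp: t_def field_simps abs_le_iff)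
  define w where "w = cmod (zc y) / norm y"
  have w0: "w \<ge> 0" by (simp add: w_def)
  have "(norm y)\<^sup>2 = (y$1)\<^sup>2 + (cmod (zc y))\<^sup>2"
    by (simp add: norm_vec_def L2_set_def sum_3 cmod_power2 zc_def)
  then have "(cmod (zc y))\<^sup>2 = (norm y)\<^sup>2 - (y$1)\<^sup>2" by simp
  then have "1 - t\<^sup>2 = w\<^sup>2" using False by (simp add: t_def w_def power_divide diff_divide_distrib)
  moreover have "(w\<^sup>2) powr (real m / 2) = w ^ m"
  proof (cases "w = 0")
    case False
    with w0 have "w > 0" by simp
    then have "(w\<^sup>2) powr (real m / 2) = (w powr 2) powr (real m / 2)" by simp
    also have "\<dots> = w powr real m" by (simp add: powr_powr)
    also have "\<dots> = w ^ m" using \<open>w > 0\<close> by (simp add: powr_realpow)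
    finally show ?thesis .
  qed (use m in simp)
  ultimately have "assoc_legendre m m (cos (theta1 y)) = w ^ m * \<kappa>"
    using t by (simp add: assoc_legendre_def \<kappa> theta1_def t_def[symmetric])
  then show ?thesis using False by (simp add: w_def power_divide)
qed

lemma zc_polar:
  "cmod (zc y) ^ m * cos (real m * theta2 y) = Rz 1 m y"
  "cmod (zc y) ^ m * sin (real m * theta2 y) = Rz (- \<i>) m y"
proof -
  have "zc y = of_real (cmod (zc y)) * cis (theta2 y)"
    using rcis_cmod_Arg[of "zc y"] by (simp add: rcis_def theta2_def zc_def)
  then have "zc y ^ m = of_real (cmod (zc y) ^ m) * cis (real m * theta2 y)"
    by (metis Complex.DeMoivre of_real_power power_mult_distrib)
  then show "cmod (zc y) ^ m * cos (real m * theta2 y) = Rz 1 m y"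
    "cmod (zc y) ^ m * sin (real m * theta2 y) = Rz (- \<i>) m y"
    by (simp_all add: Rz_def)
qed

text \<open>The identities hold at every point, including those where the spherical coordinates take
  default values, so they can be differentiated everywhere.\<close>

lemma solid_harmonics:
  obtains \<kappa> where "\<kappa> > 0"
    "\<And>y. norm y ^ (n+1) * UU n y = \<kappa> * Rz 1 (n+1) y"
    "\<And>y. norm y ^ (n+1) * VV n y = \<kappa> * Rz (- \<i>) (n+1) y"
proof -
  obtain \<kappa> where \<kappa>: "\<kappa> > 0" "\<And>t. poly ((pderiv ^^ (n+1)) (legendre (n+1))) t = \<kappa>"
    using higher_pderiv_legendre by blast
  note L = norm_power_legendre[of "n+1", OF _ \<kappa>(2)]
  have "norm y ^ (n+1) * UU n y = \<kappa> * Rz 1 (n+1) y" for y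
  proof -
    have "norm y ^ (n+1) * UU n y
       = (norm y ^ (n+1) * assoc_legendre (n+1) (n+1) (cos (theta1 y))) * cos (real (n+1) * theta2 y)"
      unfolding UU_def chebT_cos by (simp only: mult.assoc)
    then show ?thesis using zc_polar(1)[of y "n+1"] L[of y] by (simp only: mult.assoc)
  qed
  moreover have "norm y ^ (n+1) * VV n y = \<kappa> * Rz (- \<i>) (n+1) y" for y
  proof -
    have "norm y ^ (n+1) * VV n y
       = (norm y ^ (n+1) * assoc_legendre (n+1) (n+1) (cos (theta1 y))) * (sin (theta2 y) * chebU n (cos (theta2 y)))"
      unfolding VV_def by (simp only: mult.assoc)
    also have "sin (theta2 y) * chebU n (cos (theta2 y)) = sin (real (n+1) * theta2 y)"
      by (simp only: chebU_sin Suc_eq_plus1)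
    finally show ?thesis using zc_polar(2)[of y "n+1"] L[of y] by (simp only: mult.assoc)
  qed
  ultimately show ?thesis using that \<kappa>(1) by blast
qed

section \<open>Components of quaternion-valued functions\<close>

lemma Q_nth [simp]: "Q a b c d $ 1 = a" "Q a b c d $ 2 = b" "Q a b c d $ 3 = c" "Q a b c d $ 4 = d"
  by (simp_all add: Q_def)

lemma partial_nth:
  assumes "f differentiable (at x)"
  shows "partial i f x $ k = pd i (\<lambda>x. f x $ k) x" "(\<lambda>x. f x $ k) differentiable (at x)"
proof -
  have "(f has_derivative frechet_derivative f (at x)) (at x)"
    using assms frechet_derivative_works by blast
  then have D: "((\<lambda>x. f x $ k) has_derivative (\<lambda>v. frechet_derivative f (at x) v $ k)) (at x)"
    by (rule bounded_linear.has_derivative[OF bounded_linear_vec_nth])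
  then show "(\<lambda>x. f x $ k) differentiable (at x)" by (auto simp: differentiable_def)
  show "partial i f x $ k = pd i (\<lambda>x. f x $ k) x"
    using pd_eqI[OF D] by (simp add: partial_def)
qed

lemma qreal_differentiable:
  assumes "u differentiable (at x)"
  shows "(\<lambda>y. qreal (u y)) differentiable (at x)"
proof -
  have "bounded_linear qreal"
    unfolding linear_conv_bounded_linear[symmetric]
    by (rule linearI) (simp_all add: vec_eq_iff forall_4 qreal_def)
  then show ?thesis
    using assms bounded_linear.has_derivative unfolding differentiable_def by blast
qed

lemma Dbar_qreal:
  assumes "u differentiable (at x)"
  shows "Dbar (\<lambda>y. qreal (u y)) x = Q (pd 1 u x) (- pd 2 u x) (- pd 3 u x) 0"
  using partial_nth(1)[OF qreal_differentiable[OF assms]]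
  by (simp add: vec_eq_iff forall_4 Dbar_def qmult_def qe1_def qe2_def qreal_def)

text \<open>\<open>zc\<close> does not depend on \<open>x$1\<close>, so the scalar part vanishes and
  the other parts are derivatives of powers of \<open>zc\<close>. Of the common factor only its
  positivity is kept, which suffices for dividing it out of the orthogonality relations.\<close>

lemma hyperholomorphic_constants:
  obtains \<kappa> where "\<kappa> > 0"
    "\<And>x. Xdag n x = \<kappa> *\<^sub>R Q 0 (- Rz 1 n x) (Rz (- \<i>) n x) 0"
    "\<And>x. Ydag n x = \<kappa> *\<^sub>R Q 0 (- Rz (- \<i>) n x) (- Rz 1 n x) 0"
proof -
  obtain \<kappa> where \<kappa>: "\<kappa> > 0"
    "\<And>y. norm y ^ (n+1) * UU n y = \<kappa> * Rz 1 (n+1) y"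
    "\<And>y. norm y ^ (n+1) * VV n y = \<kappa> * Rz (- \<i>) (n+1) y"
    using solid_harmonics[of n] by blast
  have d: "Rz k m differentiable (at x)" for k m x
    using C1_differentiable[OF Rz_C1] by blast
  have d': "(\<lambda>y. \<kappa> * Rz k m y) differentiable (at x)" for k m x
    using C1_differentiable[OF C1_cmult[OF Rz_C1]] by blast
  have R0: "Rz 0 m x = 0" "Rz (a * of_nat (Suc n)) m x = Suc n * Rz a m x" "Rz (- a) m x = - Rz a m x" for a m x
    by (simp_all add: Rz_def algebra_simps)
  have p: "pd i (\<lambda>y. \<kappa> * Rz k (n+1) y) x = \<kappa> * Rz (k * of_nat (n+1) * zc (axis i 1)) n x" for i k x
    unfolding pd_cmult[OF d] pd_Rz by simp
  define K where "K = \<kappa> * real (Suc n) / 2"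
  have r: "Rz (k * of_nat (n+1) * \<i>) n x = Suc n * Rz (k * \<i>) n x" for k x
    using R0(2)[of "k * \<i>"] by (simp add: mult_ac)
  have "Xdag n x = K *\<^sub>R Q 0 (- Rz 1 n x) (Rz (- \<i>) n x) 0" for x
    unfolding Xdag_def \<kappa>(2) Dbar_qreal[OF d'] p zc_axis
    using R0(2)[of 1 n x] r[of 1 x] R0(3)[of \<i> n x]
    by (simp add: vec_eq_iff forall_4 K_def R0(1) field_simps del: of_nat_Suc)
  moreover have "Ydag n x = K *\<^sub>R Q 0 (- Rz (- \<i>) n x) (- Rz 1 n x) 0" for x
    unfolding Ydag_def \<kappa>(3) Dbar_qreal[OF d'] p zc_axis
    using R0(2)[of "- \<i>" n x] r[of "- \<i>" x]
    by (simp add: vec_eq_iff forall_4 K_def R0(1) field_simps del: of_nat_Suc)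
  moreover have "K > 0" using \<kappa>(1) by (simp add: K_def)
  ultimately show ?thesis using that by blast
qed

text \<open>Exhaustion by closed balls, on which \<open>bint\<close> is defined. The shift
  \<open>k + 2\<close> keeps every radius strictly between \<open>0\<close> and
  \<open>R\<close>.\<close>

lemma lint_cball_tendsto_ball:
  fixes G :: "real^3 \<Rightarrow> real"
  assumes R: "R > 0" and G: "set_integrable lborel (ball 0 R) G"
  shows "(\<lambda>k. bint (R * (1 - 1 / real (k + 2))) G) \<longlonglongrightarrow> (LINT x:ball 0 R|lborel. G x)"
proof -
  let ?c = "\<lambda>k. R * (1 - 1 / real (k + 2))"
  have "(\<Union>k. cball (0::real^3) (?c k)) = ball 0 R"
  proof (intro equalityI subsetI)
    fix x :: "real^3" assume "x \<in> (\<Union>k. cball 0 (?c k))"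
    then obtain k where "norm x \<le> ?c k" by auto
    also have "?c k < R" using R by (simp add: field_simps)
    finally show "x \<in> ball 0 R" by simp
  next
    fix x :: "real^3" assume x: "x \<in> ball 0 R"
    have "(\<lambda>k. 1 / real (k + 2)) \<longlonglongrightarrow> 0"
      using LIMSEQ_ignore_initial_segment[OF lim_1_over_n, of 2] by simp
    then have "?c \<longlonglongrightarrow> R * (1 - 0)" by (intro tendsto_intros)
    then have "\<forall>\<^sub>F k in sequentially. norm x < ?c k"
      using x by (intro order_tendstoD(1)) auto
    then obtain k where "norm x < ?c k" by (auto simp: eventually_sequentially)
    then show "x \<in> (\<Union>k. cball 0 (?c k))" by (auto intro: less_imp_le)
  qed
  moreover have "incseq (\<lambda>k. cball (0::real^3) (?c k))"
  proof (rule monoI)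
    fix k l :: nat assume "k \<le> l"
    then have "?c k \<le> ?c l" using R by (intro mult_left_mono diff_left_mono divide_left_mono) auto
    then show "cball (0::real^3) (?c k) \<subseteq> cball 0 (?c l)" by (rule subset_cball)
  qed
  ultimately show ?thesis
    using set_integral_cont_up[of "\<lambda>k. cball 0 (?c k)" lborel G] G by (simp add: bint_def)
qed

text \<open>At radius \<open>R c\<close> with \<open>c < 1\<close> the projection replaces each
  component by its part of degree \<open>n\<close>, and homogeneity makes the integral a multiple of
  \<open>c^(2 n + 3)\<close>. The limit \<open>c -> 1\<close> reaches the integral over the open
  ball.\<close>

lemma (in riesz_unit) hom_moment:
  assumes R: "R > 0" and G: "set_integrable lborel (ball 0 R) G"
    and Gv: "\<And>y. y \<in> ball 0 1 \<Longrightarrow> G (R *\<^sub>R y) = v 2 y * Rz a n y + v 3 y * Rz b n y"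
    and cG: "continuous_on (ball 0 R) G" and z: "(LINT x:ball 0 R|lborel. G x) = 0"
  shows "bint 1 (\<lambda>y. hom n (v 2) y * Rz a n y + hom n (v 3) y * Rz b n y) = 0"
proof -
  let ?H = "\<lambda>y. hom n (v 2) y * Rz a n y + hom n (v 3) y * Rz b n y"
  let ?A = "bint 1 ?H"
  have cH: "continuous_on S ?H" for S
    by (intro continuous_intros comp.hom_cont Rz_continuous)
  have e: "bint (R * c) G = R^3 * (c ^ (2 * n + 3) * ?A)" if c: "0 < c" "c < 1" for c
  proof -
    have "bint (R * c) G = R^3 * bint c (\<lambda>y. G (R *\<^sub>R y))"
    proof (rule bint_scale[OF R continuous_on_subset[OF cG]])
      have "R * c < R * 1" using R c by (intro mult_strict_left_mono) auto
      then show "cball 0 (R * c) \<subseteq> ball (0::real^3) R" by auto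
    qed
    also have "bint c (\<lambda>y. G (R *\<^sub>R y)) = bint c (\<lambda>y. v 2 y * Rz a n y + v 3 y * Rz b n y)"
      by (rule bint_cong) (use c Gv in auto)
    also have "\<dots> = bint c (\<lambda>y. v 2 y * Rz a n y) + bint c (\<lambda>y. v 3 y * Rz b n y)"
      by (rule bint_add) (intro continuous_intros comp.cball_cont c Rz_continuous)+
    also have "\<dots> = bint c (\<lambda>y. hom n (v 2) y * Rz a n y) + bint c (\<lambda>y. hom n (v 3) y * Rz b n y)"
      by (simp only: comp.hom_projection[OF Rz_harmonic Rz_scale c])
    also have "\<dots> = bint c ?H"
      by (rule bint_add[symmetric]) (intro continuous_intros comp.hom_cont Rz_continuous)+
    also have "\<dots> = c^3 * bint 1 (\<lambda>y. ?H (c *\<^sub>R y))"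
      using bint_scale[OF c(1) cH, of 1] by (simp only: mult_1_right)
    also have "\<dots> = c^3 * bint 1 (\<lambda>y. c ^ (2 * n) * ?H y)"
    proof -
      have "c ^ (2 * n) = c ^ n * c ^ n" by (simp only: mult_2 power_add)
      then have "?H (c *\<^sub>R y) = c ^ (2 * n) * ?H y" for y
        by (simp only: hom_scale Rz_scale distrib_left mult_ac)
      then show ?thesis by (simp only:)
    qed
    finally show ?thesis by (simp only: bint_cmult power_add mult_ac)
  qed
  let ?c = "\<lambda>k. 1 - 1 / real (k + 2)"
  have "(\<lambda>k. R^3 * (?c k ^ (2 * n + 3) * ?A)) \<longlonglongrightarrow> (LINT x:ball 0 R|lborel. G x)"
  proof -
    have "bint (R * ?c k) G = R^3 * (?c k ^ (2 * n + 3) * ?A)" for k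
      by (rule e) (auto simp: field_simps)
    then show ?thesis using lint_cball_tendsto_ball[OF R G] by (simp only:)
  qed
  moreover have "(\<lambda>k. R^3 * (?c k ^ (2 * n + 3) * ?A)) \<longlonglongrightarrow> R^3 * ((1 - 0) ^ (2 * n + 3) * ?A)"
  proof -
    have "(\<lambda>k. 1 / real (k + 2)) \<longlonglongrightarrow> 0"
      using LIMSEQ_ignore_initial_segment[OF lim_1_over_n, of 2] by simp
    then show ?thesis by (intro tendsto_intros)
  qed
  ultimately have "R^3 * ((1 - 0) ^ (2 * n + 3) * ?A) = 0"
    unfolding z by (rule LIMSEQ_unique[rotated])
  then show ?thesis using R by simp
qed

section \<open>From monogenic functions on the ball of radius R to Riesz systems on the unit
  ball\<close>

definition riesz_of :: "(real^3 \<Rightarrow> quat) \<Rightarrow> real \<Rightarrow> 3 \<Rightarrow> real^3 \<Rightarrow> real" where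
  "riesz_of f R j y = (if j = 1 then f (R *\<^sub>R y) $ 1 else if j = 2 then - f (R *\<^sub>R y) $ 2 else - f (R *\<^sub>R y) $ 3)"

lemma riesz_of_simps:
  "riesz_of f R 1 = (\<lambda>y. f (R *\<^sub>R y) $ 1)"
  "riesz_of f R 2 = (\<lambda>y. - f (R *\<^sub>R y) $ 2)"
  "riesz_of f R 3 = (\<lambda>y. - f (R *\<^sub>R y) $ 3)"
  by (auto simp: riesz_of_def fun_eq_iff)

lemma monogenic_riesz:
  assumes R: "R > 0" and f: "monogenic_on (ball 0 R) f"
  shows "riesz (ball 0 1) (riesz_of f R)"
proof -
  let ?k = "\<lambda>k x. f x $ k"
  have dif: "f differentiable (at x)" if "x \<in> ball 0 R" for x
    using f that by (simp add: monogenic_on_def C1_on_def)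
  have c1: "C1 (ball 0 R) (?k k)" for k
    unfolding C1_def
  proof (intro conjI ballI allI)
    show "?k k differentiable at x" if "x \<in> ball 0 R" for x
      by (rule partial_nth(2)[OF dif[OF that]])
    show "continuous_on (ball 0 R) (pd i (?k k))" for i
    proof -
      have "continuous_on (ball 0 R) (\<lambda>x. partial i f x $ k)"
        using f by (intro continuous_intros) (simp add: monogenic_on_def C1_on_def)
      then show ?thesis
        by (rule continuous_on_cong[THEN iffD1, rotated 2]) (auto simp: partial_nth(1)[OF dif])
    qed
  qed
  have inR: "R *\<^sub>R y \<in> ball 0 R" if "y \<in> ball 0 1" for y :: "real^3"
    using that R by simp
  have a: "C1 (ball 0 1) (\<lambda>y. f (R *\<^sub>R y) $ k)" for k
    using C1_affine[OF c1[of k], of "ball 0 1" 0 R] inR by simp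
  have p: "pd i (\<lambda>y. f (R *\<^sub>R y) $ k) y = R * pd i (?k k) (R *\<^sub>R y)"
    "(\<lambda>y. f (R *\<^sub>R y) $ k) differentiable (at y)" if "y \<in> ball 0 1" for i k y
    using pd_affine[where a=0 and t=R and x=y and f="?k k"] C1_differentiable[OF c1[of k] inR[OF that]] by simp_all
  \<comment> \<open>The four components of \<open>Dop f x = 0\<close> without the derivatives of the
    vanishing fourth component: the first is the zero trace, the others are the symmetry.\<close>
  have E: "pd 1 (?k 1) x = pd 2 (?k 2) x + pd 3 (?k 3) x" "pd 1 (?k 2) x = - pd 2 (?k 1) x"
    "pd 1 (?k 3) x = - pd 3 (?k 1) x" "pd 2 (?k 3) x = pd 3 (?k 2) x" if x: "x \<in> ball 0 R" for x
  proof -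
    have z: "pd i (?k 4) x = 0" for i
    proof -
      have "pd i (?k 4) x = pd i (\<lambda>x. 0) x"
        by (rule pd_cong[OF open_ball x]) (use f in \<open>auto simp: monogenic_on_def A_valued_on_def\<close>)
      then show ?thesis by simp
    qed
    have "Dop f x = 0" using f x by (simp add: monogenic_on_def)
    then have "\<forall>k. Dop f x $ k = 0" by simp
    then show "pd 1 (?k 1) x = pd 2 (?k 2) x + pd 3 (?k 3) x" "pd 1 (?k 2) x = - pd 2 (?k 1) x"
      "pd 1 (?k 3) x = - pd 3 (?k 1) x" "pd 2 (?k 3) x = pd 3 (?k 2) x"
      by (simp_all add: forall_4 Dop_def qmult_def qe1_def qe2_def partial_nth(1)[OF dif[OF x]] z)
  qed
  have pm: "pd i (\<lambda>y. - f (R *\<^sub>R y) $ k) y = - R * pd i (?k k) (R *\<^sub>R y)" if "y \<in> ball 0 1" for i k y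
    using pd_minus[OF p(2)[OF that, of k]] p(1)[OF that] by simp
  show ?thesis
    unfolding riesz_def forall_3 sum_3 riesz_of_simps
    using a C1_minus[OF a] inR
    by (auto simp: p(1) pm E algebra_simps)
qed

lemma norm_riesz_of:
  assumes "f (R *\<^sub>R y) $ 4 = 0" "f 0 $ 4 = 0"
  shows "norm (\<chi> j. riesz_of f R j y - riesz_of f R j 0) = norm (f (R *\<^sub>R y) - f 0)"
proof -
  have "(- a - - b)\<^sup>2 = (a - b)\<^sup>2" for a b :: real
    by (simp add: power2_eq_square algebra_simps)
  then show ?thesis
    unfolding norm_vec_def L2_set_def using assms by (simp add: sum_3 sum_4 riesz_of_def)
qed

lemma Sc_qconj_mult: "Sc (qconj p \<odot> q) = p$1 * q$1 + p$2 * q$2 + p$3 * q$3 + p$4 * q$4"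
  by (simp add: Sc_def qconj_def qmult_def)

lemma monogenic_riesz_ball:
  assumes R: "R > 0" and L2: "L2_ball R f" and f: "monogenic_on (ball 0 R) f"
    and orth: "\<forall>n\<ge>1. L2_inner R f (Xdag n) = 0 \<and> L2_inner R f (Ydag n) = 0"
    and S: "\<And>x. x \<in> ball 0 R \<Longrightarrow> \<bar>Sc (f x - f 0)\<bar> \<le> S"
  shows "riesz_ball (riesz_of f R) S"
proof -
  let ?v = "riesz_of f R"
  interpret riesz_unit ?v by standard (rule monogenic_riesz[OF R f])
  have cf: "continuous_on (ball 0 R) f"
    using f by (auto simp: monogenic_on_def C1_on_def intro!: continuous_at_imp_continuous_on differentiable_imp_continuous_within)
  \<comment> \<open>Square integrability enters through \<open>|f x $ k| <= 1 + |f x|^2\<close>; the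
    powers of \<open>zc\<close> are bounded on the ball.\<close>
  have int: "set_integrable lborel (ball 0 R) (\<lambda>x. f x $ 2 * Rz a n x + f x $ 3 * Rz b n x)"
    (is "set_integrable _ _ ?g") for a b n
  proof -
    have cg: "continuous_on (ball 0 R) ?g" by (intro continuous_intros cf Rz_continuous)
    define M where "M = max (cmod a) (cmod b) * R ^ n"
    have M: "\<bar>Rz a n x\<bar> \<le> M" "\<bar>Rz b n x\<bar> \<le> M" if "x \<in> ball 0 R" for x
    proof -
      have "\<bar>Rz k n x\<bar> \<le> cmod k * R ^ n" for k
      proof -
        have "(cmod (zc x))\<^sup>2 \<le> (norm x)\<^sup>2"
          by (simp add: norm_vec_def L2_set_def sum_3 cmod_power2 zc_def)
        then have "cmod (zc x) \<le> norm x" by (rule power2_le_imp_le) simp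
        then have "cmod (zc x) \<le> R" using that by simp
        then have "cmod (k * zc x ^ n) \<le> cmod k * R ^ n"
          by (simp add: norm_mult norm_power mult_left_mono power_mono)
        then show ?thesis unfolding Rz_def using abs_Re_le_cmod order_trans by blast
      qed
      moreover have "cmod a * R ^ n \<le> M" "cmod b * R ^ n \<le> M"
        unfolding M_def using R by (auto intro!: mult_right_mono)
      ultimately show "\<bar>Rz a n x\<bar> \<le> M" "\<bar>Rz b n x\<bar> \<le> M" using order_trans by blast+
    qed
    show ?thesis
    proof (rule set_integrable_bound[where f="\<lambda>x. 2 * M * (1 + (norm (f x))\<^sup>2)"])
      have "set_integrable lborel (ball (0::real^3) R) (\<lambda>x. 1::real)"
        using emeasure_bounded_finite[of "ball (0::real^3) R"] by (simp add: set_integrable_def)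
      then show "set_integrable lborel (ball 0 R) (\<lambda>x. 2 * M * (1 + (norm (f x))\<^sup>2))"
        using L2 by (intro set_integrable_mult_right set_integral_add(1)) (auto simp: L2_ball_def)
      show "set_borel_measurable lborel (ball 0 R) ?g"
        using borel_measurable_continuous_on_indicator[OF _ cg] by (simp add: set_borel_measurable_def)
      have "norm (?g x) \<le> norm (2 * M * (1 + (norm (f x))\<^sup>2))" if x: "x \<in> ball 0 R" for x
      proof -
        have M0: "M \<ge> 0" using M(1)[OF x] by linarith
        have s: "norm (f x) \<le> 1 + (norm (f x))\<^sup>2"
        proof -
          have "0 \<le> (norm (f x) - 1/2)\<^sup>2" by simp
          then show ?thesis by (simp add: power2_eq_square algebra_simps)
        qed
        have fk: "\<bar>f x $ k\<bar> \<le> 1 + (norm (f x))\<^sup>2" for k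
          using component_le_norm_cart[of "f x" k] s by linarith
        have "\<bar>?g x\<bar> \<le> \<bar>f x $ 2\<bar> * \<bar>Rz a n x\<bar> + \<bar>f x $ 3\<bar> * \<bar>Rz b n x\<bar>"
          by (simp add: abs_mult[symmetric])
        also have "\<dots> \<le> (1 + (norm (f x))\<^sup>2) * M + (1 + (norm (f x))\<^sup>2) * M"
          by (intro add_mono mult_mono fk M x) auto
        also have "\<dots> = norm (2 * M * (1 + (norm (f x))\<^sup>2))" using M0 by (simp add: algebra_simps abs_mult)
        finally show ?thesis by simp
      qed
      then show "AE x in lborel. x \<in> ball 0 R \<longrightarrow> norm (?g x) \<le> norm (2 * M * (1 + (norm (f x))\<^sup>2))"
        by (intro AE_I2 impI)
    qed
  qed
  have mom: "bint 1 (\<lambda>y. hom n (?v 2) y * Rz a n y + hom n (?v 3) y * Rz b n y) = 0"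
    if z: "(LINT x:ball 0 R|lborel. f x $ 2 * Rz a n x + f x $ 3 * Rz b n x) = 0" for a b n
  proof (rule hom_moment[OF R])
    \<comment> \<open>The sign matches \<open>riesz_of\<close>, and the power of \<open>R\<close>
      cancels the scaling of \<open>Rz\<close>.\<close>
    let ?k = "- (1 / R ^ n)"
    let ?G = "\<lambda>x. ?k * (f x $ 2 * Rz a n x + f x $ 3 * Rz b n x)"
    show "set_integrable lborel (ball 0 R) ?G" by (intro set_integrable_mult_right int)
    show "continuous_on (ball 0 R) ?G" by (intro continuous_intros cf Rz_continuous)
    show "(LINT x:ball 0 R|lborel. ?G x) = 0" unfolding set_integral_mult_right z by simp
    show "?G (R *\<^sub>R y) = ?v 2 y * Rz a n y + ?v 3 y * Rz b n y" for y
      using R by (simp add: Rz_scale riesz_of_def field_simps)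
  qed
  show ?thesis
  proof
    fix y :: "real^3" assume "y \<in> ball 0 1"
    then show "\<bar>?v 1 y - ?v 1 0\<bar> \<le> S"
      using S[of "R *\<^sub>R y"] R by (simp add: riesz_of_def Sc_def)
  next
    fix n :: nat assume n: "n \<ge> 1"
    obtain \<kappa> where \<kappa>: "\<kappa> > 0"
      "\<And>x. Xdag n x = \<kappa> *\<^sub>R Q 0 (- Rz 1 n x) (Rz (- \<i>) n x) 0"
      "\<And>x. Ydag n x = \<kappa> *\<^sub>R Q 0 (- Rz (- \<i>) n x) (- Rz 1 n x) 0"
      using hyperholomorphic_constants[of n] by blast
    have Rm: "Rz (- k) n x = - Rz k n x" for k x by (simp add: Rz_def)
    have "L2_inner R f (Xdag n) = (LINT x:ball 0 R|lborel. (- \<kappa>) * (f x $ 2 * Rz 1 n x + f x $ 3 * Rz \<i> n x))"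
      unfolding L2_inner_def Sc_qconj_mult \<kappa> by (simp add: Rm algebra_simps)
    then have "(LINT x:ball 0 R|lborel. f x $ 2 * Rz 1 n x + f x $ 3 * Rz \<i> n x) = 0"
      using orth n \<kappa>(1) unfolding set_integral_mult_right by simp
    from mom[OF this] show "bint 1 (\<lambda>y. hom n (?v 2) y * Rz 1 n y - hom n (?v 3) y * Rz (- \<i>) n y) = 0"
      by (simp add: Rm del: hom.simps)
    have "L2_inner R f (Ydag n) = (LINT x:ball 0 R|lborel. (- \<kappa>) * (f x $ 2 * Rz (- \<i>) n x + f x $ 3 * Rz 1 n x))"
      unfolding L2_inner_def Sc_qconj_mult \<kappa> by (simp add: algebra_simps)
    then have "(LINT x:ball 0 R|lborel. f x $ 2 * Rz (- \<i>) n x + f x $ 3 * Rz 1 n x) = 0"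
      using orth n \<kappa>(1) unfolding set_integral_mult_right by simp
    from mom[OF this] show "bint 1 (\<lambda>y. hom n (?v 2) y * Rz (- \<i>) n y + hom n (?v 3) y * Rz 1 n y) = 0" .
  qed
qed

lemma bound_constant_scale:
  assumes R: "(R::real) > 0" and r: "0 \<le> r" "r < R"
  shows "2 * (r / R) * ((3 - r / R) * (3 - r / R + (r / R)\<^sup>2)) / (1 - r / R)^4 = 2 * r * Acoef r R / (R - r)^4"
proof -
  define \<rho> where "\<rho> = r / R"
  have r': "r = \<rho> * R" using R by (simp add: \<rho>_def)
  have \<rho>: "1 - \<rho> \<noteq> 0" using r R by (simp add: \<rho>_def field_simps)
  have "2 * r * Acoef r R = R^4 * (2 * \<rho> * ((3 - \<rho>) * (3 - \<rho> + \<rho>\<^sup>2)))"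
    unfolding r' Acoef_def by (simp add: eval_nat_numeral algebra_simps)
  moreover have "(R - r)^4 = R^4 * (1 - \<rho>)^4"
    unfolding r' power_mult_distrib[symmetric] by (simp add: algebra_simps)
  ultimately have "2 * r * Acoef r R / (R - r)^4
      = (R^4 * (2 * \<rho> * ((3 - \<rho>) * (3 - \<rho> + \<rho>\<^sup>2)))) / (R^4 * (1 - \<rho>)^4)"
    by (simp only:)
  also have "\<dots> = 2 * \<rho> * ((3 - \<rho>) * (3 - \<rho> + \<rho>\<^sup>2)) / (1 - \<rho>)^4"
    by (rule mult_divide_mult_cancel_left) (use R in simp)
  finally show ?thesis unfolding \<rho>_def ..
qed

theorem theorem3:
  fixes f :: "real^3 \<Rightarrow> quat" and R r :: real
  assumes "R > 0"
    and "L2_ball R f"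
    and "monogenic_on (ball 0 R) f"
    and "\<forall>n\<ge>1. L2_inner R f (Xdag n) = 0 \<and> L2_inner R f (Ydag n) = 0"
    and "0 \<le> r" and "r < R"
  shows "ereal (maxmod (\<lambda>x. f x - f 0) r)
    \<le> ereal (sqrt (2/3) * (2 * r * Acoef r R) / (R - r) ^ 4)
        * (SUP \<xi>\<in>ball 0 R. ereal \<bar>Sc (f \<xi> - f 0)\<bar>)"
proof -
  let ?C = "sqrt (2/3) * (2 * r * Acoef r R) / (R - r) ^ 4"
  let ?B = "SUP \<xi>\<in>ball 0 R. ereal \<bar>Sc (f \<xi> - f 0)\<bar>"
  have up: "ereal \<bar>Sc (f x - f 0)\<bar> \<le> ?B" if "x \<in> ball 0 R" for x
    by (rule SUP_upper[OF that])
  have ne: "sphere (0::real^3) r \<noteq> {}"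
    using assms(5) by (auto intro!: exI[of _ "r *\<^sub>R axis 1 1"])
  have "ereal 0 \<le> ?B" using up[of 0] assms(1) by (simp add: Sc_def)
  then have B0: "?B \<ge> 0" by (simp only: zero_ereal_def)
  have A: "Acoef r R > 0 \<and> (R - r)^4 > 0"
  proof
    have "3 * R\<^sup>2 - R * r + r\<^sup>2 = 2 * R\<^sup>2 + R * (R - r) + r\<^sup>2" by (simp add: power2_eq_square algebra_simps)
    moreover have "\<dots> > 0" using assms by (intro add_pos_nonneg) auto
    ultimately show "Acoef r R > 0" unfolding Acoef_def using assms by simp
  qed (use assms in simp)
  show ?thesis
  proof (cases "?B = \<infinity>")
    case True
    \<comment> \<open>For \<open>r > 0\<close> the constant is positive and the right side infinite.
      For \<open>r = 0\<close> it is zero times infinity, which is \<open>0\<close> in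
      \<open>ereal\<close>, and the left side is \<open>0\<close> as well.\<close>
    show ?thesis
    proof (cases "r = 0")
      case True
      then have "maxmod (\<lambda>x. f x - f 0) r = 0" by (simp add: maxmod_def)
      with True show ?thesis by (simp add: zero_ereal_def[symmetric])
    next
      case False
      then have "?C > 0" using A assms by simp
      moreover have "ereal K * \<infinity> = \<infinity>" if "K > 0" for K using that by simp
      ultimately have "ereal ?C * ?B = \<infinity>" unfolding \<open>?B = \<infinity>\<close> by blast
      then show ?thesis by (simp only: ereal_less_eq(1))
    qed
  next
    case False
    with B0 obtain S where S: "?B = ereal S" by (cases ?B) auto
    interpret riesz_ball "riesz_of f R" S
      by (rule monogenic_riesz_ball[OF assms(1-4)]) (use up S in simp)
    have "norm (f x - f 0) \<le> ?C * S" if x: "x \<in> sphere 0 r" for x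
    proof -
      define y where "y = (1 / R) *\<^sub>R x"
      have xy: "x = R *\<^sub>R y" and ny: "norm y = r / R" using assms x by (auto simp: y_def)
      have "f z $ 4 = 0" if "norm z < R" for z
        using assms(3) that by (simp add: monogenic_on_def A_valued_on_def)
      then have "norm (f x - f 0) = norm (\<chi> j. riesz_of f R j y - riesz_of f R j 0)"
        unfolding xy using assms ny by (intro norm_riesz_of[symmetric]) auto
      also have "\<dots> \<le> sqrt (2/3) * (2 * norm y * ((3 - norm y) * (3 - norm y + (norm y)\<^sup>2)) / (1 - norm y)^4) * S"
        by (rule unit_ball_bound) (use assms ny in simp)
      also have "\<dots> = ?C * S"
        unfolding ny bound_constant_scale[OF assms(1,5,6)] by simp
      finally show ?thesis .
    qed
    then have "maxmod (\<lambda>x. f x - f 0) r \<le> ?C * S"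
      unfolding maxmod_def by (intro cSUP_least ne)
    then show ?thesis unfolding S by simp
  qed
qed

end
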